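(* Let $A:\mathcal{U}$ be a bridge-discrete type. Then there is a family of equivalences \[ \Pi_{a,a':A}\Big(\big(\Pi_{X:A\to\mathcal{U}}X\,a\to X\,a'\big)\simeq\mathsf{Path}_A(a,a')\Big). \]
   Context: We work in parametric cubical type theory: Martin-Löf type theory with $\Sigma$-, $\Pi$-types and a univalent universe $\mathcal{U}$ of Kan types, extended by structural path dimensions (variables $x,y,z$, constants $0,1$) with path types $\mathsf{Path}_{x.A}(M_0,M_1)$ and Kan operations including coercion $\mathsf{coe}^{r\to s}_{z.A}$, so paths behave like homotopy-type-theoretic identity types (function extensionality, univalence, $\mathsf{isEquiv}$, $\simeq$ as there), and by substructural bridge dimensions (weakening and exchange, no contraction; variables $\mathbf{x},\dots$, constants $\mathbf{0},\mathbf{1}$) with $\mathsf{Bridge}_{\mathbf{x}.A}(M_{\mathbf{0}},M_{\mathbf{1}})$ having elements $\lambda^{\mathbf{x}}P$, application to fresh dimensions, $\beta$, endpoint rules and $\eta$; $\mathsf{Bridge}_A$ is the case of constant $A$. The theory has Gel-types $\mathsf{Gel}_{\mathbf{r}}(A,B,a.b.R)$ (equal to $A$ at $\mathbf{0}$ and $B$ at $\mathbf{1}$, constructor $\mathsf{gel}_{\mathbf{r}}(M,N,P)$ for $P:R(M,N)$, eliminator $\mathsf{ungel}(\mathbf{x}.Q):R(Q[\mathbf{0}/\mathbf{x}],Q[\mathbf{1}/\mathbf{x}])$, $\beta,\eta$), an $\mathsf{extent}$ operator (case analysis on a bridge dimension), and $\mathcal{U}$ is closed under these. For $P:\mathsf{Path}_A(M,N)$,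 $\mathsf{loosen}_A(P):=\mathsf{coe}^{0\to1}_{z.\mathsf{Bridge}_A(P@0,P@z)}(\lambda^{\_}.P@0)$; $A$ is bridge-discrete when $\Pi_{a,a':A}\mathsf{isEquiv}(\lambda p.\mathsf{loosen}_A(p):\mathsf{Path}_A(a,a')\to\mathsf{Bridge}_A(a,a'))$ is inhabited. *)

theory Defs
  imports Main
begin

text \<open>
  A deep embedding of parametric cubical type theory: raw de Bruijn syntax, and the judgments as
  mutually inductive predicates.  Types and terms share one syntactic category (universe a la
  Russell), which also contains the two sorts of dimension terms.
\<close>

section \<open>Raw syntax\<close>

text \<open>\<open>Pth\<close> is the sort of structural path dimensions, \<open>Brd\<close> that of substructural bridge dimensions.\<close>

datatype dsort = Pth | Brd

text \<open>
  Binders, besides the evident ones: \<open>Coe A r s M\<close> binds a path dimension in \<open>A\<close>; \<open>Gel r A B R\<close> binds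
  \<open>a\<close> (index 1) and \<open>b\<close> (index 0) in \<open>R\<close>; \<open>Ungel Q\<close> binds a bridge dimension;
  \<open>Extent r M N0 N1 N\<close> binds one variable in each of \<open>N0\<close> and \<open>N1\<close>, and \<open>a0\<close>, \<open>a1\<close>, \<open>c\<close> (indices 2, 1, 0) in
  \<open>N\<close>.  A constraint hypothesis occupies an index too, although no well-formed term refers to it.
  Hence each tube \<open>(i, u, v, N)\<close> of \<open>HCom\<close>, with constraint \<open>u = v\<close> between dimensions of sort \<open>i\<close>,
  binds two indices in \<open>N\<close>, the constraint (1) and the path dimension (0); and \<open>V r A B E\<close> binds
  the constraint \<open>r = 0\<close> in \<open>A\<close> and \<open>E\<close>, \<open>VIn r M N\<close> binds it in \<open>M\<close>, and \<open>VProj r P E\<close> in \<open>E\<close>.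
\<close>

datatype tm =
    Var nat
  | End dsort bool
  | Univ
  | Pi tm tm | Lam tm | App tm tm
  | Sig tm tm | Pr tm tm | Fst tm | Snd tm
  | PathT tm tm tm | PLam tm | PApp tm tm
  | Coe tm tm tm tm
  | HCom tm tm tm tm "(dsort \<times> tm \<times> tm \<times> tm) list"
  | V tm tm tm tm | VIn tm tm tm | VProj tm tm tm
  | BridgeT tm tm tm | BLam tm | BApp tm tm
  | Gel tm tm tm tm | GelIn tm tm tm tm | Ungel tm
  | Extent tm tm tm tm tm

abbreviation I0 :: tm where "I0 \<equiv> End Pth False"
abbreviation I1 :: tm where "I1 \<equiv> End Pth True"
abbreviation B0 :: tm where "B0 \<equiv> End Brd False"
abbreviation B1 :: tm where "B1 \<equiv> End Brd True"

text \<open>The term put in the slot of a constraint by a substitution; its choice is immaterial.\<close>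
abbreviation (input) Triv :: tm where "Triv \<equiv> I0"

definition upr :: "(nat \<Rightarrow> nat) \<Rightarrow> nat \<Rightarrow> nat" where
  "upr f = case_nat 0 (\<lambda>i. Suc (f i))"

fun ren :: "(nat \<Rightarrow> nat) \<Rightarrow> tm \<Rightarrow> tm" where
  "ren f (Var i) = Var (f i)"
| "ren f (End i e) = End i e"
| "ren f Univ = Univ"
| "ren f (Pi A B) = Pi (ren f A) (ren (upr f) B)"
| "ren f (Lam M) = Lam (ren (upr f) M)"
| "ren f (App M N) = App (ren f M) (ren f N)"
| "ren f (Sig A B) = Sig (ren f A) (ren (upr f) B)"
| "ren f (Pr M N) = Pr (ren f M) (ren f N)"
| "ren f (Fst M) = Fst (ren f M)"
| "ren f (Snd M) = Snd (ren f M)"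
| "ren f (PathT A M N) = PathT (ren (upr f) A) (ren f M) (ren f N)"
| "ren f (PLam M) = PLam (ren (upr f) M)"
| "ren f (PApp M r) = PApp (ren f M) (ren f r)"
| "ren f (Coe A r s M) = Coe (ren (upr f) A) (ren f r) (ren f s) (ren f M)"
| "ren f (HCom r s A M T) = HCom (ren f r) (ren f s) (ren f A) (ren f M)
     (map (\<lambda>(i, u, v, N). (i, ren f u, ren f v, ren (upr (upr f)) N)) T)"
| "ren f (V r A B E) = V (ren f r) (ren (upr f) A) (ren f B) (ren (upr f) E)"
| "ren f (VIn r M N) = VIn (ren f r) (ren (upr f) M) (ren f N)"
| "ren f (VProj r P E) = VProj (ren f r) (ren f P) (ren (upr f) E)"
| "ren f (BridgeT A M N) = BridgeT (ren (upr f) A) (ren f M) (ren f N)"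
| "ren f (BLam M) = BLam (ren (upr f) M)"
| "ren f (BApp M r) = BApp (ren f M) (ren f r)"
| "ren f (Gel r A B R) = Gel (ren f r) (ren f A) (ren f B) (ren (upr (upr f)) R)"
| "ren f (GelIn r M N P) = GelIn (ren f r) (ren f M) (ren f N) (ren f P)"
| "ren f (Ungel Q) = Ungel (ren (upr f) Q)"
| "ren f (Extent r M N0 N1 N) = Extent (ren f r) (ren f M) (ren (upr f) N0) (ren (upr f) N1)
     (ren (upr (upr (upr f))) N)"

abbreviation wk :: "nat \<Rightarrow> tm \<Rightarrow> tm" where
  "wk n \<equiv> ren (\<lambda>i. i + n)"

definition up :: "(nat \<Rightarrow> tm) \<Rightarrow> nat \<Rightarrow> tm" where
  "up \<sigma> = case_nat (Var 0) (\<lambda>i. wk 1 (\<sigma> i))"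

fun sub :: "(nat \<Rightarrow> tm) \<Rightarrow> tm \<Rightarrow> tm" where
  "sub \<sigma> (Var i) = \<sigma> i"
| "sub \<sigma> (End i e) = End i e"
| "sub \<sigma> Univ = Univ"
| "sub \<sigma> (Pi A B) = Pi (sub \<sigma> A) (sub (up \<sigma>) B)"
| "sub \<sigma> (Lam M) = Lam (sub (up \<sigma>) M)"
| "sub \<sigma> (App M N) = App (sub \<sigma> M) (sub \<sigma> N)"
| "sub \<sigma> (Sig A B) = Sig (sub \<sigma> A) (sub (up \<sigma>) B)"
| "sub \<sigma> (Pr M N) = Pr (sub \<sigma> M) (sub \<sigma> N)"
| "sub \<sigma> (Fst M) = Fst (sub \<sigma> M)"
| "sub \<sigma> (Snd M) = Snd (sub \<sigma> M)"
| "sub \<sigma> (PathT A M N) = PathT (sub (up \<sigma>) A) (sub \<sigma> M) (sub \<sigma> N)"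
| "sub \<sigma> (PLam M) = PLam (sub (up \<sigma>) M)"
| "sub \<sigma> (PApp M r) = PApp (sub \<sigma> M) (sub \<sigma> r)"
| "sub \<sigma> (Coe A r s M) = Coe (sub (up \<sigma>) A) (sub \<sigma> r) (sub \<sigma> s) (sub \<sigma> M)"
| "sub \<sigma> (HCom r s A M T) = HCom (sub \<sigma> r) (sub \<sigma> s) (sub \<sigma> A) (sub \<sigma> M)
     (map (\<lambda>(i, u, v, N). (i, sub \<sigma> u, sub \<sigma> v, sub (up (up \<sigma>)) N)) T)"
| "sub \<sigma> (V r A B E) = V (sub \<sigma> r) (sub (up \<sigma>) A) (sub \<sigma> B) (sub (up \<sigma>) E)"
| "sub \<sigma> (VIn r M N) = VIn (sub \<sigma> r) (sub (up \<sigma>) M) (sub \<sigma> N)"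
| "sub \<sigma> (VProj r P E) = VProj (sub \<sigma> r) (sub \<sigma> P) (sub (up \<sigma>) E)"
| "sub \<sigma> (BridgeT A M N) = BridgeT (sub (up \<sigma>) A) (sub \<sigma> M) (sub \<sigma> N)"
| "sub \<sigma> (BLam M) = BLam (sub (up \<sigma>) M)"
| "sub \<sigma> (BApp M r) = BApp (sub \<sigma> M) (sub \<sigma> r)"
| "sub \<sigma> (Gel r A B R) = Gel (sub \<sigma> r) (sub \<sigma> A) (sub \<sigma> B) (sub (up (up \<sigma>)) R)"
| "sub \<sigma> (GelIn r M N P) = GelIn (sub \<sigma> r) (sub \<sigma> M) (sub \<sigma> N) (sub \<sigma> P)"
| "sub \<sigma> (Ungel Q) = Ungel (sub (up \<sigma>) Q)"
| "sub \<sigma> (Extent r M N0 N1 N) = Extent (sub \<sigma> r) (sub \<sigma> M) (sub (up \<sigma>) N0) (sub (up \<sigma>) N1)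
     (sub (up (up (up \<sigma>))) N)"

text \<open>\<open>inst [M\<^sub>0, \<dots>, M\<^sub>k] N\<close> substitutes \<open>M\<^sub>i\<close> for index \<open>i\<close>.\<close>
abbreviation scons :: "tm list \<Rightarrow> (nat \<Rightarrow> tm) \<Rightarrow> nat \<Rightarrow> tm" where
  "scons Ms \<sigma> \<equiv> (\<lambda>i. if i < length Ms then Ms ! i else \<sigma> (i - length Ms))"

abbreviation inst :: "tm list \<Rightarrow> tm \<Rightarrow> tm" where
  "inst Ms \<equiv> sub (scons Ms Var)"

section \<open>Derived types\<close>

definition Arrow :: "tm \<Rightarrow> tm \<Rightarrow> tm" where
  "Arrow A B = Pi A (wk 1 B)"

definition Path :: "tm \<Rightarrow> tm \<Rightarrow> tm \<Rightarrow> tm" where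
  "Path A M N = PathT (wk 1 A) M N"

definition Bridge :: "tm \<Rightarrow> tm \<Rightarrow> tm \<Rightarrow> tm" where
  "Bridge A M N = BridgeT (wk 1 A) M N"

definition isContr :: "tm \<Rightarrow> tm" where
  "isContr A = Sig A (Pi (wk 1 A) (Path (wk 2 A) (Var 1) (Var 0)))"

definition Fiber :: "tm \<Rightarrow> tm \<Rightarrow> tm \<Rightarrow> tm \<Rightarrow> tm" where
  "Fiber A B F N = Sig A (Path (wk 1 B) (App (wk 1 F) (Var 0)) (wk 1 N))"

definition isEquiv :: "tm \<Rightarrow> tm \<Rightarrow> tm \<Rightarrow> tm" where
  "isEquiv A B F = Pi B (isContr (Fiber (wk 1 A) (wk 1 B) (wk 1 F) (Var 0)))"

definition Equiv :: "tm \<Rightarrow> tm \<Rightarrow> tm" where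
  "Equiv A B = Sig (Arrow A B) (isEquiv (wk 1 A) (wk 1 B) (Var 0))"

section \<open>Contexts and dimensions\<close>

text \<open>
  The most recent hypothesis is the head of the list.  \<open>Hid\<close> marks a hypothesis that has been removed
  by a restriction \<open>cut\<close>: it cannot be used, but keeps its place so that indices do not change.
\<close>

datatype entry = Tm tm | Dim dsort | Cs dsort tm tm | Hid

type_synonym ctx = "entry list"

text \<open>
  \<open>cut \<Gamma> r\<close> is the part of \<open>\<Gamma>\<close> that is fresh for the bridge dimension \<open>r\<close>.  For a constant it is
  all of \<open>\<Gamma>\<close>.  For a variable, that variable is removed together with everything introduced after it
  that may depend on it, namely later term variables and the constraints mentioning it; other
  dimension variables are apart from it and remain.
\<close>

fun restrict :: "nat \<Rightarrow> ctx \<Rightarrow> ctx" where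
  "restrict k [] = []"
| "restrict 0 (e # \<Gamma>) = Hid # \<Gamma>"
| "restrict (Suc k) (e # \<Gamma>) =
     (case e of
        Tm A \<Rightarrow> Hid
      | Cs i r s \<Rightarrow> if r = Var k \<or> s = Var k then Hid else Cs i r s
      | Dim i \<Rightarrow> Dim i
      | Hid \<Rightarrow> Hid) # restrict k \<Gamma>"

definition cut :: "ctx \<Rightarrow> tm \<Rightarrow> ctx" where
  "cut \<Gamma> r = (case r of Var k \<Rightarrow> restrict k \<Gamma> | _ \<Rightarrow> \<Gamma>)"

inductive dim :: "ctx \<Rightarrow> dsort \<Rightarrow> tm \<Rightarrow> bool" where
  dim_end: "dim \<Gamma> i (End i e)"
| dim_var: "k < length \<Gamma> \<Longrightarrow> \<Gamma> ! k = Dim i \<Longrightarrow> dim \<Gamma> i (Var k)"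

text \<open>Path constraints are arbitrary equations \<open>r = s\<close>; bridge constraints have the form \<open>r = \<epsilon>\<close>.\<close>
definition cstr :: "ctx \<Rightarrow> dsort \<Rightarrow> tm \<Rightarrow> tm \<Rightarrow> bool" where
  "cstr \<Gamma> i r s \<longleftrightarrow> dim \<Gamma> i r \<and> dim \<Gamma> i s \<and> (i = Brd \<longrightarrow> (\<exists>e. s = End Brd e))"

inductive deq :: "ctx \<Rightarrow> dsort \<Rightarrow> tm \<Rightarrow> tm \<Rightarrow> bool" where
  deq_refl: "dim \<Gamma> i r \<Longrightarrow> deq \<Gamma> i r r"
| deq_sym: "deq \<Gamma> i r s \<Longrightarrow> deq \<Gamma> i s r"
| deq_trans: "deq \<Gamma> i r s \<Longrightarrow> deq \<Gamma> i s t \<Longrightarrow> deq \<Gamma> i r t"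
| deq_hyp: "k < length \<Gamma> \<Longrightarrow> \<Gamma> ! k = Cs i r s \<Longrightarrow> deq \<Gamma> i (wk (Suc k) r) (wk (Suc k) s)"
| deq_absurd: "deq \<Gamma> j (End j False) (End j True) \<Longrightarrow> dim \<Gamma> i r \<Longrightarrow> dim \<Gamma> i s \<Longrightarrow> deq \<Gamma> i r s"

definition absurd :: "ctx \<Rightarrow> bool" where
  "absurd \<Gamma> \<longleftrightarrow> (\<exists>j. deq \<Gamma> j (End j False) (End j True))"

section \<open>Judgments\<close>

text \<open>
  Only equality judgments are primitive; \<open>M\<close> is a term of type \<open>A\<close> when \<open>M \<doteq> M \<Colon> A\<close>, and similarly for types
  and substitutions.  So each congruence rule is also the formation or introduction rule of the
  construct concerned.

  All types are Kan.  The index of the type judgment is \<open>Sm\<close> for types that are elements of the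
  universe and \<open>Lg\<close> for arbitrary types.

  The last four predicates collect premises shared by several rules: the data of a composition
  problem, of a V-type, of a Gel-type (over the restricted context), and of the clauses
  of \<open>Extent\<close> (likewise over the restricted context).
\<close>

datatype size = Sm | Lg

inductive
  wf :: "ctx \<Rightarrow> bool" (\<open>\<turnstile> _\<close> [50] 50) and
  ty_eq :: "ctx \<Rightarrow> tm \<Rightarrow> tm \<Rightarrow> size \<Rightarrow> bool" (\<open>_ \<turnstile> _ \<doteq> _ type _\<close> [51, 51, 51, 51] 50) and
  tm_eq :: "ctx \<Rightarrow> tm \<Rightarrow> tm \<Rightarrow> tm \<Rightarrow> bool" (\<open>_ \<turnstile> _ \<doteq> _ \<Colon> _\<close> [51, 51, 51, 51] 50) and
  sub_eq :: "ctx \<Rightarrow> (nat \<Rightarrow> tm) \<Rightarrow> (nat \<Rightarrow> tm) \<Rightarrow> ctx \<Rightarrow> bool" (\<open>_ \<turnstile> _ \<doteq> _ \<Rightarrow>\<^sub>s _\<close> [51, 51, 51, 51] 50) and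
  box_eq :: "ctx \<Rightarrow> tm \<Rightarrow> tm \<Rightarrow> tm \<Rightarrow> tm \<Rightarrow> tm \<Rightarrow> tm
     \<Rightarrow> (dsort \<times> tm \<times> tm \<times> tm) list \<Rightarrow> (dsort \<times> tm \<times> tm \<times> tm) list \<Rightarrow> bool" and
  v_eq :: "ctx \<Rightarrow> tm \<Rightarrow> tm \<Rightarrow> tm \<Rightarrow> tm \<Rightarrow> tm \<Rightarrow> tm \<Rightarrow> tm \<Rightarrow> tm \<Rightarrow> size \<Rightarrow> bool" and
  gel_eq :: "ctx \<Rightarrow> tm \<Rightarrow> tm \<Rightarrow> tm \<Rightarrow> tm \<Rightarrow> tm \<Rightarrow> tm \<Rightarrow> size \<Rightarrow> bool" and
  extent_eq :: "ctx \<Rightarrow> tm \<Rightarrow> tm \<Rightarrow> tm \<Rightarrow> tm \<Rightarrow> tm \<Rightarrow> tm \<Rightarrow> tm \<Rightarrow> tm \<Rightarrow> bool"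
where
  wf_nil: "\<turnstile> []"
| wf_tm: "\<turnstile> \<Gamma> \<Longrightarrow> \<Gamma> \<turnstile> A \<doteq> A type Lg \<Longrightarrow> \<turnstile> Tm A # \<Gamma>"
| wf_dim: "\<turnstile> \<Gamma> \<Longrightarrow> \<turnstile> Dim i # \<Gamma>"
| wf_cs: "\<turnstile> \<Gamma> \<Longrightarrow> cstr \<Gamma> i r s \<Longrightarrow> \<turnstile> Cs i r s # \<Gamma>"
| wf_hid: "\<turnstile> \<Gamma> \<Longrightarrow> \<turnstile> Hid # \<Gamma>"

  \<comment> \<open>substitutions: structural, except that a bridge dimension may only be replaced by
      one for which the rest of the substitution is fresh\<close>
| sub_nil: "\<turnstile> \<Delta> \<Longrightarrow> \<Delta> \<turnstile> \<sigma> \<doteq> \<tau> \<Rightarrow>\<^sub>s []"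
| sub_tm: "\<Delta> \<turnstile> \<sigma> \<circ> Suc \<doteq> \<tau> \<circ> Suc \<Rightarrow>\<^sub>s \<Gamma> \<Longrightarrow> \<Gamma> \<turnstile> A \<doteq> A type Lg \<Longrightarrow>
     \<Delta> \<turnstile> \<sigma> 0 \<doteq> \<tau> 0 \<Colon> sub (\<sigma> \<circ> Suc) A \<Longrightarrow> \<Delta> \<turnstile> \<sigma> \<doteq> \<tau> \<Rightarrow>\<^sub>s Tm A # \<Gamma>"
| sub_pth: "\<Delta> \<turnstile> \<sigma> \<circ> Suc \<doteq> \<tau> \<circ> Suc \<Rightarrow>\<^sub>s \<Gamma> \<Longrightarrow> deq \<Delta> Pth (\<sigma> 0) (\<tau> 0) \<Longrightarrow>
     \<Delta> \<turnstile> \<sigma> \<doteq> \<tau> \<Rightarrow>\<^sub>s Dim Pth # \<Gamma>"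
| sub_brd: "\<Delta> \<turnstile> \<sigma> \<circ> Suc \<doteq> \<tau> \<circ> Suc \<Rightarrow>\<^sub>s \<Gamma> \<Longrightarrow>
     cut \<Delta> (\<sigma> 0) \<turnstile> \<sigma> \<circ> Suc \<doteq> \<sigma> \<circ> Suc \<Rightarrow>\<^sub>s \<Gamma> \<Longrightarrow> cut \<Delta> (\<tau> 0) \<turnstile> \<tau> \<circ> Suc \<doteq> \<tau> \<circ> Suc \<Rightarrow>\<^sub>s \<Gamma> \<Longrightarrow>
     deq \<Delta> Brd (\<sigma> 0) (\<tau> 0) \<Longrightarrow> \<Delta> \<turnstile> \<sigma> \<doteq> \<tau> \<Rightarrow>\<^sub>s Dim Brd # \<Gamma>"
| sub_cs: "\<Delta> \<turnstile> \<sigma> \<circ> Suc \<doteq> \<tau> \<circ> Suc \<Rightarrow>\<^sub>s \<Gamma> \<Longrightarrow> cstr \<Gamma> i r s \<Longrightarrow>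
     deq \<Delta> i (sub (\<sigma> \<circ> Suc) r) (sub (\<sigma> \<circ> Suc) s) \<Longrightarrow> \<Delta> \<turnstile> \<sigma> \<doteq> \<tau> \<Rightarrow>\<^sub>s Cs i r s # \<Gamma>"
| sub_hid: "\<Delta> \<turnstile> \<sigma> \<circ> Suc \<doteq> \<tau> \<circ> Suc \<Rightarrow>\<^sub>s \<Gamma> \<Longrightarrow> \<Delta> \<turnstile> \<sigma> \<doteq> \<tau> \<Rightarrow>\<^sub>s Hid # \<Gamma>"

| ty_sym: "\<Gamma> \<turnstile> A \<doteq> B type s \<Longrightarrow> \<Gamma> \<turnstile> B \<doteq> A type s"
| ty_trans: "\<Gamma> \<turnstile> A \<doteq> B type s \<Longrightarrow> \<Gamma> \<turnstile> B \<doteq> C type s \<Longrightarrow> \<Gamma> \<turnstile> A \<doteq> C type s"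
| ty_sub: "\<Gamma> \<turnstile> A \<doteq> B type s \<Longrightarrow> \<Delta> \<turnstile> \<sigma> \<doteq> \<tau> \<Rightarrow>\<^sub>s \<Gamma> \<Longrightarrow> \<Delta> \<turnstile> sub \<sigma> A \<doteq> sub \<tau> B type s"
| ty_absurd: "absurd \<Gamma> \<Longrightarrow> \<Gamma> \<turnstile> A \<doteq> A type s \<Longrightarrow> \<Gamma> \<turnstile> B \<doteq> B type s \<Longrightarrow> \<Gamma> \<turnstile> A \<doteq> B type s"
| tm_sym: "\<Gamma> \<turnstile> M \<doteq> N \<Colon> A \<Longrightarrow> \<Gamma> \<turnstile> N \<doteq> M \<Colon> A"
| tm_trans: "\<Gamma> \<turnstile> M \<doteq> N \<Colon> A \<Longrightarrow> \<Gamma> \<turnstile> N \<doteq> P \<Colon> A \<Longrightarrow> \<Gamma> \<turnstile> M \<doteq> P \<Colon> A"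
| tm_sub: "\<Gamma> \<turnstile> M \<doteq> N \<Colon> A \<Longrightarrow> \<Delta> \<turnstile> \<sigma> \<doteq> \<tau> \<Rightarrow>\<^sub>s \<Gamma> \<Longrightarrow> \<Delta> \<turnstile> sub \<sigma> M \<doteq> sub \<tau> N \<Colon> sub \<sigma> A"
| tm_absurd: "absurd \<Gamma> \<Longrightarrow> \<Gamma> \<turnstile> M \<doteq> M \<Colon> A \<Longrightarrow> \<Gamma> \<turnstile> N \<doteq> N \<Colon> A \<Longrightarrow> \<Gamma> \<turnstile> M \<doteq> N \<Colon> A"
| tm_conv: "\<Gamma> \<turnstile> M \<doteq> N \<Colon> A \<Longrightarrow> \<Gamma> \<turnstile> A \<doteq> B type Lg \<Longrightarrow> \<Gamma> \<turnstile> M \<doteq> N \<Colon> B"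
| tm_var: "\<turnstile> \<Gamma> \<Longrightarrow> k < length \<Gamma> \<Longrightarrow> \<Gamma> ! k = Tm A \<Longrightarrow> \<Gamma> \<turnstile> Var k \<doteq> Var k \<Colon> wk (Suc k) A"

| univ: "\<turnstile> \<Gamma> \<Longrightarrow> \<Gamma> \<turnstile> Univ \<doteq> Univ type Lg"
| univ_el: "\<Gamma> \<turnstile> A \<doteq> B \<Colon> Univ \<Longrightarrow> \<Gamma> \<turnstile> A \<doteq> B type Sm"
| univ_code: "\<Gamma> \<turnstile> A \<doteq> B type Sm \<Longrightarrow> \<Gamma> \<turnstile> A \<doteq> B \<Colon> Univ"
| ty_lift: "\<Gamma> \<turnstile> A \<doteq> B type Sm \<Longrightarrow> \<Gamma> \<turnstile> A \<doteq> B type Lg"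

| pi: "\<Gamma> \<turnstile> A \<doteq> A' type s \<Longrightarrow> Tm A # \<Gamma> \<turnstile> B \<doteq> B' type s \<Longrightarrow> \<Gamma> \<turnstile> Pi A B \<doteq> Pi A' B' type s"
| lam: "\<Gamma> \<turnstile> A \<doteq> A type Lg \<Longrightarrow> Tm A # \<Gamma> \<turnstile> M \<doteq> M' \<Colon> B \<Longrightarrow> \<Gamma> \<turnstile> Lam M \<doteq> Lam M' \<Colon> Pi A B"
| app: "\<Gamma> \<turnstile> M \<doteq> M' \<Colon> Pi A B \<Longrightarrow> \<Gamma> \<turnstile> N \<doteq> N' \<Colon> A \<Longrightarrow> \<Gamma> \<turnstile> App M N \<doteq> App M' N' \<Colon> inst [N] B"
| pi_beta: "Tm A # \<Gamma> \<turnstile> M \<doteq> M \<Colon> B \<Longrightarrow> \<Gamma> \<turnstile> N \<doteq> N \<Colon> A \<Longrightarrow>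
     \<Gamma> \<turnstile> App (Lam M) N \<doteq> inst [N] M \<Colon> inst [N] B"
| pi_eta: "\<Gamma> \<turnstile> M \<doteq> M \<Colon> Pi A B \<Longrightarrow> \<Gamma> \<turnstile> M \<doteq> Lam (App (wk 1 M) (Var 0)) \<Colon> Pi A B"

| sig: "\<Gamma> \<turnstile> A \<doteq> A' type s \<Longrightarrow> Tm A # \<Gamma> \<turnstile> B \<doteq> B' type s \<Longrightarrow> \<Gamma> \<turnstile> Sig A B \<doteq> Sig A' B' type s"
| pair: "Tm A # \<Gamma> \<turnstile> B \<doteq> B type Lg \<Longrightarrow> \<Gamma> \<turnstile> M \<doteq> M' \<Colon> A \<Longrightarrow> \<Gamma> \<turnstile> N \<doteq> N' \<Colon> inst [M] B \<Longrightarrow>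
     \<Gamma> \<turnstile> Pr M N \<doteq> Pr M' N' \<Colon> Sig A B"
| fst: "\<Gamma> \<turnstile> P \<doteq> P' \<Colon> Sig A B \<Longrightarrow> \<Gamma> \<turnstile> Fst P \<doteq> Fst P' \<Colon> A"
| snd: "\<Gamma> \<turnstile> P \<doteq> P' \<Colon> Sig A B \<Longrightarrow> \<Gamma> \<turnstile> Snd P \<doteq> Snd P' \<Colon> inst [Fst P] B"
| fst_beta: "Tm A # \<Gamma> \<turnstile> B \<doteq> B type Lg \<Longrightarrow> \<Gamma> \<turnstile> M \<doteq> M \<Colon> A \<Longrightarrow> \<Gamma> \<turnstile> N \<doteq> N \<Colon> inst [M] B \<Longrightarrow>
     \<Gamma> \<turnstile> Fst (Pr M N) \<doteq> M \<Colon> A"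
| snd_beta: "Tm A # \<Gamma> \<turnstile> B \<doteq> B type Lg \<Longrightarrow> \<Gamma> \<turnstile> M \<doteq> M \<Colon> A \<Longrightarrow> \<Gamma> \<turnstile> N \<doteq> N \<Colon> inst [M] B \<Longrightarrow>
     \<Gamma> \<turnstile> Snd (Pr M N) \<doteq> N \<Colon> inst [M] B"
| sig_eta: "\<Gamma> \<turnstile> P \<doteq> P \<Colon> Sig A B \<Longrightarrow> \<Gamma> \<turnstile> P \<doteq> Pr (Fst P) (Snd P) \<Colon> Sig A B"

| path: "Dim Pth # \<Gamma> \<turnstile> A \<doteq> A' type s \<Longrightarrow>
     \<Gamma> \<turnstile> M0 \<doteq> M0' \<Colon> inst [I0] A \<Longrightarrow> \<Gamma> \<turnstile> M1 \<doteq> M1' \<Colon> inst [I1] A \<Longrightarrow>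
     \<Gamma> \<turnstile> PathT A M0 M1 \<doteq> PathT A' M0' M1' type s"
| plam: "Dim Pth # \<Gamma> \<turnstile> M \<doteq> M' \<Colon> A \<Longrightarrow>
     \<Gamma> \<turnstile> inst [I0] M \<doteq> M0 \<Colon> inst [I0] A \<Longrightarrow> \<Gamma> \<turnstile> inst [I1] M \<doteq> M1 \<Colon> inst [I1] A \<Longrightarrow>
     \<Gamma> \<turnstile> PLam M \<doteq> PLam M' \<Colon> PathT A M0 M1"
| papp: "\<Gamma> \<turnstile> P \<doteq> P' \<Colon> PathT A M0 M1 \<Longrightarrow> deq \<Gamma> Pth r r' \<Longrightarrow>
     \<Gamma> \<turnstile> PApp P r \<doteq> PApp P' r' \<Colon> inst [r] A"
| papp_0: "\<Gamma> \<turnstile> P \<doteq> P \<Colon> PathT A M0 M1 \<Longrightarrow> \<Gamma> \<turnstile> PApp P I0 \<doteq> M0 \<Colon> inst [I0] A"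
| papp_1: "\<Gamma> \<turnstile> P \<doteq> P \<Colon> PathT A M0 M1 \<Longrightarrow> \<Gamma> \<turnstile> PApp P I1 \<doteq> M1 \<Colon> inst [I1] A"
| path_beta: "Dim Pth # \<Gamma> \<turnstile> M \<doteq> M \<Colon> A \<Longrightarrow> \<turnstile> \<Gamma> \<Longrightarrow> dim \<Gamma> Pth r \<Longrightarrow>
     \<Gamma> \<turnstile> PApp (PLam M) r \<doteq> inst [r] M \<Colon> inst [r] A"
| path_eta: "\<Gamma> \<turnstile> P \<doteq> P \<Colon> PathT A M0 M1 \<Longrightarrow>
     \<Gamma> \<turnstile> P \<doteq> PLam (PApp (wk 1 P) (Var 0)) \<Colon> PathT A M0 M1"

  \<comment> \<open>Kan operations: no unfolding of \<open>Coe\<close> and \<open>HCom\<close> at particular type formers is imposed, so what is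
      derivable here remains so when such equations are added\<close>
| coe: "Dim Pth # \<Gamma> \<turnstile> A \<doteq> A' type Lg \<Longrightarrow> deq \<Gamma> Pth r r' \<Longrightarrow> deq \<Gamma> Pth s s' \<Longrightarrow>
     \<Gamma> \<turnstile> M \<doteq> M' \<Colon> inst [r] A \<Longrightarrow> \<Gamma> \<turnstile> Coe A r s M \<doteq> Coe A' r' s' M' \<Colon> inst [s] A"
| coe_id: "Dim Pth # \<Gamma> \<turnstile> A \<doteq> A type Lg \<Longrightarrow> deq \<Gamma> Pth r s \<Longrightarrow>
     \<Gamma> \<turnstile> M \<doteq> M \<Colon> inst [r] A \<Longrightarrow> \<Gamma> \<turnstile> Coe A r s M \<doteq> M \<Colon> inst [s] A"
| box: "\<Gamma> \<turnstile> A \<doteq> A' type Lg \<Longrightarrow> deq \<Gamma> Pth r r' \<Longrightarrow> \<Gamma> \<turnstile> M \<doteq> M' \<Colon> A \<Longrightarrow> length T = length T' \<Longrightarrow>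
     (\<And>i u v N i' u' v' N'. ((i, u, v, N), (i', u', v', N')) \<in> set (zip T T') \<Longrightarrow>
        i = i' \<and> cstr \<Gamma> i u v \<and> cstr \<Gamma> i u' v' \<and> deq \<Gamma> i u u' \<and> deq \<Gamma> i v v' \<and>
        (Dim Pth # Cs i u v # \<Gamma> \<turnstile> N \<doteq> N' \<Colon> wk 2 A) \<and>
        (Cs i u v # \<Gamma> \<turnstile> inst [wk 1 r] N \<doteq> wk 1 M \<Colon> wk 1 A)) \<Longrightarrow>
     (\<And>i u v N j w z K. (i, u, v, N) \<in> set T \<Longrightarrow> (j, w, z, K) \<in> set T \<Longrightarrow>
        Dim Pth # Cs j (wk 1 w) (wk 1 z) # Cs i u v # \<Gamma>
          \<turnstile> ren (upr Suc) N \<doteq> ren (upr (upr Suc)) K \<Colon> wk 3 A) \<Longrightarrow>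
     box_eq \<Gamma> A A' r r' M M' T T'"
| hcom: "box_eq \<Gamma> A A' r r' M M' T T' \<Longrightarrow> deq \<Gamma> Pth s s' \<Longrightarrow>
     \<Gamma> \<turnstile> HCom r s A M T \<doteq> HCom r' s' A' M' T' \<Colon> A"
| hcom_id: "box_eq \<Gamma> A A r r M M T T \<Longrightarrow> deq \<Gamma> Pth r s \<Longrightarrow> \<Gamma> \<turnstile> HCom r s A M T \<doteq> M \<Colon> A"
| hcom_tube: "box_eq \<Gamma> A A r r M M T T \<Longrightarrow> dim \<Gamma> Pth s \<Longrightarrow> (i, u, v, N) \<in> set T \<Longrightarrow>
     deq \<Gamma> i u v \<Longrightarrow> \<Gamma> \<turnstile> HCom r s A M T \<doteq> inst [s, Triv] N \<Colon> A"

  \<comment> \<open>V-types, from which univalence follows: \<open>V x A B E\<close> is a path from \<open>A\<close> to \<open>B\<close>\<close>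
| v_data: "deq \<Gamma> Pth r r' \<Longrightarrow> Cs Pth r I0 # \<Gamma> \<turnstile> A \<doteq> A' type s \<Longrightarrow> \<Gamma> \<turnstile> B \<doteq> B' type s \<Longrightarrow>
     Cs Pth r I0 # \<Gamma> \<turnstile> E \<doteq> E' \<Colon> Equiv A (wk 1 B) \<Longrightarrow> v_eq \<Gamma> r r' A A' B B' E E' s"
| v: "v_eq \<Gamma> r r' A A' B B' E E' s \<Longrightarrow> \<Gamma> \<turnstile> V r A B E \<doteq> V r' A' B' E' type s"
| v_0: "v_eq \<Gamma> r r A A B B E E s \<Longrightarrow> deq \<Gamma> Pth r I0 \<Longrightarrow> \<Gamma> \<turnstile> V r A B E \<doteq> inst [Triv] A type s"
| v_1: "v_eq \<Gamma> r r A A B B E E s \<Longrightarrow> deq \<Gamma> Pth r I1 \<Longrightarrow> \<Gamma> \<turnstile> V r A B E \<doteq> B type s"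
| vin: "v_eq \<Gamma> r r' A A B B E E Lg \<Longrightarrow> Cs Pth r I0 # \<Gamma> \<turnstile> M \<doteq> M' \<Colon> A \<Longrightarrow> \<Gamma> \<turnstile> N \<doteq> N' \<Colon> B \<Longrightarrow>
     Cs Pth r I0 # \<Gamma> \<turnstile> App (Fst E) M \<doteq> wk 1 N \<Colon> wk 1 B \<Longrightarrow>
     \<Gamma> \<turnstile> VIn r M N \<doteq> VIn r' M' N' \<Colon> V r A B E"
| vin_0: "v_eq \<Gamma> r r A A B B E E Lg \<Longrightarrow> Cs Pth r I0 # \<Gamma> \<turnstile> M \<doteq> M \<Colon> A \<Longrightarrow> \<Gamma> \<turnstile> N \<doteq> N \<Colon> B \<Longrightarrow>
     Cs Pth r I0 # \<Gamma> \<turnstile> App (Fst E) M \<doteq> wk 1 N \<Colon> wk 1 B \<Longrightarrow> deq \<Gamma> Pth r I0 \<Longrightarrow>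
     \<Gamma> \<turnstile> VIn r M N \<doteq> inst [Triv] M \<Colon> V r A B E"
| vin_1: "v_eq \<Gamma> r r A A B B E E Lg \<Longrightarrow> Cs Pth r I0 # \<Gamma> \<turnstile> M \<doteq> M \<Colon> A \<Longrightarrow> \<Gamma> \<turnstile> N \<doteq> N \<Colon> B \<Longrightarrow>
     Cs Pth r I0 # \<Gamma> \<turnstile> App (Fst E) M \<doteq> wk 1 N \<Colon> wk 1 B \<Longrightarrow> deq \<Gamma> Pth r I1 \<Longrightarrow>
     \<Gamma> \<turnstile> VIn r M N \<doteq> N \<Colon> V r A B E"
| vproj: "v_eq \<Gamma> r r' A A B B E E' Lg \<Longrightarrow> \<Gamma> \<turnstile> P \<doteq> P' \<Colon> V r A B E \<Longrightarrow>
     \<Gamma> \<turnstile> VProj r P E \<doteq> VProj r' P' E' \<Colon> B"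
| vproj_0: "v_eq \<Gamma> r r A A B B E E Lg \<Longrightarrow> \<Gamma> \<turnstile> P \<doteq> P \<Colon> V r A B E \<Longrightarrow> deq \<Gamma> Pth r I0 \<Longrightarrow>
     \<Gamma> \<turnstile> VProj r P E \<doteq> App (Fst (inst [Triv] E)) P \<Colon> B"
| vproj_1: "v_eq \<Gamma> r r A A B B E E Lg \<Longrightarrow> \<Gamma> \<turnstile> P \<doteq> P \<Colon> V r A B E \<Longrightarrow> deq \<Gamma> Pth r I1 \<Longrightarrow>
     \<Gamma> \<turnstile> VProj r P E \<doteq> P \<Colon> B"
| v_beta: "v_eq \<Gamma> r r A A B B E E Lg \<Longrightarrow> Cs Pth r I0 # \<Gamma> \<turnstile> M \<doteq> M \<Colon> A \<Longrightarrow> \<Gamma> \<turnstile> N \<doteq> N \<Colon> B \<Longrightarrow>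
     Cs Pth r I0 # \<Gamma> \<turnstile> App (Fst E) M \<doteq> wk 1 N \<Colon> wk 1 B \<Longrightarrow>
     \<Gamma> \<turnstile> VProj r (VIn r M N) E \<doteq> N \<Colon> B"
| v_eta: "v_eq \<Gamma> r r A A B B E E Lg \<Longrightarrow> \<Gamma> \<turnstile> P \<doteq> P \<Colon> V r A B E \<Longrightarrow>
     \<Gamma> \<turnstile> P \<doteq> VIn r (wk 1 P) (VProj r P E) \<Colon> V r A B E"

| bridge: "Dim Brd # \<Gamma> \<turnstile> A \<doteq> A' type s \<Longrightarrow>
     \<Gamma> \<turnstile> M0 \<doteq> M0' \<Colon> inst [B0] A \<Longrightarrow> \<Gamma> \<turnstile> M1 \<doteq> M1' \<Colon> inst [B1] A \<Longrightarrow>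
     \<Gamma> \<turnstile> BridgeT A M0 M1 \<doteq> BridgeT A' M0' M1' type s"
| blam: "Dim Brd # \<Gamma> \<turnstile> M \<doteq> M' \<Colon> A \<Longrightarrow>
     \<Gamma> \<turnstile> inst [B0] M \<doteq> M0 \<Colon> inst [B0] A \<Longrightarrow> \<Gamma> \<turnstile> inst [B1] M \<doteq> M1 \<Colon> inst [B1] A \<Longrightarrow>
     \<Gamma> \<turnstile> BLam M \<doteq> BLam M' \<Colon> BridgeT A M0 M1"
| bapp: "\<turnstile> \<Gamma> \<Longrightarrow> dim \<Gamma> Brd r \<Longrightarrow> cut \<Gamma> r \<turnstile> P \<doteq> P' \<Colon> BridgeT A M0 M1 \<Longrightarrow>
     \<Gamma> \<turnstile> BApp P r \<doteq> BApp P' r \<Colon> inst [r] A"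
| bapp_0: "\<Gamma> \<turnstile> P \<doteq> P \<Colon> BridgeT A M0 M1 \<Longrightarrow> \<Gamma> \<turnstile> BApp P B0 \<doteq> M0 \<Colon> inst [B0] A"
| bapp_1: "\<Gamma> \<turnstile> P \<doteq> P \<Colon> BridgeT A M0 M1 \<Longrightarrow> \<Gamma> \<turnstile> BApp P B1 \<doteq> M1 \<Colon> inst [B1] A"
| bridge_beta: "\<turnstile> \<Gamma> \<Longrightarrow> dim \<Gamma> Brd r \<Longrightarrow> Dim Brd # cut \<Gamma> r \<turnstile> M \<doteq> M \<Colon> A \<Longrightarrow>
     \<Gamma> \<turnstile> BApp (BLam M) r \<doteq> inst [r] M \<Colon> inst [r] A"
| bridge_eta: "\<Gamma> \<turnstile> P \<doteq> P \<Colon> BridgeT A M0 M1 \<Longrightarrow>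
     \<Gamma> \<turnstile> P \<doteq> BLam (BApp (wk 1 P) (Var 0)) \<Colon> BridgeT A M0 M1"

| gel_data: "\<Gamma> \<turnstile> A \<doteq> A' type s \<Longrightarrow> \<Gamma> \<turnstile> B \<doteq> B' type s \<Longrightarrow>
     Tm (wk 1 B) # Tm A # \<Gamma> \<turnstile> R \<doteq> R' type s \<Longrightarrow> gel_eq \<Gamma> A A' B B' R R' s"
| gel: "\<turnstile> \<Gamma> \<Longrightarrow> dim \<Gamma> Brd r \<Longrightarrow> gel_eq (cut \<Gamma> r) A A' B B' R R' s \<Longrightarrow>
     \<Gamma> \<turnstile> Gel r A B R \<doteq> Gel r A' B' R' type s"
| gel_0: "gel_eq \<Gamma> A A B B R R s \<Longrightarrow> \<Gamma> \<turnstile> Gel B0 A B R \<doteq> A type s"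
| gel_1: "gel_eq \<Gamma> A A B B R R s \<Longrightarrow> \<Gamma> \<turnstile> Gel B1 A B R \<doteq> B type s"
| gelin: "\<turnstile> \<Gamma> \<Longrightarrow> dim \<Gamma> Brd r \<Longrightarrow> gel_eq (cut \<Gamma> r) A A B B R R Lg \<Longrightarrow>
     cut \<Gamma> r \<turnstile> M \<doteq> M' \<Colon> A \<Longrightarrow> cut \<Gamma> r \<turnstile> N \<doteq> N' \<Colon> B \<Longrightarrow> cut \<Gamma> r \<turnstile> P \<doteq> P' \<Colon> inst [N, M] R \<Longrightarrow>
     \<Gamma> \<turnstile> GelIn r M N P \<doteq> GelIn r M' N' P' \<Colon> Gel r A B R"
| gelin_0: "gel_eq \<Gamma> A A B B R R Lg \<Longrightarrow> \<Gamma> \<turnstile> M \<doteq> M \<Colon> A \<Longrightarrow> \<Gamma> \<turnstile> N \<doteq> N \<Colon> B \<Longrightarrow>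
     \<Gamma> \<turnstile> P \<doteq> P \<Colon> inst [N, M] R \<Longrightarrow> \<Gamma> \<turnstile> GelIn B0 M N P \<doteq> M \<Colon> A"
| gelin_1: "gel_eq \<Gamma> A A B B R R Lg \<Longrightarrow> \<Gamma> \<turnstile> M \<doteq> M \<Colon> A \<Longrightarrow> \<Gamma> \<turnstile> N \<doteq> N \<Colon> B \<Longrightarrow>
     \<Gamma> \<turnstile> P \<doteq> P \<Colon> inst [N, M] R \<Longrightarrow> \<Gamma> \<turnstile> GelIn B1 M N P \<doteq> N \<Colon> B"
| ungel: "gel_eq \<Gamma> A A B B R R Lg \<Longrightarrow>
     Dim Brd # \<Gamma> \<turnstile> Q \<doteq> Q' \<Colon> Gel (Var 0) (wk 1 A) (wk 1 B) (ren (upr (upr Suc)) R) \<Longrightarrow>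
     \<Gamma> \<turnstile> Ungel Q \<doteq> Ungel Q' \<Colon> inst [inst [B1] Q, inst [B0] Q] R"
| gel_beta: "gel_eq \<Gamma> A A B B R R Lg \<Longrightarrow> \<Gamma> \<turnstile> M \<doteq> M \<Colon> A \<Longrightarrow> \<Gamma> \<turnstile> N \<doteq> N \<Colon> B \<Longrightarrow>
     \<Gamma> \<turnstile> P \<doteq> P \<Colon> inst [N, M] R \<Longrightarrow>
     \<Gamma> \<turnstile> Ungel (GelIn (Var 0) (wk 1 M) (wk 1 N) (wk 1 P)) \<doteq> P \<Colon> inst [N, M] R"
| gel_eta: "\<turnstile> \<Gamma> \<Longrightarrow> dim \<Gamma> Brd r \<Longrightarrow> gel_eq (cut \<Gamma> r) A A B B R R Lg \<Longrightarrow>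
     Dim Brd # cut \<Gamma> r \<turnstile> Q \<doteq> Q \<Colon> Gel (Var 0) (wk 1 A) (wk 1 B) (ren (upr (upr Suc)) R) \<Longrightarrow>
     \<Gamma> \<turnstile> inst [r] Q \<doteq> GelIn r (inst [B0] Q) (inst [B1] Q) (Ungel Q) \<Colon> Gel r A B R"

  \<comment> \<open>extent; \<open>A\<close> depends on a bridge dimension \<open>x\<close>, and \<open>B\<close> on \<open>x\<close> (index 1) and \<open>a : A\<close> (index 0).
      The bridge type in the last premise is \<open>Bridge\<close> over \<open>x\<close> in \<open>B[c @ x/a]\<close> from \<open>N0[a0]\<close> to \<open>N1[a1]\<close>.\<close>
| extent_data: "Dim Brd # \<Gamma> \<turnstile> A \<doteq> A type Lg \<Longrightarrow> Tm A # Dim Brd # \<Gamma> \<turnstile> B \<doteq> B type Lg \<Longrightarrow>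
     Tm (inst [B0] A) # \<Gamma> \<turnstile> N0 \<doteq> N0' \<Colon> sub (up (scons [B0] Var)) B \<Longrightarrow>
     Tm (inst [B1] A) # \<Gamma> \<turnstile> N1 \<doteq> N1' \<Colon> sub (up (scons [B1] Var)) B \<Longrightarrow>
     Tm (BridgeT (ren (upr (\<lambda>i. i + 2)) A) (Var 1) (Var 0)) # Tm (wk 1 (inst [B1] A)) # Tm (inst [B0] A) # \<Gamma>
       \<turnstile> N \<doteq> N' \<Colon> BridgeT (sub (scons [BApp (Var 1) (Var 0), Var 0] (\<lambda>i. Var (i + 4))) B)
                       (wk 2 N0) (ren (case_nat 1 (\<lambda>i. i + 3)) N1) \<Longrightarrow>
     extent_eq \<Gamma> A B N0 N0' N1 N1' N N'"
| extent: "\<turnstile> \<Gamma> \<Longrightarrow> dim \<Gamma> Brd r \<Longrightarrow> extent_eq (cut \<Gamma> r) A B N0 N0' N1 N1' N N' \<Longrightarrow>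
     \<Gamma> \<turnstile> M \<doteq> M' \<Colon> inst [r] A \<Longrightarrow>
     \<Gamma> \<turnstile> Extent r M N0 N1 N \<doteq> Extent r M' N0' N1' N' \<Colon> inst [M, r] B"
| extent_0: "extent_eq \<Gamma> A B N0 N0 N1 N1 N N \<Longrightarrow> \<Gamma> \<turnstile> M \<doteq> M \<Colon> inst [B0] A \<Longrightarrow>
     \<Gamma> \<turnstile> Extent B0 M N0 N1 N \<doteq> inst [M] N0 \<Colon> inst [M, B0] B"
| extent_1: "extent_eq \<Gamma> A B N0 N0 N1 N1 N N \<Longrightarrow> \<Gamma> \<turnstile> M \<doteq> M \<Colon> inst [B1] A \<Longrightarrow>
     \<Gamma> \<turnstile> Extent B1 M N0 N1 N \<doteq> inst [M] N1 \<Colon> inst [M, B1] B"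
| extent_beta: "\<turnstile> \<Gamma> \<Longrightarrow> dim \<Gamma> Brd r \<Longrightarrow> extent_eq (cut \<Gamma> r) A B N0 N0 N1 N1 N N \<Longrightarrow>
     Dim Brd # cut \<Gamma> r \<turnstile> M \<doteq> M \<Colon> A \<Longrightarrow>
     \<Gamma> \<turnstile> Extent r (inst [r] M) N0 N1 N
        \<doteq> BApp (inst [BLam M, inst [B1] M, inst [B0] M] N) r \<Colon> inst [inst [r] M, r] B"

abbreviation has_type :: "ctx \<Rightarrow> tm \<Rightarrow> tm \<Rightarrow> bool" (\<open>_ \<turnstile> _ \<Colon> _\<close> [51, 51, 51] 50) where
  "\<Gamma> \<turnstile> M \<Colon> A \<equiv> \<Gamma> \<turnstile> M \<doteq> M \<Colon> A"

section \<open>Bridge-discrete types\<close>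

definition loosen :: "tm \<Rightarrow> tm \<Rightarrow> tm" where
  "loosen A P =
     Coe (Bridge (wk 1 A) (PApp (wk 1 P) I0) (PApp (wk 1 P) (Var 0))) I0 I1 (BLam (wk 1 (PApp P I0)))"

text \<open>In the context extended by \<open>a, a' : A\<close> these are indices 1 and 0.\<close>
definition isBDisc :: "tm \<Rightarrow> tm" where
  "isBDisc A = Pi A (Pi (wk 1 A)
     (isEquiv (Path (wk 2 A) (Var 1) (Var 0)) (Bridge (wk 2 A) (Var 1) (Var 0))
        (Lam (loosen (wk 3 A) (Var 0)))))"

definition bridge_discrete :: "ctx \<Rightarrow> tm \<Rightarrow> bool" where
  "bridge_discrete \<Gamma> A \<longleftrightarrow> (\<exists>D. \<Gamma> \<turnstile> D \<Colon> isBDisc A)"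

definition Leibniz :: "tm \<Rightarrow> tm \<Rightarrow> tm \<Rightarrow> tm" where
  "Leibniz A a a' = Pi (Arrow A Univ) (Arrow (App (Var 0) (wk 1 a)) (App (Var 0) (wk 1 a')))"

end

theory Submission
  imports Defs "HOL-Library.Monad_Syntax"
begin

text \<open>\<open>Coe\<close> and \<open>HCom\<close> have boundary equations only, none at
  particular type formers, so path operations cannot be computed. Most steps on paths are therefore
  coercions in a line of path types whose ends vary. A recurring device is \<open>coe z 1 u\<close>
  along a constant line with \<open>z\<close> bound: at \<open>z = 1\<close> it is \<open>u\<close>,
  at \<open>z = 0\<close> the coercion to be removed. \<open>Leibniz A a a'\<close> quantifies over
  families in \<open>Univ\<close> and is large, so lemmas about an arbitrary type in
  \<open>Univ\<close> do not apply to it; what is needed of its paths is proved separately.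
  Parametricity is typed by hand because the rules for bridge application, Gel and Extent have
  premises over restricted contexts, which the checker does not treat; the typings and syntactic
  identities used there are still evaluated. Every later result becomes a variable of the context
  once accepted, so later terms mention earlier proofs only by index and never unfold them. The
  numbers 30 and 50 bound the recursion depth of the checker; soundness holds for every
  bound.\<close>

text \<open>
  The map \<open>F k = k (Path a) refl\<close> from \<open>\<Pi>X. X a \<rightarrow> X a'\<close> to \<open>Path a a'\<close> has the inverse
  \<open>g p X u = coe\<^bsub>z. X (p z)\<^esub> 0 1 u\<close>.  That \<open>F (g p)\<close> is \<open>p\<close> is a unit law for paths.  That \<open>g (F k)\<close>
  is \<open>k\<close> is parametricity: families of relations over bridges in \<open>A\<close> are, by \<open>Extent\<close> and \<open>Gel\<close>, bridges
  in \<open>A \<rightarrow> Univ\<close>, to which \<open>k\<close> can be applied.  The relation needed, between \<open>Path a\<close> and an arbitrary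
  family \<open>Y\<close>, has to transport in \<open>Y\<close> along a bridge of \<open>A\<close>, and this is where \<open>A\<close> being bridge-discrete
  is used.

  All terms except the one for parametricity are typed by a sound checker, which computes
  \<open>\<beta>\<close>-normal \<open>\<eta>\<close>-contracted forms along with types.  Every equality it uses is verified by it, so its
  soundness needs neither substitution nor inversion lemmas for the judgments.
\<close>

section \<open>Equality of dimensions\<close>

fun is_dim :: "ctx \<Rightarrow> dsort \<Rightarrow> tm \<Rightarrow> bool" where
  "is_dim \<Gamma> i (End j e) = (i = j)"
| "is_dim \<Gamma> i (Var k) = (k < length \<Gamma> \<and> \<Gamma> ! k = Dim i)"
| "is_dim \<Gamma> i _ = False"

lemma is_dim_sound: "is_dim \<Gamma> i r \<Longrightarrow> dim \<Gamma> i r"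
  by (cases r) (auto intro: dim.intros)

fun constraints :: "dsort \<Rightarrow> nat \<Rightarrow> ctx \<Rightarrow> (tm \<times> tm) list" where
  "constraints i k [] = []"
| "constraints i k (Cs j r s # \<Gamma>) =
     (if i = j then (wk (Suc k) r, wk (Suc k) s) # constraints i (Suc k) \<Gamma> else constraints i (Suc k) \<Gamma>)"
| "constraints i k (_ # \<Gamma>) = constraints i (Suc k) \<Gamma>"

text \<open>A representative of the class of \<open>r\<close>: the recursive call represents classes
  under the remaining equations, and the first equation merges the class of \<open>u\<close> into
  that of \<open>v\<close>.\<close>

fun identify :: "(tm \<times> tm) list \<Rightarrow> tm \<Rightarrow> tm" where
  "identify [] r = r"
| "identify ((u, v) # E) r = (if identify E r = identify E u then identify E v else identify E r)"

definition canon :: "ctx \<Rightarrow> dsort \<Rightarrow> tm \<Rightarrow> tm" where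
  "canon \<Gamma> i = identify (constraints i 0 \<Gamma>)"

text \<open>The path sort suffices: the only constraints the checker adds are those of tubes, which
  \<open>check_tube\<close> restricts to \<open>Pth\<close>.\<close>

definition absurd_check :: "ctx \<Rightarrow> bool" where
  "absurd_check \<Gamma> \<longleftrightarrow> canon \<Gamma> Pth I0 = canon \<Gamma> Pth I1"

lemma constraints_sound: "(u, v) \<in> set (constraints i k \<Gamma>) \<Longrightarrow> deq (\<Delta> @ \<Gamma>) i u v" if "length \<Delta> = k"
  using that
proof (induction i k \<Gamma> arbitrary: \<Delta> rule: constraints.induct)
  case (2 i k j r s \<Gamma>)
  have *: "length (\<Delta> @ [Cs j r s]) = Suc k" using 2 by simp
  have "deq (\<Delta> @ Cs j r s # \<Gamma>) j (wk (Suc k) r) (wk (Suc k) s)"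
    using 2 by (intro deq_hyp) (auto simp: nth_append)
  then show ?case using 2 * 2(1)[of "\<Delta> @ [Cs j r s]"] 2(2)[of "\<Delta> @ [Cs j r s]"]
    by (auto split: if_splits)
next
  case ("3_1" i k A \<Gamma>)
  then show ?case using "3_1"(1)[of "\<Delta> @ [Tm A]"] by auto
next
  case ("3_2" i k j \<Gamma>)
  then show ?case using "3_2"(1)[of "\<Delta> @ [Dim j]"] by auto
next
  case ("3_3" i k \<Gamma>)
  then show ?case using "3_3"(1)[of "\<Delta> @ [Hid]"] by auto
qed auto

lemma identify_sound:
  "(\<And>u v. (u, v) \<in> set E \<Longrightarrow> deq \<Gamma> i u v) \<Longrightarrow> deq \<Gamma> i r r \<Longrightarrow> deq \<Gamma> i r (identify E r)"
proof (induction E arbitrary: r)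
  case (Cons e E)
  obtain u v where e: "e = (u, v)" by force
  have uv: "deq \<Gamma> i u v" using Cons(2) e by auto
  have IH: "deq \<Gamma> i t t \<Longrightarrow> deq \<Gamma> i t (identify E t)" for t using Cons by auto
  have u: "deq \<Gamma> i u (identify E u)" and v: "deq \<Gamma> i v (identify E v)"
    using uv by (auto intro!: IH intro: deq_sym deq_trans)
  have "deq \<Gamma> i r (identify E v)" if "identify E r = identify E u"
    using that IH[OF Cons(3)] u v uv by (metis deq_sym deq_trans)
  then show ?case using IH[OF Cons(3)] e by auto
qed simp

lemma canon_sound: "is_dim \<Gamma> i r \<Longrightarrow> deq \<Gamma> i r (canon \<Gamma> i r)"
  unfolding canon_def
  by (rule identify_sound) (use constraints_sound[of "[]"] in \<open>auto intro: deq_refl is_dim_sound\<close>)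

lemma canon_eqD: "is_dim \<Gamma> i r \<Longrightarrow> is_dim \<Gamma> i s \<Longrightarrow> canon \<Gamma> i r = canon \<Gamma> i s \<Longrightarrow> deq \<Gamma> i r s"
  by (metis canon_sound deq_sym deq_trans)

lemma absurd_check_sound: "absurd_check \<Gamma> \<Longrightarrow> absurd \<Gamma>"
  unfolding absurd_check_def absurd_def by (rule exI[of _ Pth], rule canon_eqD) auto

section \<open>A normalizing type checker\<close>

fun canonical :: "tm \<Rightarrow> bool" where
  "canonical Univ = True"
| "canonical (Pi _ _) = True"
| "canonical (Sig _ _) = True"
| "canonical (PathT _ _ _) = True"
| "canonical (BridgeT _ _ _) = True"
| "canonical _ = False"

text \<open>\<open>BLam\<close> is absent: the checker makes no reduction at a bridge application,
  so nothing about the body of a bridge has to be remembered.\<close>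

fun is_intro :: "tm \<Rightarrow> bool" where
  "is_intro (Lam _) = True"
| "is_intro (Pr _ _) = True"
| "is_intro (PLam _) = True"
| "is_intro _ = False"

text \<open>
  No type can be inferred for an unascribed abstraction or pair, so a normal form that is one does not
  replace the original term inside types that are checked again.
\<close>

definition simpler :: "tm \<Rightarrow> tm \<Rightarrow> tm" where
  "simpler M' M = (if is_intro M' then M else M')"

text \<open>Weakening back and comparing verifies that index 0 does not occur, without any lemma on
  free variables.\<close>

definition strengthen :: "tm \<Rightarrow> tm option" where
  "strengthen M = (let N = inst [Triv] M in if wk 1 N = M then Some N else None)"

text \<open>
  A checker answers an inference query with a normal form and a type.  In its answers to the other
  queries, for a term at a type and for a type of a given size, only the normal form matters.  A single
  step of the checker takes the checker for the recursive calls as an argument.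
\<close>

datatype query = Inf ctx tm | Chk ctx tm tm | Ty size ctx tm

type_synonym checker = "query \<Rightarrow> (tm \<times> tm) option"

definition infer :: "checker \<Rightarrow> ctx \<Rightarrow> tm \<Rightarrow> (tm \<times> tm) option" where
  "infer f \<Gamma> M = f (Inf \<Gamma> M)"

definition check :: "checker \<Rightarrow> ctx \<Rightarrow> tm \<Rightarrow> tm \<Rightarrow> tm option" where
  "check f \<Gamma> M A = map_option fst (f (Chk \<Gamma> M A))"

definition check_type :: "checker \<Rightarrow> size \<Rightarrow> ctx \<Rightarrow> tm \<Rightarrow> tm option" where
  "check_type f s \<Gamma> A = map_option fst (f (Ty s \<Gamma> A))"

definition whnf :: "checker \<Rightarrow> ctx \<Rightarrow> tm \<Rightarrow> tm option" where
  "whnf f \<Gamma> A = (if canonical A then Some A else check_type f Lg \<Gamma> A)"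

definition convert :: "checker \<Rightarrow> ctx \<Rightarrow> tm \<Rightarrow> tm \<Rightarrow> unit option" where
  "convert f \<Gamma> A B = (if A = B then Some () else
     do { A' \<leftarrow> check_type f Lg \<Gamma> A; if A' = B then Some () else
       do { B' \<leftarrow> check_type f Lg \<Gamma> B; if A' = B' \<or> absurd_check \<Gamma> then Some () else None } })"

definition check_eq :: "checker \<Rightarrow> ctx \<Rightarrow> tm \<Rightarrow> tm \<Rightarrow> tm \<Rightarrow> unit option" where
  "check_eq f \<Gamma> M N A = (if M = N then map_option (\<lambda>_. ()) (check f \<Gamma> M A) else
     do { M' \<leftarrow> check f \<Gamma> M A; N' \<leftarrow> check f \<Gamma> N A; if M' = N' \<or> absurd_check \<Gamma> then Some () else None })"

text \<open>An \<eta>-contractum is typed afresh, since its type would otherwise come from a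
  strengthening lemma. An introduction form is refused because its invariant is known only at the
  inferred type.\<close>

definition contract :: "checker \<Rightarrow> ctx \<Rightarrow> tm option \<Rightarrow> tm \<Rightarrow> tm \<Rightarrow> tm option" where
  "contract f \<Gamma> K M A = (case K of None \<Rightarrow> Some M | Some N \<Rightarrow>
     do { (N', T) \<leftarrow> infer f \<Gamma> N; convert f \<Gamma> T A; if is_intro N' then None else Some N' })"

fun strengthen_at :: "tm \<Rightarrow> tm \<Rightarrow> tm option" where
  "strengthen_at g (Var k) = (if k = 0 then strengthen g else None)"
| "strengthen_at g _ = None"

fun eta_lam :: "tm \<Rightarrow> tm option" where
  "eta_lam (App g x) = strengthen_at g x"
| "eta_lam _ = None"

fun eta_plam :: "tm \<Rightarrow> tm option" where
  "eta_plam (PApp g x) = strengthen_at g x"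
| "eta_plam _ = None"

fun eta_snd :: "tm \<Rightarrow> tm \<Rightarrow> tm option" where
  "eta_snd g (Snd h) = (if g = h then Some g else None)"
| "eta_snd g _ = None"

fun eta_pr :: "tm \<Rightarrow> tm \<Rightarrow> tm option" where
  "eta_pr (Fst g) y = eta_snd g y"
| "eta_pr _ y = None"

section \<open>Types, introduction forms and eliminations\<close>

definition check_el :: "checker \<Rightarrow> ctx \<Rightarrow> tm \<Rightarrow> tm option" where
  "check_el f \<Gamma> A = do { (A', T) \<leftarrow> infer f \<Gamma> A; convert f \<Gamma> T Univ; Some A' }"

fun type_step :: "checker \<Rightarrow> size \<Rightarrow> ctx \<Rightarrow> tm \<Rightarrow> tm option" where
  "type_step f s \<Gamma> Univ = (if s = Lg then Some Univ else None)"
| "type_step f s \<Gamma> (Pi A B) = do { A' \<leftarrow> check_type f s \<Gamma> A; B' \<leftarrow> check_type f s (Tm A # \<Gamma>) B; Some (Pi A' B') }"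
| "type_step f s \<Gamma> (Sig A B) = do { A' \<leftarrow> check_type f s \<Gamma> A; B' \<leftarrow> check_type f s (Tm A # \<Gamma>) B; Some (Sig A' B') }"
| "type_step f s \<Gamma> (PathT A M N) = do { A' \<leftarrow> check_type f s (Dim Pth # \<Gamma>) A; M' \<leftarrow> check f \<Gamma> M (inst [I0] A);
     N' \<leftarrow> check f \<Gamma> N (inst [I1] A); Some (PathT A' M' N') }"
| "type_step f s \<Gamma> (BridgeT A M N) = do { A' \<leftarrow> check_type f s (Dim Brd # \<Gamma>) A; M' \<leftarrow> check f \<Gamma> M (inst [B0] A);
     N' \<leftarrow> check f \<Gamma> N (inst [B1] A); Some (BridgeT A' M' N') }"
| "type_step f s \<Gamma> A = check_el f \<Gamma> A"

fun check_lam where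
  "check_lam f \<Gamma> b (Pi A B) = do { check_type f Lg \<Gamma> A; b' \<leftarrow> check f (Tm A # \<Gamma>) b B;
     contract f \<Gamma> (eta_lam b') (Lam b') (Pi A B) }"
| "check_lam f \<Gamma> b _ = None"

fun check_pr where
  "check_pr f \<Gamma> x y (Sig A B) = do {
     check_type f Lg \<Gamma> A; check_type f Lg (Tm A # \<Gamma>) B; x' \<leftarrow> check f \<Gamma> x A; y' \<leftarrow> check f \<Gamma> y (inst [simpler x' x] B);
     contract f \<Gamma> (eta_pr (simpler x' x) y') (Pr (simpler x' x) y') (Sig A B) }"
| "check_pr f \<Gamma> x y _ = None"

fun check_plam where
  "check_plam f \<Gamma> b (PathT A M0 M1) = do { b' \<leftarrow> check f (Dim Pth # \<Gamma>) b A;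
     check_eq f \<Gamma> (inst [I0] b') M0 (inst [I0] A); check_eq f \<Gamma> (inst [I1] b') M1 (inst [I1] A);
     contract f \<Gamma> (eta_plam b') (PLam b') (PathT A M0 M1) }"
| "check_plam f \<Gamma> b _ = None"

fun check_blam where
  "check_blam f \<Gamma> b (BridgeT A M0 M1) = do { b' \<leftarrow> check f (Dim Brd # \<Gamma>) b A;
     check_eq f \<Gamma> (inst [B0] b') M0 (inst [B0] A); check_eq f \<Gamma> (inst [B1] b') M1 (inst [B1] A); Some (BLam b') }"
| "check_blam f \<Gamma> b _ = None"

text \<open>The invariant on introduction forms is tied to the syntactic type, so after a proper
  conversion such a form is checked again at the new type.\<close>

definition check_infer :: "checker \<Rightarrow> ctx \<Rightarrow> tm \<Rightarrow> tm \<Rightarrow> tm option" where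
  "check_infer f \<Gamma> M C = (if C = Univ then check_type f Sm \<Gamma> M else do { (M', T) \<leftarrow> infer f \<Gamma> M; convert f \<Gamma> T C;
     if T = C \<or> \<not> is_intro M' then Some M' else check f \<Gamma> M' C })"

fun check_step :: "checker \<Rightarrow> ctx \<Rightarrow> tm \<Rightarrow> tm \<Rightarrow> tm option" where
  "check_step f \<Gamma> (Lam b) C = whnf f \<Gamma> C \<bind> check_lam f \<Gamma> b"
| "check_step f \<Gamma> (Pr x y) C = whnf f \<Gamma> C \<bind> check_pr f \<Gamma> x y"
| "check_step f \<Gamma> (PLam b) C = whnf f \<Gamma> C \<bind> check_plam f \<Gamma> b"
| "check_step f \<Gamma> (BLam b) C = whnf f \<Gamma> C \<bind> check_blam f \<Gamma> b"
| "check_step f \<Gamma> M C = check_infer f \<Gamma> M C"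

definition check_at :: "checker \<Rightarrow> ctx \<Rightarrow> tm \<Rightarrow> tm \<Rightarrow> (tm \<times> tm) option" where
  "check_at f \<Gamma> M A = do { M' \<leftarrow> check f \<Gamma> M A; Some (M', A) }"

fun beta_app where
  "beta_app f \<Gamma> N N' (Lam b) B = check_at f \<Gamma> (inst [simpler N' N] b) (inst [simpler N' N] B)"
| "beta_app f \<Gamma> N N' M' B = Some (App M' N', inst [simpler N' N] B)"

fun infer_app where
  "infer_app f \<Gamma> N M' (Pi A B) = do { N' \<leftarrow> check f \<Gamma> N A; beta_app f \<Gamma> N N' M' B }"
| "infer_app f \<Gamma> N M' _ = None"

fun beta_fst where
  "beta_fst f \<Gamma> (Pr x y) A = check_at f \<Gamma> x A"
| "beta_fst f \<Gamma> M' A = Some (Fst M', A)"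

fun infer_fst where
  "infer_fst f \<Gamma> M' (Sig A B) = beta_fst f \<Gamma> M' A"
| "infer_fst f \<Gamma> M' _ = None"

fun infer_snd where
  "infer_snd M' (Sig A B) = Some (Snd M', inst [Fst M'] B)"
| "infer_snd M' _ = None"

fun beta_papp where
  "beta_papp f \<Gamma> r (PLam b) A = check_at f \<Gamma> (inst [r] b) (inst [r] A)"
| "beta_papp f \<Gamma> r M' A = Some (PApp M' r, inst [r] A)"

fun endpoint_papp where
  "endpoint_papp f \<Gamma> (End Pth e) M' A M0 M1 = check_at f \<Gamma> (if e then M1 else M0) (inst [End Pth e] A)"
| "endpoint_papp f \<Gamma> r M' A M0 M1 = beta_papp f \<Gamma> r M' A"

fun infer_papp where
  "infer_papp f \<Gamma> r M' (PathT A M0 M1) = endpoint_papp f \<Gamma> r M' A M0 M1"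
| "infer_papp f \<Gamma> r M' _ = None"

definition infer_whnf :: "checker \<Rightarrow> ctx \<Rightarrow> tm \<Rightarrow> (tm \<times> tm) option" where
  "infer_whnf f \<Gamma> M = do { (M', T) \<leftarrow> infer f \<Gamma> M; T' \<leftarrow> whnf f \<Gamma> T;
     if T = T' \<or> \<not> is_intro M' then Some (M', T') else check_at f \<Gamma> M' T' }"

definition check_tube :: "checker \<Rightarrow> ctx \<Rightarrow> tm \<Rightarrow> tm \<Rightarrow> tm \<Rightarrow> dsort \<times> tm \<times> tm \<times> tm \<Rightarrow> bool" where
  "check_tube f \<Gamma> r A M = (\<lambda>(i, u, v, N). i = Pth \<and> is_dim \<Gamma> i u \<and> is_dim \<Gamma> i v \<and>
     check f (Dim Pth # Cs i u v # \<Gamma>) N (wk 2 A) \<noteq> None \<and>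
     check_eq f (Cs i u v # \<Gamma>) (inst [wk 1 r] N) (wk 1 M) (wk 1 A) \<noteq> None)"

definition check_overlap :: "checker \<Rightarrow> ctx \<Rightarrow> tm \<Rightarrow> dsort \<times> tm \<times> tm \<times> tm \<Rightarrow> dsort \<times> tm \<times> tm \<times> tm \<Rightarrow> bool" where
  "check_overlap f \<Gamma> A = (\<lambda>(i, u, v, N) (j, w, z, K).
     check_eq f (Dim Pth # Cs j (wk 1 w) (wk 1 z) # Cs i u v # \<Gamma>)
       (ren (upr Suc) N) (ren (upr (upr Suc)) K) (wk 3 A) \<noteq> None)"

definition infer_type :: "checker \<Rightarrow> ctx \<Rightarrow> tm \<Rightarrow> (tm \<times> tm) option" where
  "infer_type f \<Gamma> A = do { A' \<leftarrow> check_type f Sm \<Gamma> A; Some (A', Univ) }"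

fun infer_var :: "nat \<Rightarrow> ctx \<Rightarrow> nat \<Rightarrow> (tm \<times> tm) option" where
  "infer_var k (Tm A # \<Gamma>) 0 = Some (Var k, wk (Suc k) A)"
| "infer_var k (_ # \<Gamma>) (Suc i) = infer_var k \<Gamma> i"
| "infer_var k _ _ = None"

text \<open>The \<open>Lam\<close> of a literal redex carries no domain; it is taken from the type
  inferred for the argument.\<close>

fun infer_call :: "checker \<Rightarrow> ctx \<Rightarrow> tm \<Rightarrow> tm \<Rightarrow> (tm \<times> tm) option" where
  "infer_call f \<Gamma> (Lam b) N = do { (N', A) \<leftarrow> infer f \<Gamma> N; check_type f Lg \<Gamma> A; (b', B) \<leftarrow> infer f (Tm A # \<Gamma>) b;
     check_at f \<Gamma> (inst [N'] b') (inst [N'] B) }"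
| "infer_call f \<Gamma> M N = do { (M', T) \<leftarrow> infer_whnf f \<Gamma> M; infer_app f \<Gamma> N M' T }"

definition infer_coe where
  "infer_coe f \<Gamma> r s A' M' Ar As = (if canon \<Gamma> Pth r = canon \<Gamma> Pth s then
     (if Ar = As then Some (M', Ar) else check_at f \<Gamma> M' As)
     else Some (Coe A' (canon \<Gamma> Pth r) (canon \<Gamma> Pth s) M', As))"

fun infer_hcom where
  "infer_hcom f \<Gamma> s A (Some (i, u, v, N)) M = check_at f \<Gamma> (inst [s, Triv] N) A"
| "infer_hcom f \<Gamma> s A None M = Some (M, A)"

definition check_box where
  "check_box f \<Gamma> r A M T \<longleftrightarrow> list_all (check_tube f \<Gamma> r A M) T \<and> list_all (\<lambda>t. list_all (check_overlap f \<Gamma> A t) T) T"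

fun infer_step :: "checker \<Rightarrow> ctx \<Rightarrow> tm \<Rightarrow> (tm \<times> tm) option" where
  "infer_step f \<Gamma> (Var k) = infer_var k \<Gamma> k"
| "infer_step f \<Gamma> (App M N) = infer_call f \<Gamma> M N"
| "infer_step f \<Gamma> (Fst M) = do { (M', T) \<leftarrow> infer_whnf f \<Gamma> M; infer_fst f \<Gamma> M' T }"
| "infer_step f \<Gamma> (Snd M) = do { (M', T) \<leftarrow> infer_whnf f \<Gamma> M; infer_snd M' T }"
| "infer_step f \<Gamma> (PApp M r) = (if is_dim \<Gamma> Pth r \<and> is_dim \<Gamma> Pth (canon \<Gamma> Pth r) then
     do { (M', T) \<leftarrow> infer_whnf f \<Gamma> M; infer_papp f \<Gamma> (canon \<Gamma> Pth r) M' T } else None)"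
| "infer_step f \<Gamma> (PLam b) = do { (b', A) \<leftarrow> infer f (Dim Pth # \<Gamma>) b; M0 \<leftarrow> check f \<Gamma> (inst [I0] b') (inst [I0] A);
     M1 \<leftarrow> check f \<Gamma> (inst [I1] b') (inst [I1] A); Some (PLam b', PathT A M0 M1) }"
| "infer_step f \<Gamma> (Coe A r s M) = (if is_dim \<Gamma> Pth r \<and> is_dim \<Gamma> Pth s then
     do { A' \<leftarrow> check_type f Lg (Dim Pth # \<Gamma>) A; M' \<leftarrow> check f \<Gamma> M (inst [r] A);
       infer_coe f \<Gamma> r s A' M' (inst [r] A) (inst [s] A) } else None)"
| "infer_step f \<Gamma> (HCom r s A M T) = (if is_dim \<Gamma> Pth r \<and> is_dim \<Gamma> Pth s then
     do { check_type f Lg \<Gamma> A; M' \<leftarrow> check f \<Gamma> M A;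
       if check_box f \<Gamma> r A M T
       then if canon \<Gamma> Pth r = canon \<Gamma> Pth s then Some (M', A)
         else infer_hcom f \<Gamma> s A (find (\<lambda>(i, u, v, N). canon \<Gamma> i u = canon \<Gamma> i v) T) (HCom r s A M T)
       else None } else None)"
| "infer_step f \<Gamma> (Pi A B) = infer_type f \<Gamma> (Pi A B)"
| "infer_step f \<Gamma> (Sig A B) = infer_type f \<Gamma> (Sig A B)"
| "infer_step f \<Gamma> (PathT A M N) = infer_type f \<Gamma> (PathT A M N)"
| "infer_step f \<Gamma> (BridgeT A M N) = infer_type f \<Gamma> (BridgeT A M N)"
| "infer_step f \<Gamma> M = None"

fun step :: "checker \<Rightarrow> query \<Rightarrow> (tm \<times> tm) option" where
  "step f (Inf \<Gamma> M) = infer_step f \<Gamma> M"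
| "step f (Chk \<Gamma> M A) = map_option (\<lambda>M'. (M', A)) (check_step f \<Gamma> M A)"
| "step f (Ty s \<Gamma> A) = map_option (\<lambda>A'. (A', Univ)) (type_step f s \<Gamma> A)"

text \<open>The first argument bounds the depth of the recursion.\<close>

fun run :: "nat \<Rightarrow> checker" where
  "run 0 q = None"
| "run (Suc n) q = step (run n) q"

section \<open>Soundness of the checker\<close>

lemma tm_refl1: "\<Gamma> \<turnstile> M \<doteq> N \<Colon> A \<Longrightarrow> \<Gamma> \<turnstile> M \<Colon> A"
  by (blast intro: tm_trans tm_sym)

lemma tm_refl2: "\<Gamma> \<turnstile> M \<doteq> N \<Colon> A \<Longrightarrow> \<Gamma> \<turnstile> N \<Colon> A"
  by (blast intro: tm_trans tm_sym)

lemma ty_refl1: "\<Gamma> \<turnstile> A \<doteq> B type s \<Longrightarrow> \<Gamma> \<turnstile> A \<doteq> A type s"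
  by (blast intro: ty_trans ty_sym)

lemma ty_refl2: "\<Gamma> \<turnstile> A \<doteq> B type s \<Longrightarrow> \<Gamma> \<turnstile> B \<doteq> B type s"
  by (blast intro: ty_trans ty_sym)

lemma ty_Lg: "\<Gamma> \<turnstile> A \<doteq> B type s \<Longrightarrow> \<Gamma> \<turnstile> A \<doteq> B type Lg"
  by (cases s) (auto intro: ty_lift)

lemma dim_wk: "dim \<Gamma> i r \<Longrightarrow> dim (e # \<Gamma>) i (wk 1 r)"
  by (auto elim!: dim.cases intro!: dim.intros)

text \<open>
  A \<open>\<beta>\<close>-step needs typings of the components of an introduction form.  In place of an inversion
  lemma for the judgments, the checker keeps these as an invariant of its answers.
\<close>

definition invertible :: "ctx \<Rightarrow> tm \<Rightarrow> tm \<Rightarrow> bool" where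
  "invertible \<Gamma> M T \<longleftrightarrow>
     (\<forall>b A B. M = Lam b \<longrightarrow> T = Pi A B \<longrightarrow> (\<Gamma> \<turnstile> A \<doteq> A type Lg) \<and> (Tm A # \<Gamma> \<turnstile> b \<Colon> B)) \<and>
     (\<forall>x y A B. M = Pr x y \<longrightarrow> T = Sig A B \<longrightarrow>
        (Tm A # \<Gamma> \<turnstile> B \<doteq> B type Lg) \<and> (\<Gamma> \<turnstile> x \<Colon> A) \<and> (\<Gamma> \<turnstile> y \<Colon> inst [x] B)) \<and>
     (\<forall>b A M0 M1. M = PLam b \<longrightarrow> T = PathT A M0 M1 \<longrightarrow> (Dim Pth # \<Gamma> \<turnstile> b \<Colon> A))"

lemma invertible_neutral: "\<not> is_intro M \<Longrightarrow> invertible \<Gamma> M T"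
  by (auto simp: invertible_def)

lemma invertible_noncanonical: "\<not> canonical T \<Longrightarrow> invertible \<Gamma> M T"
  by (auto simp: invertible_def)

definition sound :: "checker \<Rightarrow> bool" where
  "sound f \<longleftrightarrow> (\<forall>\<Gamma>. (\<turnstile> \<Gamma>) \<longrightarrow>
     (\<forall>M N T. f (Inf \<Gamma> M) = Some (N, T) \<longrightarrow> (\<Gamma> \<turnstile> M \<doteq> N \<Colon> T) \<and> invertible \<Gamma> N T) \<and>
     (\<forall>M A N T. f (Chk \<Gamma> M A) = Some (N, T) \<longrightarrow> (\<Gamma> \<turnstile> M \<doteq> N \<Colon> A) \<and> invertible \<Gamma> N A) \<and>
     (\<forall>s A B T. f (Ty s \<Gamma> A) = Some (B, T) \<longrightarrow> (\<Gamma> \<turnstile> A \<doteq> B type s)))"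

lemma strengthen_at_sound: "strengthen_at g x = Some N \<Longrightarrow> g = wk 1 N \<and> x = Var 0"
  by (cases "(g, x)" rule: strengthen_at.cases) (auto simp: strengthen_def Let_def split: if_splits)

lemma eta_lam_sound: "eta_lam b = Some N \<Longrightarrow> b = App (wk 1 N) (Var 0)"
  by (cases b rule: eta_lam.cases) (auto dest: strengthen_at_sound)

lemma eta_plam_sound: "eta_plam b = Some N \<Longrightarrow> b = PApp (wk 1 N) (Var 0)"
  by (cases b rule: eta_plam.cases) (auto dest: strengthen_at_sound)

lemma eta_pr_sound: "eta_pr x y = Some N \<Longrightarrow> x = Fst N \<and> y = Snd N"
  by (cases x; cases y) (auto split: if_splits)

lemma simpler_cases: "simpler M' M = M' \<or> simpler M' M = M"
  by (simp add: simpler_def)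

context
  fixes f assumes f: "sound f"
begin

lemma infer_sound: "infer f \<Gamma> M = Some (N, T) \<Longrightarrow> \<turnstile> \<Gamma> \<Longrightarrow> (\<Gamma> \<turnstile> M \<doteq> N \<Colon> T) \<and> invertible \<Gamma> N T"
  using f by (auto simp: sound_def infer_def)

lemma check_sound: "check f \<Gamma> M A = Some N \<Longrightarrow> \<turnstile> \<Gamma> \<Longrightarrow> (\<Gamma> \<turnstile> M \<doteq> N \<Colon> A) \<and> invertible \<Gamma> N A"
  using f by (auto simp: sound_def check_def)

lemma check_type_sound: "check_type f s \<Gamma> A = Some B \<Longrightarrow> \<turnstile> \<Gamma> \<Longrightarrow> \<Gamma> \<turnstile> A \<doteq> B type s"
  using f by (auto simp: sound_def check_type_def)

lemma wf_check_type: "check_type f s \<Gamma> A = Some B \<Longrightarrow> \<turnstile> \<Gamma> \<Longrightarrow> \<turnstile> Tm A # \<Gamma>"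
  by (blast intro: wf_tm ty_refl1 ty_Lg check_type_sound)

text \<open>A transfer of typings and not a type equality, because a canonical \<open>A\<close> is
  returned unchecked. The second conjunct lets \<open>invertible\<close> be carried back from
  \<open>B\<close> to \<open>A\<close>.\<close>

lemma whnf_sound:
  "whnf f \<Gamma> A = Some B \<Longrightarrow> \<turnstile> \<Gamma> \<Longrightarrow> (\<Gamma> \<turnstile> M \<doteq> N \<Colon> A) = (\<Gamma> \<turnstile> M \<doteq> N \<Colon> B) \<and> (A = B \<or> \<not> canonical A)"
  by (auto simp: whnf_def split: if_splits dest!: check_type_sound intro: tm_conv ty_sym)

lemma convert_sound: "convert f \<Gamma> A B = Some u \<Longrightarrow> \<turnstile> \<Gamma> \<Longrightarrow> \<Gamma> \<turnstile> M \<doteq> N \<Colon> A \<Longrightarrow> \<Gamma> \<turnstile> M \<doteq> N \<Colon> B"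
  unfolding convert_def
  by (auto split: if_splits bind_splits dest!: check_type_sound
      intro: tm_conv ty_sym ty_trans ty_absurd ty_refl1 ty_refl2 absurd_check_sound)

lemma check_eq_sound: "check_eq f \<Gamma> M N A = Some u \<Longrightarrow> \<turnstile> \<Gamma> \<Longrightarrow> \<Gamma> \<turnstile> M \<doteq> N \<Colon> A"
  unfolding check_eq_def
  by (auto split: if_splits bind_splits dest!: check_sound
      intro: tm_trans tm_sym tm_absurd tm_refl1 tm_refl2 absurd_check_sound)

lemma contract_sound:
  assumes "contract f \<Gamma> K M A = Some P" and "\<turnstile> \<Gamma>" and "\<Gamma> \<turnstile> M \<Colon> A" and "invertible \<Gamma> M A"
    and "\<And>N. K = Some N \<Longrightarrow> \<Gamma> \<turnstile> N \<Colon> A \<Longrightarrow> \<Gamma> \<turnstile> N \<doteq> M \<Colon> A"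
  shows "(\<Gamma> \<turnstile> M \<doteq> P \<Colon> A) \<and> invertible \<Gamma> P A"
proof (cases K)
  case None
  then show ?thesis using assms by (auto simp: contract_def)
next
  case (Some N)
  then obtain T u where *: "infer f \<Gamma> N = Some (P, T)" "convert f \<Gamma> T A = Some u" "\<not> is_intro P"
    using assms(1) by (auto simp: contract_def split: bind_splits if_splits)
  then have "\<Gamma> \<turnstile> N \<doteq> P \<Colon> A"
    using infer_sound convert_sound assms(2) by blast
  then show ?thesis using assms(5)[OF Some] * by (blast intro: tm_trans tm_sym tm_refl1 invertible_neutral)
qed

lemma check_el_sound:
  assumes "check_el f \<Gamma> A = Some B" and "\<turnstile> \<Gamma>"
  shows "\<Gamma> \<turnstile> A \<doteq> B type s"
proof -
  from assms obtain T where "\<Gamma> \<turnstile> A \<doteq> B \<Colon> T" "convert f \<Gamma> T Univ = Some ()"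
    unfolding check_el_def by (auto split: bind_splits dest!: infer_sound)
  then have "\<Gamma> \<turnstile> A \<doteq> B \<Colon> Univ" using convert_sound assms(2) by blast
  then show ?thesis by (cases s) (auto intro: univ_el ty_lift)
qed

lemma type_step_sound: "type_step f s \<Gamma> A = Some B \<Longrightarrow> \<turnstile> \<Gamma> \<Longrightarrow> \<Gamma> \<turnstile> A \<doteq> B type s"
  by (cases "(f, s, \<Gamma>, A)" rule: type_step.cases)
    (auto split: bind_splits if_splits dest: check_el_sound intro!: univ pi sig path bridge
      intro: check_type_sound wf_check_type wf_dim check_sound[THEN conjunct1])

lemma check_lam_sound:
  assumes "check_lam f \<Gamma> b C = Some P" and "\<turnstile> \<Gamma>"
  shows "(\<Gamma> \<turnstile> Lam b \<doteq> P \<Colon> C) \<and> invertible \<Gamma> P C"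
proof -
  from assms obtain A B A' b' where C: "C = Pi A B" and *: "check_type f Lg \<Gamma> A = Some A'"
    "check f (Tm A # \<Gamma>) b B = Some b'" "contract f \<Gamma> (eta_lam b') (Lam b') C = Some P"
    by (cases C) (auto split: bind_splits)
  have A: "\<Gamma> \<turnstile> A \<doteq> A type Lg" using * assms(2) by (blast intro: check_type_sound ty_refl1)
  have b: "Tm A # \<Gamma> \<turnstile> b \<doteq> b' \<Colon> B" using * assms(2) by (blast intro: check_sound[THEN conjunct1] wf_check_type)
  have "\<Gamma> \<turnstile> Lam b \<doteq> Lam b' \<Colon> C" unfolding C by (rule lam[OF A b])
  moreover have "(\<Gamma> \<turnstile> Lam b' \<doteq> P \<Colon> C) \<and> invertible \<Gamma> P C"
  proof (rule contract_sound[OF *(3) assms(2)])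
    show "\<Gamma> \<turnstile> Lam b' \<Colon> C" using calculation by (rule tm_refl2)
    show "invertible \<Gamma> (Lam b') C" using A b by (auto simp: invertible_def C intro: tm_refl2)
  qed (auto simp: C dest!: eta_lam_sound intro: pi_eta)
  ultimately show ?thesis by (blast intro: tm_trans)
qed

lemma check_pr_sound:
  assumes "check_pr f \<Gamma> x y C = Some P" and "\<turnstile> \<Gamma>"
  shows "(\<Gamma> \<turnstile> Pr x y \<doteq> P \<Colon> C) \<and> invertible \<Gamma> P C"
proof -
  from assms obtain A B A' B' x' y' where C: "C = Sig A B" and *: "check_type f Lg \<Gamma> A = Some A'"
    "check_type f Lg (Tm A # \<Gamma>) B = Some B'" "check f \<Gamma> x A = Some x'"
    "check f \<Gamma> y (inst [simpler x' x] B) = Some y'" "contract f \<Gamma> (eta_pr (simpler x' x) y') (Pr (simpler x' x) y') C = Some P"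
    by (cases C) (auto split: bind_splits)
  have B: "Tm A # \<Gamma> \<turnstile> B \<doteq> B type Lg" using * assms(2) by (blast intro: check_type_sound ty_refl1 wf_check_type)
  have x: "\<Gamma> \<turnstile> x \<doteq> x' \<Colon> A" using * assms(2) by (blast intro: check_sound[THEN conjunct1])
  define z where "z = simpler x' x"
  have zx: "\<Gamma> \<turnstile> z \<doteq> x \<Colon> A" using x simpler_cases[of x' x] unfolding z_def by (auto intro: tm_sym tm_refl1)
  have y: "\<Gamma> \<turnstile> y \<doteq> y' \<Colon> inst [z] B" using *(4) assms(2) unfolding z_def by (blast intro: check_sound[THEN conjunct1])
  \<comment> \<open>The rule \<open>pair\<close> types the second component over the left-hand first
    component, so both equations start from \<open>Pr z y\<close>.\<close>
  have "\<Gamma> \<turnstile> Pr z y \<doteq> Pr x y \<Colon> C" "\<Gamma> \<turnstile> Pr z y \<doteq> Pr z y' \<Colon> C"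
    unfolding C using B zx y by (auto intro!: pair intro: tm_refl1)
  then have eq: "\<Gamma> \<turnstile> Pr x y \<doteq> Pr z y' \<Colon> C" by (blast intro: tm_trans tm_sym)
  moreover have "(\<Gamma> \<turnstile> Pr z y' \<doteq> P \<Colon> C) \<and> invertible \<Gamma> P C"
  proof (rule contract_sound[OF *(5)[folded z_def] assms(2)])
    show "\<Gamma> \<turnstile> Pr z y' \<Colon> C" using eq by (rule tm_refl2)
    show "invertible \<Gamma> (Pr z y') C" using B zx y by (auto simp: invertible_def C intro: tm_refl1 tm_refl2)
  qed (auto simp: C dest!: eta_pr_sound intro: sig_eta)
  ultimately show ?thesis by (blast intro: tm_trans)
qed

lemma check_plam_sound:
  assumes "check_plam f \<Gamma> b C = Some P" and "\<turnstile> \<Gamma>"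
  shows "(\<Gamma> \<turnstile> PLam b \<doteq> P \<Colon> C) \<and> invertible \<Gamma> P C"
proof -
  from assms obtain A M0 M1 b' u v where C: "C = PathT A M0 M1" and *: "check f (Dim Pth # \<Gamma>) b A = Some b'"
    "check_eq f \<Gamma> (inst [I0] b') M0 (inst [I0] A) = Some u" "check_eq f \<Gamma> (inst [I1] b') M1 (inst [I1] A) = Some v"
    "contract f \<Gamma> (eta_plam b') (PLam b') C = Some P"
    by (cases C) (auto split: bind_splits)
  have b: "Dim Pth # \<Gamma> \<turnstile> b \<doteq> b' \<Colon> A" using * assms(2) by (blast intro: check_sound[THEN conjunct1] wf_dim)
  \<comment> \<open>Oriented from \<open>b'\<close> to \<open>b\<close>: the endpoint premises of
    \<open>plam\<close> concern the left-hand body, and the checker has tested those of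
    \<open>b'\<close>.\<close>
  have eq: "\<Gamma> \<turnstile> PLam b' \<doteq> PLam b \<Colon> C"
    unfolding C using b * assms(2) by (intro plam tm_sym[OF b] check_eq_sound)
  moreover have "(\<Gamma> \<turnstile> PLam b' \<doteq> P \<Colon> C) \<and> invertible \<Gamma> P C"
  proof (rule contract_sound[OF *(4) assms(2)])
    show "\<Gamma> \<turnstile> PLam b' \<Colon> C" using eq by (rule tm_refl1)
    show "invertible \<Gamma> (PLam b') C" using b by (auto simp: invertible_def C intro: tm_refl2)
  qed (auto simp: C dest!: eta_plam_sound intro: path_eta)
  ultimately show ?thesis by (blast intro: tm_trans tm_sym)
qed

lemma check_blam_sound:
  assumes "check_blam f \<Gamma> b C = Some P" and "\<turnstile> \<Gamma>"
  shows "(\<Gamma> \<turnstile> BLam b \<doteq> P \<Colon> C) \<and> invertible \<Gamma> P C"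
proof -
  from assms obtain A M0 M1 b' u v where C: "C = BridgeT A M0 M1" and *: "check f (Dim Brd # \<Gamma>) b A = Some b'"
    "check_eq f \<Gamma> (inst [B0] b') M0 (inst [B0] A) = Some u" "check_eq f \<Gamma> (inst [B1] b') M1 (inst [B1] A) = Some v"
    and P: "P = BLam b'"
    by (cases C) (auto split: bind_splits)
  have b: "Dim Brd # \<Gamma> \<turnstile> b \<doteq> b' \<Colon> A" using * assms(2) by (blast intro: check_sound[THEN conjunct1] wf_dim)
  have "\<Gamma> \<turnstile> BLam b' \<doteq> BLam b \<Colon> C"
    unfolding C using b * assms(2) by (intro blam tm_sym[OF b] check_eq_sound)
  then show ?thesis unfolding P by (auto intro: tm_sym invertible_neutral)
qed

lemma check_infer_sound: "check_infer f \<Gamma> M C = Some P \<Longrightarrow> \<turnstile> \<Gamma> \<Longrightarrow> (\<Gamma> \<turnstile> M \<doteq> P \<Colon> C) \<and> invertible \<Gamma> P C"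
proof (cases "C = Univ")
  case True
  assume "check_infer f \<Gamma> M C = Some P" "\<turnstile> \<Gamma>"
  then show ?thesis using True by (auto simp: check_infer_def invertible_def intro: univ_code check_type_sound)
next
  case False
  assume *: "check_infer f \<Gamma> M C = Some P" "\<turnstile> \<Gamma>"
  then obtain M' T where M': "infer f \<Gamma> M = Some (M', T)" "convert f \<Gamma> T C = Some ()"
    "(if T = C \<or> \<not> is_intro M' then Some M' else check f \<Gamma> M' C) = Some P"
    using False by (auto simp: check_infer_def split: bind_splits)
  have "\<Gamma> \<turnstile> M \<doteq> M' \<Colon> C" "invertible \<Gamma> M' T" using M' * convert_sound infer_sound by blast+
  then show ?thesis using M'(3) *(2)
    by (auto split: if_splits dest!: check_sound intro: invertible_neutral tm_trans)
qed

lemma check_step_sound: "check_step f \<Gamma> M C = Some P \<Longrightarrow> \<turnstile> \<Gamma> \<Longrightarrow> (\<Gamma> \<turnstile> M \<doteq> P \<Colon> C) \<and> invertible \<Gamma> P C"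
  by (cases "(f, \<Gamma>, M, C)" rule: check_step.cases)
    (auto split: bind_splits dest: whnf_sound check_lam_sound check_pr_sound check_plam_sound check_blam_sound
      check_infer_sound intro: invertible_noncanonical)

lemma check_at_sound: "check_at f \<Gamma> M A = Some (N, T) \<Longrightarrow> \<turnstile> \<Gamma> \<Longrightarrow> T = A \<and> (\<Gamma> \<turnstile> M \<doteq> N \<Colon> T) \<and> invertible \<Gamma> N T"
  by (auto simp: check_at_def split: bind_splits dest: check_sound)

lemma check_at_trans:
  "check_at f \<Gamma> M A = Some (N, T) \<Longrightarrow> \<turnstile> \<Gamma> \<Longrightarrow> \<Gamma> \<turnstile> L \<doteq> M \<Colon> A \<Longrightarrow> (\<Gamma> \<turnstile> L \<doteq> N \<Colon> T) \<and> invertible \<Gamma> N T"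
  by (auto dest: check_at_sound intro: tm_trans)

lemma infer_whnf_sound:
  assumes "infer_whnf f \<Gamma> M = Some (N, T)" and "\<turnstile> \<Gamma>"
  shows "(\<Gamma> \<turnstile> M \<doteq> N \<Colon> T) \<and> invertible \<Gamma> N T"
proof -
  from assms(1) obtain M' T' T'' where *: "infer f \<Gamma> M = Some (M', T')" "whnf f \<Gamma> T' = Some T''"
    "(if T' = T'' \<or> \<not> is_intro M' then Some (M', T'') else check_at f \<Gamma> M' T'') = Some (N, T)"
    unfolding infer_whnf_def by (auto split: bind_splits)
  have "\<Gamma> \<turnstile> M \<doteq> M' \<Colon> T''" "invertible \<Gamma> M' T'" using *(1,2) assms(2) infer_sound whnf_sound by blast+
  then show ?thesis using *(3) assms(2) check_at_trans by (auto split: if_splits intro: invertible_neutral)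
qed

lemma infer_app_sound:
  assumes "infer_app f \<Gamma> N M' C = Some (P, T)" and "\<turnstile> \<Gamma>" and M: "\<Gamma> \<turnstile> M \<doteq> M' \<Colon> C" and invertible: "invertible \<Gamma> M' C"
  shows "(\<Gamma> \<turnstile> App M N \<doteq> P \<Colon> T) \<and> invertible \<Gamma> P T"
proof -
  from assms(1) obtain A B N' where C: "C = Pi A B" and N': "check f \<Gamma> N A = Some N'"
    and P: "beta_app f \<Gamma> N N' M' B = Some (P, T)"
    by (cases C) (auto split: bind_splits)
  have N: "\<Gamma> \<turnstile> N \<doteq> N' \<Colon> A" using N' assms(2) by (blast intro: check_sound[THEN conjunct1])
  define L where "L = simpler N' N"
  have L: "\<Gamma> \<turnstile> L \<doteq> N \<Colon> A" "\<Gamma> \<turnstile> L \<doteq> N' \<Colon> A"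
    using N simpler_cases[of N' N] unfolding L_def by (auto intro: tm_sym tm_refl1 tm_refl2)
  have LM: "\<Gamma> \<turnstile> App M' L \<doteq> App M N \<Colon> inst [L] B" and LN: "\<Gamma> \<turnstile> App M' L \<doteq> App M' N' \<Colon> inst [L] B"
    using M L unfolding C by (blast intro: app tm_sym tm_refl2)+
  show ?thesis
  proof (cases "\<exists>b. M' = Lam b")
    case True
    then obtain b where b: "M' = Lam b" by blast
    have "\<Gamma> \<turnstile> App M' L \<doteq> inst [L] b \<Colon> inst [L] B"
      using invertible L(1) unfolding invertible_def b C by (blast intro: pi_beta tm_refl1)
    then have "\<Gamma> \<turnstile> App M N \<doteq> inst [L] b \<Colon> inst [L] B" using LM by (blast intro: tm_trans tm_sym)
    then show ?thesis using P assms(2) check_at_trans unfolding b L_def by auto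
  next
    case False
    then have "P = App M' N'" "T = inst [L] B" using P unfolding L_def by (cases M'; auto)+
    then show ?thesis using LM LN by (auto intro: tm_trans tm_sym invertible_neutral)
  qed
qed

lemma infer_call_sound:
  assumes "infer_call f \<Gamma> M N = Some (P, T)" and "\<turnstile> \<Gamma>"
  shows "(\<Gamma> \<turnstile> App M N \<doteq> P \<Colon> T) \<and> invertible \<Gamma> P T"
proof (cases "\<exists>b. M = Lam b")
  case True
  then obtain b where b: "M = Lam b" by blast
  with assms obtain N' A A' b' B where *: "infer f \<Gamma> N = Some (N', A)" "check_type f Lg \<Gamma> A = Some A'"
    "infer f (Tm A # \<Gamma>) b = Some (b', B)" "check_at f \<Gamma> (inst [N'] b') (inst [N'] B) = Some (P, T)"
    by (auto split: bind_splits)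
  have A: "\<Gamma> \<turnstile> A \<doteq> A type Lg" using *(2) assms(2) by (blast intro: ty_refl1 check_type_sound)
  have N: "\<Gamma> \<turnstile> N \<doteq> N' \<Colon> A" using *(1) assms(2) by (blast intro: infer_sound[THEN conjunct1])
  have B: "Tm A # \<Gamma> \<turnstile> b \<doteq> b' \<Colon> B" using *(2,3) assms(2) by (blast intro: infer_sound[THEN conjunct1] wf_check_type)
  have "\<Gamma> \<turnstile> App (Lam b') N' \<doteq> App (Lam b) N \<Colon> inst [N'] B"
    by (rule app[OF lam[OF A tm_sym[OF B]] tm_sym[OF N]])
  moreover have "\<Gamma> \<turnstile> App (Lam b') N' \<doteq> inst [N'] b' \<Colon> inst [N'] B"
    by (rule pi_beta[OF tm_refl2[OF B] tm_refl2[OF N]])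
  ultimately have "\<Gamma> \<turnstile> App M N \<doteq> inst [N'] b' \<Colon> inst [N'] B" unfolding b by (blast intro: tm_trans tm_sym)
  then show ?thesis using *(4) assms(2) by (rule check_at_trans[rotated 2])
next
  case False
  then have "infer_call f \<Gamma> M N = do { (M', T) \<leftarrow> infer_whnf f \<Gamma> M; infer_app f \<Gamma> N M' T }" by (cases M) auto
  then show ?thesis using assms
    by (auto split: bind_splits dest!: infer_whnf_sound intro: infer_app_sound[THEN conjunct1] infer_app_sound[THEN conjunct2])
qed

lemma infer_fst_sound:
  assumes "infer_fst f \<Gamma> M' C = Some (P, T)" and "\<turnstile> \<Gamma>" and M: "\<Gamma> \<turnstile> M \<doteq> M' \<Colon> C" and invertible: "invertible \<Gamma> M' C"
  shows "(\<Gamma> \<turnstile> Fst M \<doteq> P \<Colon> T) \<and> invertible \<Gamma> P T"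
proof -
  from assms(1) obtain A B where C: "C = Sig A B" and P: "beta_fst f \<Gamma> M' A = Some (P, T)"
    by (cases C) auto
  have eq: "\<Gamma> \<turnstile> Fst M \<doteq> Fst M' \<Colon> A" using M unfolding C by (rule fst)
  show ?thesis
  proof (cases "\<exists>x y. M' = Pr x y")
    case True
    then obtain x y where b: "M' = Pr x y" by blast
    have "\<Gamma> \<turnstile> Fst M' \<doteq> x \<Colon> A" using invertible by (auto simp: invertible_def b C intro!: fst_beta)
    then have "\<Gamma> \<turnstile> Fst M \<doteq> x \<Colon> A" using eq by (blast intro: tm_trans)
    then show ?thesis using P assms(2) check_at_trans by (auto simp: b)
  next
    case False
    then have "P = Fst M'" "T = A" using P by (cases M'; auto)+
    then show ?thesis using eq by (auto intro: invertible_neutral)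
  qed
qed

lemma infer_snd_sound:
  assumes "infer_snd M' C = Some (P, T)" and M: "\<Gamma> \<turnstile> M \<doteq> M' \<Colon> C"
  shows "(\<Gamma> \<turnstile> Snd M \<doteq> P \<Colon> T) \<and> invertible \<Gamma> P T"
proof -
  from assms(1) obtain A B where "C = Sig A B" "P = Snd M'" "T = inst [Fst M'] B"
    by (cases C) auto
  then show ?thesis using tm_sym[OF snd[OF tm_sym[OF M[unfolded \<open>C = Sig A B\<close>]]]] by (simp add: invertible_neutral)
qed

lemma infer_papp_sound:
  assumes "infer_papp f \<Gamma> r' M' C = Some (P, T)" and "\<turnstile> \<Gamma>" and M: "\<Gamma> \<turnstile> M \<doteq> M' \<Colon> C" and invertible: "invertible \<Gamma> M' C"
    and r: "deq \<Gamma> Pth r r'" and r': "dim \<Gamma> Pth r'"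
  shows "(\<Gamma> \<turnstile> PApp M r \<doteq> P \<Colon> T) \<and> invertible \<Gamma> P T"
proof -
  from assms(1) obtain A M0 M1 where C: "C = PathT A M0 M1" and P: "endpoint_papp f \<Gamma> r' M' A M0 M1 = Some (P, T)"
    by (cases C) auto
  have eq: "\<Gamma> \<turnstile> PApp M r \<doteq> PApp M' r' \<Colon> inst [r'] A"
    using M r unfolding C by (blast intro: tm_sym[OF papp[OF tm_sym deq_sym]])
  have M': "\<Gamma> \<turnstile> M' \<Colon> C" using M by (rule tm_refl2)
  show ?thesis
  proof (cases "\<exists>e. r' = End Pth e")
    case True
    then obtain e where e: "r' = End Pth e" by blast
    have "\<Gamma> \<turnstile> PApp M' r' \<doteq> (if e then M1 else M0) \<Colon> inst [r'] A"
      using papp_0[OF M'[unfolded C]] papp_1[OF M'[unfolded C]] unfolding e by (cases e) (simp_all only: if_True if_False)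
    with eq have "\<Gamma> \<turnstile> PApp M r \<doteq> (if e then M1 else M0) \<Colon> inst [r'] A" by (rule tm_trans)
    moreover have "check_at f \<Gamma> (if e then M1 else M0) (inst [r'] A) = Some (P, T)"
      using P unfolding e by (simp only: endpoint_papp.simps)
    ultimately show ?thesis using assms(2) check_at_trans by blast
  next
    case False
    then have P: "beta_papp f \<Gamma> r' M' A = Some (P, T)"
      using P by (cases "(f, \<Gamma>, r', M', A, M0, M1)" rule: endpoint_papp.cases) auto
    show ?thesis
    proof (cases "\<exists>b. M' = PLam b")
      case True
      then obtain b where b: "M' = PLam b" by blast
      have "\<Gamma> \<turnstile> PApp M' r' \<doteq> inst [r'] b \<Colon> inst [r'] A"
        using invertible r' assms(2) unfolding invertible_def b C by (blast intro: path_beta)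
      with eq have "\<Gamma> \<turnstile> PApp M r \<doteq> inst [r'] b \<Colon> inst [r'] A" by (rule tm_trans)
      then show ?thesis using P assms(2) check_at_trans by (auto simp: b)
    next
      case False
      then have "P = PApp M' r'" "T = inst [r'] A" using P by (cases M'; auto)+
      then show ?thesis using eq by (auto intro: invertible_neutral)
    qed
  qed
qed

lemma infer_var_sound: "infer_var k \<Gamma> i = Some (P, T) \<Longrightarrow> P = Var k \<and> i < length \<Gamma> \<and> (\<exists>A. \<Gamma> ! i = Tm A \<and> T = wk (Suc k) A)"
  by (induction k \<Gamma> i rule: infer_var.induct) auto

lemma infer_coe_sound:
  assumes "infer_coe f \<Gamma> r s A' M' (inst [r] A) (inst [s] A) = Some (P, T)" and "\<turnstile> \<Gamma>"
    and r: "is_dim \<Gamma> Pth r" and s: "is_dim \<Gamma> Pth s"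
    and A: "Dim Pth # \<Gamma> \<turnstile> A \<doteq> A' type Lg" and M: "\<Gamma> \<turnstile> M \<doteq> M' \<Colon> inst [r] A" and invertible: "invertible \<Gamma> M' (inst [r] A)"
  shows "(\<Gamma> \<turnstile> Coe A r s M \<doteq> P \<Colon> T) \<and> invertible \<Gamma> P T"
proof (cases "canon \<Gamma> Pth r = canon \<Gamma> Pth s")
  case True
  have rs: "deq \<Gamma> Pth r s" using r s True by (rule canon_eqD)
  have "\<Gamma> \<turnstile> Coe A r s M \<doteq> Coe A r s M' \<Colon> inst [s] A"
    using A M r s by (blast intro: coe deq_refl is_dim_sound ty_refl1)
  moreover have "\<Gamma> \<turnstile> Coe A r s M' \<doteq> M' \<Colon> inst [s] A"
    using A M rs by (blast intro: coe_id ty_refl1 tm_refl2)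
  ultimately have eq: "\<Gamma> \<turnstile> Coe A r s M \<doteq> M' \<Colon> inst [s] A" by (rule tm_trans)
  show ?thesis
  proof (cases "inst [r] A = inst [s] A")
    case eq': True
    then have "P = M'" "T = inst [s] A" using assms(1) True unfolding infer_coe_def by auto
    then show ?thesis using eq invertible eq' by auto
  next
    case False
    then show ?thesis using assms(1,2) True eq check_at_trans unfolding infer_coe_def by auto
  qed
next
  case False
  then have "P = Coe A' (canon \<Gamma> Pth r) (canon \<Gamma> Pth s) M'" "T = inst [s] A"
    using assms(1) by (auto simp: infer_coe_def)
  then show ?thesis using coe[OF A canon_sound[OF r] canon_sound[OF s] M] by (simp add: invertible_neutral)
qed

lemma check_box_sound:
  assumes "check_box f \<Gamma> r A M T" and "\<turnstile> \<Gamma>" and A: "\<Gamma> \<turnstile> A \<doteq> A type Lg" and r: "is_dim \<Gamma> Pth r" and M: "\<Gamma> \<turnstile> M \<Colon> A"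
  shows "box_eq \<Gamma> A A r r M M T T"
proof (rule Defs.box[OF A])
  have tubes: "i = Pth \<and> is_dim \<Gamma> i u \<and> is_dim \<Gamma> i v \<and> check f (Dim Pth # Cs i u v # \<Gamma>) N (wk 2 A) \<noteq> None \<and>
     check_eq f (Cs i u v # \<Gamma>) (inst [wk 1 r] N) (wk 1 M) (wk 1 A) \<noteq> None"
    if "(i, u, v, N) \<in> set T" for i u v N
    using assms(1) that by (auto simp: check_box_def check_tube_def list_all_iff)
  have cstr: "cstr \<Gamma> i u v" if "(i, u, v, N) \<in> set T" for i u v N
    using tubes[OF that] by (auto simp: cstr_def intro: is_dim_sound)
  show "deq \<Gamma> Pth r r" using r by (auto intro: deq_refl is_dim_sound)
  show "\<Gamma> \<turnstile> M \<Colon> A" by fact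
  show "i = i' \<and> cstr \<Gamma> i u v \<and> cstr \<Gamma> i u' v' \<and> deq \<Gamma> i u u' \<and> deq \<Gamma> i v v' \<and>
        (Dim Pth # Cs i u v # \<Gamma> \<turnstile> N \<doteq> N' \<Colon> wk 2 A) \<and>
        (Cs i u v # \<Gamma> \<turnstile> inst [wk 1 r] N \<doteq> wk 1 M \<Colon> wk 1 A)"
    if "((i, u, v, N), (i', u', v', N')) \<in> set (zip T T)" for i u v N i' u' v' N'
  proof -
    have t: "(i, u, v, N) \<in> set T" and "(i', u', v', N') = (i, u, v, N)"
      using that by (auto simp: zip_same_conv_map)
    moreover have "\<turnstile> Cs i u v # \<Gamma>" using cstr[OF t] assms(2) by (rule wf_cs[rotated])
    ultimately show ?thesis using tubes[OF t] cstr[OF t]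
      by (auto simp: cstr_def intro: deq_refl check_eq_sound wf_dim dest: check_sound tm_refl1)
  qed
  show "Dim Pth # Cs j (wk 1 w) (wk 1 z) # Cs i u v # \<Gamma> \<turnstile> ren (upr Suc) N \<doteq> ren (upr (upr Suc)) K \<Colon> wk 3 A"
    if "(i, u, v, N) \<in> set T" "(j, w, z, K) \<in> set T" for i u v N j w z K
  proof -
    have "\<turnstile> Cs i u v # \<Gamma>" using cstr[OF that(1)] assms(2) by (rule wf_cs[rotated])
    moreover have "cstr (Cs i u v # \<Gamma>) j (wk 1 w) (wk 1 z)"
      using cstr[OF that(2)] tubes[OF that(2)] by (auto simp: cstr_def intro: dim_wk[simplified])
    ultimately have "\<turnstile> Dim Pth # Cs j (wk 1 w) (wk 1 z) # Cs i u v # \<Gamma>" by (rule wf_dim[OF wf_cs])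
    moreover have "check_eq f (Dim Pth # Cs j (wk 1 w) (wk 1 z) # Cs i u v # \<Gamma>)
       (ren (upr Suc) N) (ren (upr (upr Suc)) K) (wk 3 A) \<noteq> None"
      using assms(1) that by (auto simp: check_box_def check_overlap_def list_all_iff)
    ultimately show ?thesis by (auto intro: check_eq_sound)
  qed
qed simp

lemma hcom_sound:
  assumes "(if check_box f \<Gamma> r A M T then if canon \<Gamma> Pth r = canon \<Gamma> Pth s then Some (M', A)
         else infer_hcom f \<Gamma> s A (find (\<lambda>(i, u, v, N). canon \<Gamma> i u = canon \<Gamma> i v) T) (HCom r s A M T)
       else None) = Some (P, C)" and "\<turnstile> \<Gamma>" and r: "is_dim \<Gamma> Pth r" and s: "is_dim \<Gamma> Pth s"
    and A: "\<Gamma> \<turnstile> A \<doteq> A type Lg" and M: "\<Gamma> \<turnstile> M \<doteq> M' \<Colon> A" and invertible: "invertible \<Gamma> M' A"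
  shows "(\<Gamma> \<turnstile> HCom r s A M T \<doteq> P \<Colon> C) \<and> invertible \<Gamma> P C"
proof -
  have b: "check_box f \<Gamma> r A M T" using assms(1) by (auto split: if_splits)
  then have box: "box_eq \<Gamma> A A r r M M T T" using assms(2) A r tm_refl1[OF M] by (rule check_box_sound)
  show ?thesis
  proof (cases "canon \<Gamma> Pth r = canon \<Gamma> Pth s")
    case True
    then have "\<Gamma> \<turnstile> HCom r s A M T \<doteq> M \<Colon> A" using box r s by (blast intro: hcom_id canon_eqD)
    then show ?thesis using assms(1) b True M invertible by (auto intro: tm_trans)
  next
    case False
    show ?thesis
    proof (cases "find (\<lambda>(i, u, v, N). canon \<Gamma> i u = canon \<Gamma> i v) T")
      case None
      then have "P = HCom r s A M T" "C = A" using assms(1) b False by auto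
      then show ?thesis using box s by (auto intro: hcom deq_refl is_dim_sound invertible_neutral)
    next
      case (Some t)
      then obtain i u v N where t: "t = (i, u, v, N)" by (cases t)
      have mem: "(i, u, v, N) \<in> set T" and uv: "canon \<Gamma> i u = canon \<Gamma> i v"
        using Some unfolding t find_Some_iff by (auto dest: nth_mem)
      have "is_dim \<Gamma> i u" "is_dim \<Gamma> i v" using b mem by (auto simp: check_box_def check_tube_def list_all_iff)
      then have "\<Gamma> \<turnstile> HCom r s A M T \<doteq> inst [s, Triv] N \<Colon> A"
        using box s mem uv by (blast intro: hcom_tube is_dim_sound canon_eqD)
      moreover have "check_at f \<Gamma> (inst [s, Triv] N) A = Some (P, C)"
        using assms(1) b False Some unfolding t by (simp only: if_True if_False infer_hcom.simps)
      ultimately show ?thesis using assms(2) check_at_trans by blast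
    qed
  qed
qed

lemma infer_plam_sound:
  assumes "do { (b', A) \<leftarrow> infer f (Dim Pth # \<Gamma>) b; M0 \<leftarrow> check f \<Gamma> (inst [I0] b') (inst [I0] A);
     M1 \<leftarrow> check f \<Gamma> (inst [I1] b') (inst [I1] A); Some (PLam b', PathT A M0 M1) } = Some (P, T)" and "\<turnstile> \<Gamma>"
  shows "(\<Gamma> \<turnstile> PLam b \<doteq> P \<Colon> T) \<and> invertible \<Gamma> P T"
proof -
  from assms(1) obtain b' A M0 M1 where *: "infer f (Dim Pth # \<Gamma>) b = Some (b', A)"
    "check f \<Gamma> (inst [I0] b') (inst [I0] A) = Some M0" "check f \<Gamma> (inst [I1] b') (inst [I1] A) = Some M1"
    and P: "P = PLam b'" "T = PathT A M0 M1"
    by (auto split: bind_splits)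
  have b: "Dim Pth # \<Gamma> \<turnstile> b \<doteq> b' \<Colon> A" using *(1) assms(2) by (blast intro: infer_sound[THEN conjunct1] wf_dim)
  have "\<Gamma> \<turnstile> PLam b' \<doteq> PLam b \<Colon> T"
    unfolding P using * assms(2) by (intro plam tm_sym[OF b]) (blast intro: check_sound[THEN conjunct1])+
  then show ?thesis using b unfolding P by (auto simp: invertible_def intro: tm_sym tm_refl2)
qed

lemma infer_type_sound: "infer_type f \<Gamma> A = Some (P, T) \<Longrightarrow> \<turnstile> \<Gamma> \<Longrightarrow> (\<Gamma> \<turnstile> A \<doteq> P \<Colon> T) \<and> invertible \<Gamma> P T"
  unfolding infer_type_def by (auto simp: invertible_def split: bind_splits intro: univ_code check_type_sound)

lemma infer_step_sound:
  assumes "infer_step f \<Gamma> M = Some (P, T)" and "\<turnstile> \<Gamma>"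
  shows "(\<Gamma> \<turnstile> M \<doteq> P \<Colon> T) \<and> invertible \<Gamma> P T"
proof (cases M)
  case (Var k)
  then show ?thesis using assms by (auto dest!: infer_var_sound intro: tm_var[simplified] invertible_neutral)
next
  case (App K N)
  then show ?thesis using assms infer_call_sound by simp
next
  case (Fst N)
  then obtain N' C where "infer_whnf f \<Gamma> N = Some (N', C)" "infer_fst f \<Gamma> N' C = Some (P, T)"
    using assms(1) by (auto split: bind_splits)
  then show ?thesis using assms(2) Fst infer_fst_sound infer_whnf_sound by blast
next
  case (Snd N)
  then obtain N' C where "infer_whnf f \<Gamma> N = Some (N', C)" "infer_snd N' C = Some (P, T)"
    using assms(1) by (auto split: bind_splits)
  then show ?thesis using assms(2) Snd infer_snd_sound infer_whnf_sound by blast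
next
  case (PApp N r)
  then obtain N' C where "is_dim \<Gamma> Pth r" "is_dim \<Gamma> Pth (canon \<Gamma> Pth r)" "infer_whnf f \<Gamma> N = Some (N', C)"
    "infer_papp f \<Gamma> (canon \<Gamma> Pth r) N' C = Some (P, T)"
    using assms(1) by (auto split: bind_splits if_splits)
  then show ?thesis using assms(2) PApp infer_papp_sound infer_whnf_sound canon_sound is_dim_sound by blast
next
  case (PLam b)
  then show ?thesis using assms infer_plam_sound by (simp only: infer_step.simps)
next
  case (Coe A r s N)
  then obtain A' N' where *: "is_dim \<Gamma> Pth r" "is_dim \<Gamma> Pth s" "check_type f Lg (Dim Pth # \<Gamma>) A = Some A'"
    "check f \<Gamma> N (inst [r] A) = Some N'" "infer_coe f \<Gamma> r s A' N' (inst [r] A) (inst [s] A) = Some (P, T)"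
    using assms(1) by (auto split: bind_splits if_splits)
  show ?thesis unfolding Coe
    by (rule infer_coe_sound[OF *(5) assms(2) *(1,2) check_type_sound[OF *(3) wf_dim[OF assms(2)]]
          check_sound[OF *(4) assms(2), THEN conjunct1] check_sound[OF *(4) assms(2), THEN conjunct2]])
next
  case (HCom r s A N Ts)
  then obtain A' N' where *: "is_dim \<Gamma> Pth r" "is_dim \<Gamma> Pth s" "check_type f Lg \<Gamma> A = Some A'" "check f \<Gamma> N A = Some N'"
    and it: "(if check_box f \<Gamma> r A N Ts then if canon \<Gamma> Pth r = canon \<Gamma> Pth s then Some (N', A)
         else infer_hcom f \<Gamma> s A (find (\<lambda>(i, u, v, N). canon \<Gamma> i u = canon \<Gamma> i v) Ts) (HCom r s A N Ts)
       else None) = Some (P, T)"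
    using assms(1) by (simp split: bind_splits if_split_asm(1))
  show ?thesis unfolding HCom
    by (rule hcom_sound[OF it assms(2) *(1,2) ty_refl1[OF check_type_sound[OF *(3) assms(2)]]
          check_sound[OF *(4) assms(2), THEN conjunct1] check_sound[OF *(4) assms(2), THEN conjunct2]])
qed (use assms infer_type_sound in auto)

lemma step_sound: "sound (step f)"
  unfolding sound_def using infer_step_sound check_step_sound type_step_sound by auto

end

text \<open>\<open>step_sound\<close> treats an arbitrary sound checker for the recursive calls, so
  induction on the depth bound is all that is left.\<close>

lemma run_sound: "sound (run n)"
proof (induction n)
  case 0
  show ?case by (simp add: sound_def)
next
  case (Suc n)
  have "run (Suc n) = step (run n)" by (simp add: fun_eq_iff)
  then show ?case using step_sound[OF Suc] by simp
qed

section \<open>From checker runs to judgments\<close>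

fun check_ctx :: "nat \<Rightarrow> ctx \<Rightarrow> bool" where
  "check_ctx n [] = True"
| "check_ctx n (Tm A # \<Gamma>) = (check_ctx n \<Gamma> \<and> check_type (run n) Lg \<Gamma> A \<noteq> None)"
| "check_ctx n (Hid # \<Gamma>) = check_ctx n \<Gamma>"
| "check_ctx n (Dim i # \<Gamma>) = check_ctx n \<Gamma>"
| "check_ctx n (Cs i r s # \<Gamma>) = False"

lemma check_ctx_sound: "check_ctx n \<Gamma> \<Longrightarrow> \<turnstile> \<Gamma>"
  by (induction n \<Gamma> rule: check_ctx.induct) (auto intro: wf_nil wf_dim wf_hid wf_check_type[OF run_sound])

lemma run_check_type: "check_type (run n) s \<Gamma> A \<noteq> None \<Longrightarrow> check_ctx n \<Gamma> \<Longrightarrow> \<Gamma> \<turnstile> A \<doteq> A type s"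
  by (auto intro: ty_refl1 check_type_sound[OF run_sound] check_ctx_sound)

lemma run_check: "check (run n) \<Gamma> M A \<noteq> None \<Longrightarrow> check_ctx n \<Gamma> \<Longrightarrow> \<Gamma> \<turnstile> M \<Colon> A"
  by (blast intro: tm_refl1 check_sound[OF run_sound, THEN conjunct1] check_ctx_sound)

lemma run_check_eq: "check_eq (run n) \<Gamma> M N A \<noteq> None \<Longrightarrow> check_ctx n \<Gamma> \<Longrightarrow> \<Gamma> \<turnstile> M \<doteq> N \<Colon> A"
  by (blast intro: check_eq_sound[OF run_sound] check_ctx_sound)

section \<open>Parametricity\<close>

lemma wf_TmD: "\<turnstile> Tm A # \<Gamma> \<Longrightarrow> (\<turnstile> \<Gamma>) \<and> (\<Gamma> \<turnstile> A \<doteq> A type Lg)"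
  by (erule wf.cases) auto

definition pis :: "tm list \<Rightarrow> tm \<Rightarrow> tm" where
  "pis As B = foldr Pi As B"

definition lams :: "nat \<Rightarrow> tm \<Rightarrow> tm" where
  "lams n M = (Lam ^^ n) M"

lemma lams_pis: "\<turnstile> map Tm As \<Longrightarrow> map Tm As \<turnstile> M \<Colon> T \<Longrightarrow> [] \<turnstile> lams (length As) M \<Colon> pis (rev As) T"
proof (induction As arbitrary: M T)
  case (Cons A As)
  then have "map Tm As \<turnstile> Lam M \<Colon> Pi A T" by (auto dest!: wf_TmD intro: lam)
  then show ?case using Cons by (auto dest!: wf_TmD simp: lams_def pis_def funpow_swap1)
qed (simp add: lams_def pis_def)

section \<open>Gel types as bridges in the universe\<close>

definition check_gel :: "nat \<Rightarrow> ctx \<Rightarrow> tm \<Rightarrow> tm \<Rightarrow> tm \<Rightarrow> bool" where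
  "check_gel n \<Gamma> A B R \<longleftrightarrow> check_ctx n \<Gamma> \<and> check_type (run n) Sm \<Gamma> A \<noteq> None \<and> check_type (run n) Sm \<Gamma> B \<noteq> None \<and>
     check_type (run n) Sm (Tm (wk 1 B) # Tm A # \<Gamma>) R \<noteq> None \<and> check_type (run n) Lg (Tm A # \<Gamma>) (wk 1 B) \<noteq> None"

lemma check_gel_sound:
  assumes "check_gel n \<Gamma> A B R"
  shows "gel_eq \<Gamma> A A B B R R Sm" "gel_eq \<Gamma> A A B B R R Lg"
proof -
  have A: "\<Gamma> \<turnstile> A \<doteq> A type Sm" "\<Gamma> \<turnstile> B \<doteq> B type Sm"
    using assms unfolding check_gel_def by (blast intro: run_check_type)+
  have "\<turnstile> \<Gamma>" using assms unfolding check_gel_def by (blast intro: check_ctx_sound)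
  moreover have "\<turnstile> Tm A # \<Gamma>" using calculation A by (blast intro: wf_tm ty_lift)
  \<comment> \<open>The separate test of the weakened type stands in for a weakening lemma.\<close>
  ultimately have "\<turnstile> Tm (wk 1 B) # Tm A # \<Gamma>"
    using assms unfolding check_gel_def by (blast intro: wf_check_type[OF run_sound])
  then have R: "Tm (wk 1 B) # Tm A # \<Gamma> \<turnstile> R \<doteq> R type Sm"
    using assms unfolding check_gel_def by (blast intro: ty_refl1 check_type_sound[OF run_sound])
  show "gel_eq \<Gamma> A A B B R R Sm" "gel_eq \<Gamma> A A B B R R Lg" using A R by (blast intro: gel_data ty_lift)+
qed

text \<open>Into \<open>Univ\<close>, the bridge clause of \<open>Extent\<close> asks for a bridge
  between types. A Gel type is one, and its endpoint equations are the boundary conditions.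
  \<open>P\<close>, \<open>Q\<close>, \<open>R\<close> are checked over \<open>Hid\<close> because
  they must be fresh for the dimension; checking their endpoint instances again replaces a
  substitution lemma.\<close>

lemma extent_gel:
  fixes \<Gamma> A N0 N1 P Q R n
  defines "\<Delta> \<equiv> Tm (BridgeT (ren (upr (\<lambda>i. i + 2)) A) (Var 1) (Var 0)) # Tm (wk 1 (inst [B1] A)) # Tm (inst [B0] A) # \<Gamma>"
    and "N \<equiv> BLam (Gel (Var 0) P Q R)"
  assumes A: "Dim Brd # \<Gamma> \<turnstile> A \<doteq> A type Lg" and U: "Tm A # Dim Brd # \<Gamma> \<turnstile> Univ \<doteq> Univ type Lg"
    and N0: "Tm (inst [B0] A) # \<Gamma> \<turnstile> N0 \<Colon> Univ" and N1: "Tm (inst [B1] A) # \<Gamma> \<turnstile> N1 \<Colon> Univ"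
    and G: "check_gel n (Hid # \<Delta>) P Q R" and wf: "\<turnstile> Dim Brd # \<Delta>"
    and G0: "check_gel n \<Delta> (inst [B0] P) (inst [B0] Q) (sub (up (up (scons [B0] Var))) R)"
    and G1: "check_gel n \<Delta> (inst [B1] P) (inst [B1] Q) (sub (up (up (scons [B1] Var))) R)"
    and P: "inst [B0] P = wk 2 N0" and Q: "inst [B1] Q = ren (case_nat 1 (\<lambda>i. i + 3)) N1"
  shows "extent_eq \<Gamma> A Univ N0 N0 N1 N1 N N"
proof -
  have "Dim Brd # \<Delta> \<turnstile> Gel (Var 0) P Q R \<Colon> Univ"
    by (rule univ_code[OF gel[OF wf]]) (auto simp: cut_def intro: dim_var check_gel_sound(1)[OF G])
  moreover have "\<Delta> \<turnstile> Gel B0 (inst [B0] P) (inst [B0] Q) (sub (up (up (scons [B0] Var))) R) \<doteq> wk 2 N0 \<Colon> Univ"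
    unfolding P[symmetric] by (rule univ_code[OF gel_0[OF check_gel_sound(1)[OF G0]]])
  moreover have "\<Delta> \<turnstile> Gel B1 (inst [B1] P) (inst [B1] Q) (sub (up (up (scons [B1] Var))) R)
      \<doteq> ren (case_nat 1 (\<lambda>i. i + 3)) N1 \<Colon> Univ"
    unfolding Q[symmetric] by (rule univ_code[OF gel_1[OF check_gel_sound(1)[OF G1]]])
  ultimately have N: "\<Delta> \<turnstile> N \<Colon> BridgeT (sub (scons [BApp (Var 1) (Var 0), Var 0] (\<lambda>i. Var (i + 4))) Univ)
     (wk 2 N0) (ren (case_nat 1 (\<lambda>i. i + 3)) N1)"
    unfolding N_def sub.simps by (intro blam) simp_all
  show ?thesis by (rule extent_data[OF A U _ _ N[unfolded \<Delta>_def]]) (use N0 N1 in simp_all)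
qed

text \<open>
  The variables \<open>0, \<dots>, 9\<close> of \<open>param_ctx\<close> are \<open>r, u, w, R, Y, X, k, a', a, A\<close>, where
  \<open>k : Leibniz A a a'\<close>, \<open>R b\<^sub>0 b\<^sub>1 c\<close> is a relation between \<open>X b\<^sub>0\<close> and \<open>Y b\<^sub>1\<close> for each bridge \<open>c\<close> from
  \<open>b\<^sub>0\<close> to \<open>b\<^sub>1\<close>, and \<open>r : R a a (\<lambda>_. a) w u\<close>.
\<close>

abbreviation rel :: "nat \<Rightarrow> nat \<Rightarrow> nat \<Rightarrow> tm \<Rightarrow> tm \<Rightarrow> tm \<Rightarrow> tm" where
  "rel R a b C P Q \<equiv> App (App (App (App (App (Var R) (Var a)) (Var b)) C) P) Q"

definition param_tele :: "tm list" where
  "param_tele = [rel 2 7 7 (BLam (Var 8)) (Var 1) (Var 0), App (Var 2) (Var 6), App (Var 2) (Var 5),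
     Pi (Var 5) (Pi (Var 6) (Pi (Bridge (Var 7) (Var 1) (Var 0)) (Pi (App (Var 4) (Var 2)) (Pi (App (Var 4) (Var 2)) Univ)))),
     Arrow (Var 4) Univ, Arrow (Var 3) Univ, Leibniz (Var 2) (Var 1) (Var 0), Var 1, Var 0, Univ]"

definition param_ctx :: ctx where
  "param_ctx = map Tm param_tele"

definition val0 where
  "val0 = App (App (Var 6) (Var 5)) (Var 2)"

definition val1 where
  "val1 = App (App (Var 6) (Var 4)) (Var 1)"

text \<open>That \<open>k X w\<close> and \<open>k Y u\<close> are related over the constant bridge
  at \<open>a'\<close>: the conclusion of binary parametricity.\<close>

definition param_result :: tm where
  "param_result = rel 3 7 7 (BLam (Var 8)) val0 val1"

text \<open>
  Over \<open>m\<close> further variables: the family with \<open>X\<close> at \<open>r = 0\<close>, \<open>Y\<close> at \<open>r = 1\<close>, and at a fresh \<open>x\<close> the type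
  \<open>Gel\<^sub>x (X (c 0)) (Y (c 1)) (R (c 0) (c 1) c)\<close> over the points of a bridge \<open>c\<close>.
\<close>

definition fam_extent :: "nat \<Rightarrow> tm \<Rightarrow> tm \<Rightarrow> tm" where
  "fam_extent m r M = Extent r M (App (Var (6 + m)) (Var 0)) (App (Var (5 + m)) (Var 0))
     (BLam (Gel (Var 0) (App (Var (9 + m)) (Var 3)) (App (Var (8 + m)) (Var 2)) (rel (9 + m) 5 4 (Var 3) (Var 1) (Var 0))))"

definition bridge_family where
  "bridge_family = Lam (fam_extent 2 (Var 1) (Var 0))"

text \<open>\<open>k\<close> applied to the bridge of families and to the bridge from
  \<open>w\<close> to \<open>u\<close> given by \<open>r\<close>; \<open>Ungel\<close> extracts the
  relation between its ends.\<close>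

definition family_image where
  "family_image = App (App (Var 7) bridge_family) (GelIn (Var 0) (Var 3) (Var 2) (Var 1))"

text \<open>Closed, so that \<open>sub_nil\<close> carries it into every well-formed
  context.\<close>

definition param_term :: tm where
  "param_term = lams (length param_tele) (Ungel family_image)"

definition param_type :: tm where
  "param_type = pis (rev param_tele) param_result"

text \<open>
  \<open>\<Xi>\<close> is \<open>[Hid, Hid]\<close> under the abstraction of \<open>bridge_family\<close>, \<open>[Hid]\<close> when \<open>bridge_family\<close> is applied,
  and \<open>[Tm (Var 9)]\<close> under its abstraction at an endpoint.
\<close>

definition check_extent :: "ctx \<Rightarrow> bool" where
  "check_extent \<Xi> \<longleftrightarrow> (let m = length \<Xi>; \<Gamma> = \<Xi> @ param_ctx; A = Var (10 + m);
     N0 = App (Var (6 + m)) (Var 0); N1 = App (Var (5 + m)) (Var 0);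
     P = App (Var (9 + m)) (Var 3); Q = App (Var (8 + m)) (Var 2); R = rel (9 + m) 5 4 (Var 3) (Var 1) (Var 0);
     \<Delta> = Tm (BridgeT (ren (upr (\<lambda>i. i + 2)) A) (Var 1) (Var 0)) # Tm (wk 1 (inst [B1] A)) # Tm (inst [B0] A) # \<Gamma> in
     check_ctx 30 \<Delta> \<and> check_type (run 30) Lg (Dim Brd # \<Gamma>) A \<noteq> None \<and>
     check_type (run 30) Lg (Tm A # Dim Brd # \<Gamma>) Univ \<noteq> None \<and>
     check (run 30) (Tm (inst [B0] A) # \<Gamma>) N0 Univ \<noteq> None \<and> check (run 30) (Tm (inst [B1] A) # \<Gamma>) N1 Univ \<noteq> None \<and>
     check_gel 30 (Hid # \<Delta>) P Q R \<and>
     check_gel 30 \<Delta> (inst [B0] P) (inst [B0] Q) (sub (up (up (scons [B0] Var))) R) \<and>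
     check_gel 30 \<Delta> (inst [B1] P) (inst [B1] Q) (sub (up (up (scons [B1] Var))) R) \<and>
     inst [B0] P = wk 2 N0 \<and> inst [B1] Q = ren (case_nat 1 (\<lambda>i. i + 3)) N1)"

lemma param_ctx_ok: "check_ctx 30 param_ctx"
  by code_simp
lemma extent_ok_Hid2: "check_extent [Hid, Hid]"
  by code_simp

lemma extent_ok_Hid: "check_extent [Hid]"
  by code_simp

lemma extent_ok_Tm: "check_extent [Tm (Var 9)]"
  by code_simp

lemma wf_param_ctx: "\<turnstile> param_ctx" using param_ctx_ok check_ctx_sound by blast

lemma extent_param:
  assumes "check_extent \<Xi>" and m: "m = length \<Xi>" and \<Gamma>: "\<Gamma> = \<Xi> @ param_ctx"
  shows "extent_eq \<Gamma> (Var (10 + m)) Univ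
     (App (Var (6 + m)) (Var 0)) (App (Var (6 + m)) (Var 0)) (App (Var (5 + m)) (Var 0)) (App (Var (5 + m)) (Var 0))
     (BLam (Gel (Var 0) (App (Var (9 + m)) (Var 3)) (App (Var (8 + m)) (Var 2)) (rel (9 + m) 5 4 (Var 3) (Var 1) (Var 0))))
     (BLam (Gel (Var 0) (App (Var (9 + m)) (Var 3)) (App (Var (8 + m)) (Var 2)) (rel (9 + m) 5 4 (Var 3) (Var 1) (Var 0))))"
proof -
  note * = assms(1)[unfolded check_extent_def Let_def, folded m \<Gamma>]
  have 1: "check_ctx 30 (Dim Brd # \<Gamma>)" "check_ctx 30 (Tm (Var (10 + m)) # Dim Brd # \<Gamma>)"
    "check_ctx 30 (Tm (inst [B0] (Var (10 + m))) # \<Gamma>)" "check_ctx 30 (Tm (inst [B1] (Var (10 + m))) # \<Gamma>)"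
    using * by simp_all
  show ?thesis
    by (rule extent_gel[where n = 30]; insert * 1; blast intro: run_check_type run_check check_ctx_sound wf_dim)
qed

text \<open>The value of the bridge family at a variable \<open>c\<close> fresh for the dimension:
  the bridge passed to the relation is constant.\<close>

definition gel_at :: "nat \<Rightarrow> nat \<Rightarrow> tm" where
  "gel_at m c = Gel (Var 0) (App (Var (5 + m)) (Var c)) (App (Var (4 + m)) (Var c))
     (rel (5 + m) (c + 2) (c + 2) (BLam (Var (c + 3))) (Var 1) (Var 0))"

text \<open>Side conditions of \<open>app_family\<close>, evaluated at 9 and 8, the indices of
  \<open>a\<close> and \<open>a'\<close> under one bridge dimension.\<close>

definition check_gel_at :: "nat \<Rightarrow> bool" where
  "check_gel_at c \<longleftrightarrow>
     inst [Var c] (fam_extent 2 (Var 1) (Var 0)) = fam_extent 1 (Var 0) (Var c) \<and>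
     check_gel 30 (Hid # Hid # param_ctx) (App (Var 7) (Var (c + 1))) (App (Var 6) (Var (c + 1)))
        (rel 7 (c + 3) (c + 3) (BLam (Var (c + 4))) (Var 1) (Var 0)) \<and>
     check_gel 30 (Hid # param_ctx) (App (Var 6) (Var c)) (App (Var 5) (Var c))
        (rel 6 (c + 2) (c + 2) (BLam (Var (c + 3))) (Var 1) (Var 0)) \<and>
     (case fam_extent 1 (Var 0) (Var c) of Extent r M N0 N1 N \<Rightarrow>
        inst [BLam (Var (c + 1)), inst [B1] (Var (c + 1)), inst [B0] (Var (c + 1))] N = BLam (gel_at 2 (c + 1)) | _ \<Rightarrow> False) \<and>
     inst [Var 0] (gel_at 2 (c + 1)) = gel_at 1 c \<and> inst [Var 0] (Var (c + 1)) = Var c \<and>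
     check (run 30) (Dim Brd # param_ctx) (Var c) (Var 10) \<noteq> None \<and>
     check (run 30) (Dim Brd # Hid # param_ctx) (Var (c + 1)) (Var 11) \<noteq> None"

lemma gel_at_ok: "check_gel_at 8 \<and> check_gel_at 9 \<and> check_type (run 30) Lg (Dim Brd # param_ctx) (Var 10) \<noteq> None"
  by code_simp

lemma fam_extent_type: "Tm (Var 10) # Dim Brd # param_ctx \<turnstile> fam_extent 2 (Var 1) (Var 0) \<Colon> Univ"
proof -
  have rc: "check_ctx 30 (Tm (Var 10) # Dim Brd # param_ctx)" using param_ctx_ok gel_at_ok by simp
  have wf: "\<turnstile> Tm (Var 10) # Dim Brd # param_ctx" using rc by (rule check_ctx_sound)
  \<comment> \<open>The point of \<open>A\<close> comes after the dimension and may depend on it, so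
    the restriction hides both.\<close>
  have cut: "cut (Tm (Var 10) # Dim Brd # param_ctx) (Var 1) = [Hid, Hid] @ param_ctx" by (simp add: cut_def)
  have "Tm (Var 10) # Dim Brd # param_ctx \<turnstile> Var 0 \<Colon> inst [Var 1] (Var (10 + 2))"
    using tm_var[OF wf, of 0 "Var 10"] by simp
  from extent[OF wf _ extent_param[OF extent_ok_Hid2 _ cut, of 2] this]
  show ?thesis by (simp add: fam_extent_def dim_var)
qed

text \<open>A point that precedes the dimension is a constant bridge in it, so
  \<open>extent_beta\<close> applies, and \<beta> for bridges then exposes the Gel type.\<close>

lemma app_family:
  assumes "check_gel_at c"
  shows "Dim Brd # param_ctx \<turnstile> App bridge_family (Var c) \<doteq> gel_at 1 c \<Colon> Univ"
proof -
  note * = assms[unfolded check_gel_at_def]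
  have rc: "check_ctx 30 (Dim Brd # param_ctx)" "check_ctx 30 (Dim Brd # Hid # param_ctx)" using param_ctx_ok by simp_all
  have wf: "\<turnstile> Dim Brd # param_ctx" "\<turnstile> Dim Brd # Hid # param_ctx" using rc by (auto intro: check_ctx_sound)
  have cut: "cut (Dim Brd # param_ctx) (Var 0) = [Hid] @ param_ctx"
    "cut (Dim Brd # Hid # param_ctx) (Var 0) = Hid # Hid # param_ctx" by (simp_all add: cut_def)
  have c: "Dim Brd # param_ctx \<turnstile> Var c \<Colon> Var 10" "Dim Brd # Hid # param_ctx \<turnstile> Var (c + 1) \<Colon> Var 11"
    using * rc by (blast intro: run_check)+
  have "Dim Brd # param_ctx \<turnstile> App bridge_family (Var c) \<doteq> inst [Var c] (fam_extent 2 (Var 1) (Var 0)) \<Colon> inst [Var c] Univ"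
    unfolding bridge_family_def by (rule pi_beta[OF fam_extent_type c(1)])
  then have 1: "Dim Brd # param_ctx \<turnstile> App bridge_family (Var c) \<doteq> fam_extent 1 (Var 0) (Var c) \<Colon> Univ"
    using * by simp
  have "Dim Brd # cut (Dim Brd # param_ctx) (Var 0) \<turnstile> Var (c + 1) \<Colon> Var (10 + 1)"
    using c(2) by (simp add: cut)
  from extent_beta[OF wf(1) _ extent_param[OF extent_ok_Hid _ cut(1), of 1] this]
  have 2: "Dim Brd # param_ctx \<turnstile> fam_extent 1 (Var 0) (Var c) \<doteq> BApp (BLam (gel_at 2 (c + 1))) (Var 0) \<Colon> Univ"
    using * by (simp add: fam_extent_def dim_var)
  have "Dim Brd # Hid # param_ctx \<turnstile> gel_at 2 (c + 1) \<Colon> Univ"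
    unfolding gel_at_def using * wf(2) by (auto simp: cut numeral_eq_Suc intro!: univ_code gel dim_var check_gel_sound(1))
  then have "Dim Brd # cut (Dim Brd # param_ctx) (Var 0) \<turnstile> gel_at 2 (c + 1) \<Colon> Univ" by (simp add: cut)
  from bridge_beta[OF wf(1) _ this]
  have "Dim Brd # param_ctx \<turnstile> BApp (BLam (gel_at 2 (c + 1))) (Var 0) \<doteq> gel_at 1 c \<Colon> Univ"
    using * by (simp add: dim_var)
  then show ?thesis using 1 2 by (blast intro: tm_trans)
qed

lemma app_eq: "\<Gamma> \<turnstile> M \<doteq> M' \<Colon> Pi A B \<Longrightarrow> \<Gamma> \<turnstile> N \<doteq> N' \<Colon> A \<Longrightarrow> inst [N] B = C \<Longrightarrow> \<Gamma> \<turnstile> App M N \<doteq> App M' N' \<Colon> C"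
  by (blast intro: app)

lemma bridge_family: "Dim Brd # param_ctx \<turnstile> bridge_family \<Colon> Pi (Var 10) Univ"
  unfolding bridge_family_def by (rule lam[OF _ fam_extent_type]) (use param_ctx_ok gel_at_ok in \<open>auto intro!: run_check_type\<close>)

lemma family_image_ok:
  "(let \<Gamma> = param_ctx; \<Delta> = Hid # param_ctx; R = rel 6 11 11 (BLam (Var 12)) (Var 1) (Var 0) in
   check (run 30) \<Delta> (Var 3) (App (Var 6) (Var 9)) \<noteq> None \<and>
   check (run 30) \<Delta> (Var 2) (App (Var 5) (Var 9)) \<noteq> None \<and>
   check (run 30) \<Delta> (Var 1) (inst [Var 2, Var 3] R) \<noteq> None \<and>
   check (run 30) (Dim Brd # param_ctx) (Var 7) (Pi (Pi (Var 10) Univ) (Arrow (App (Var 0) (Var 10)) (App (Var 0) (Var 9)))) \<noteq> None \<and>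
   inst [bridge_family] (Arrow (App (Var 0) (Var 10)) (App (Var 0) (Var 9)))
      = Arrow (App bridge_family (Var 9)) (App bridge_family (Var 8)) \<and>
   inst [GelIn (Var 0) (Var 3) (Var 2) (Var 1)] (wk 1 (App bridge_family (Var 8))) = App bridge_family (Var 8) \<and>
   check_gel 30 param_ctx (App (Var 5) (Var 7)) (App (Var 4) (Var 7)) (rel 5 9 9 (BLam (Var 10)) (Var 1) (Var 0)) \<and>
   check_gel 30 param_ctx (App (Var 5) (Var 8)) (App (Var 4) (Var 8)) (rel 5 10 10 (BLam (Var 11)) (Var 1) (Var 0)))"
  by code_simp

section \<open>Endpoints of the image under \<open>k\<close>\<close>

definition end_image where
  "end_image e = App (App (Var 6) (Lam (fam_extent 1 (End Brd e) (Var 0)))) (GelIn (End Brd e) (Var 2) (Var 1) (Var 0))"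

lemma end_image_ok:
  "check_eq (run 30) param_ctx (Lam (App (Var 6) (Var 0))) (Var 5) (Pi (Var 9) Univ) \<noteq> None \<and>
   check_eq (run 30) param_ctx (Lam (App (Var 5) (Var 0))) (Var 4) (Pi (Var 9) Univ) \<noteq> None \<and>
   check_type (run 30) Lg param_ctx (Var 9) \<noteq> None \<and>
   check (run 30) (Tm (Var 9) # param_ctx) (Var 0) (Var 10) \<noteq> None \<and>
   check (run 30) param_ctx (Var 2) (App (Var 5) (Var 8)) \<noteq> None \<and>
   check (run 30) param_ctx (Var 1) (App (Var 4) (Var 8)) \<noteq> None \<and>
   check (run 30) param_ctx (Var 0) (inst [Var 1, Var 2] (rel 5 10 10 (BLam (Var 11)) (Var 1) (Var 0))) \<noteq> None \<and>
   check (run 30) param_ctx (Var 6) (Pi (Pi (Var 9) Univ) (Pi (App (Var 0) (Var 9)) (App (Var 1) (Var 9)))) \<noteq> None \<and>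
   check (run 30) param_ctx (App (App (App (Var 3) (Var 7)) (Var 7)) (BLam (Var 8)))
      (Pi (App (Var 5) (Var 7)) (Pi (App (Var 5) (Var 8)) Univ)) \<noteq> None \<and>
   inst [val0] (Pi (App (Var 5) (Var 8)) Univ) = Pi (App (Var 4) (Var 7)) Univ"
  by code_simp

text \<open>By \<open>app_family\<close> at \<open>a\<close>, the Gel element inhabits the family at
  \<open>a\<close>; \<open>k\<close> moves it to the family at \<open>a'\<close>, which is again a
  Gel type.\<close>

lemma family_image: "Dim Brd # param_ctx \<turnstile> family_image \<Colon> gel_at 1 8"
proof -
  note * = family_image_ok[unfolded Let_def]
  have rc: "check_ctx 30 (Dim Brd # param_ctx)" "check_ctx 30 (Hid # param_ctx)" using param_ctx_ok by simp_all
  have wf: "\<turnstile> Dim Brd # param_ctx" using rc by (auto intro: check_ctx_sound)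
  have cut: "cut (Dim Brd # param_ctx) (Var 0) = Hid # param_ctx" by (simp add: cut_def)
  have gel9: "check_gel 30 (Hid # param_ctx) (App (Var 6) (Var 9)) (App (Var 5) (Var 9)) (rel 6 11 11 (BLam (Var 12)) (Var 1) (Var 0))"
    using gel_at_ok unfolding check_gel_at_def by simp
  have "Dim Brd # param_ctx \<turnstile> GelIn (Var 0) (Var 3) (Var 2) (Var 1) \<Colon> gel_at 1 9"
  proof -
    have "dim (Dim Brd # param_ctx) Brd (Var 0)" by (simp add: dim_var)
    moreover have "Hid # param_ctx \<turnstile> Var 3 \<Colon> App (Var 6) (Var 9)" "Hid # param_ctx \<turnstile> Var 2 \<Colon> App (Var 5) (Var 9)"
      "Hid # param_ctx \<turnstile> Var 1 \<Colon> inst [Var 2, Var 3] (rel 6 11 11 (BLam (Var 12)) (Var 1) (Var 0))"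
      using * rc by (blast intro: run_check)+
    ultimately have "Dim Brd # param_ctx \<turnstile> GelIn (Var 0) (Var 3) (Var 2) (Var 1)
        \<Colon> Gel (Var 0) (App (Var 6) (Var 9)) (App (Var 5) (Var 9)) (rel 6 11 11 (BLam (Var 12)) (Var 1) (Var 0))"
      using check_gel_sound(2)[OF gel9] by (intro gelin[OF wf]) (simp_all only: cut)
    then show ?thesis by (simp add: gel_at_def)
  qed
  moreover have "Dim Brd # param_ctx \<turnstile> gel_at 1 9 \<doteq> App bridge_family (Var 9) type Lg"
    using app_family[of 9] gel_at_ok by (blast intro: ty_lift univ_el tm_sym)
  ultimately have g: "Dim Brd # param_ctx \<turnstile> GelIn (Var 0) (Var 3) (Var 2) (Var 1) \<Colon> App bridge_family (Var 9)" by (rule tm_conv)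
  have "Dim Brd # param_ctx \<turnstile> Var 7 \<Colon> Pi (Pi (Var 10) Univ) (Arrow (App (Var 0) (Var 10)) (App (Var 0) (Var 9)))"
    using * rc by (blast intro: run_check)
  then have "Dim Brd # param_ctx \<turnstile> App (Var 7) bridge_family \<Colon> Arrow (App bridge_family (Var 9)) (App bridge_family (Var 8))"
    by (rule app_eq[OF _ bridge_family]) (use * in blast)
  then have "Dim Brd # param_ctx \<turnstile> family_image \<Colon> App bridge_family (Var 8)"
    unfolding family_image_def Arrow_def by (rule app_eq[OF _ g]) (use * in blast)
  moreover have "Dim Brd # param_ctx \<turnstile> App bridge_family (Var 8) \<doteq> gel_at 1 8 type Lg"
    using app_family[of 8] gel_at_ok by (blast intro: ty_lift univ_el)
  ultimately show ?thesis by (rule tm_conv)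
qed

lemma gel_at_eq: "gel_at 1 8 = Gel (Var 0) (wk 1 (App (Var 5) (Var 7))) (wk 1 (App (Var 4) (Var 7)))
       (ren (upr (upr Suc)) (rel 5 9 9 (BLam (Var 10)) (Var 1) (Var 0)))"
  by code_simp

lemma ungel_family_image: "param_ctx \<turnstile> Ungel family_image \<Colon> rel 3 7 7 (BLam (Var 8)) (end_image False) (end_image True)"
proof -
  note * = family_image_ok[unfolded Let_def]
  have "gel_eq param_ctx (App (Var 5) (Var 7)) (App (Var 5) (Var 7)) (App (Var 4) (Var 7)) (App (Var 4) (Var 7))
     (rel 5 9 9 (BLam (Var 10)) (Var 1) (Var 0)) (rel 5 9 9 (BLam (Var 10)) (Var 1) (Var 0)) Lg"
    using * by (blast intro: check_gel_sound(2))
  moreover have "Dim Brd # param_ctx \<turnstile> family_image \<Colon> Gel (Var 0) (wk 1 (App (Var 5) (Var 7))) (wk 1 (App (Var 4) (Var 7)))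
       (ren (upr (upr Suc)) (rel 5 9 9 (BLam (Var 10)) (Var 1) (Var 0)))"
    using family_image unfolding gel_at_eq .
  ultimately have "param_ctx \<turnstile> Ungel family_image \<Colon> inst [inst [B1] family_image, inst [B0] family_image]
      (rel 5 9 9 (BLam (Var 10)) (Var 1) (Var 0))"
    by (rule ungel)
  moreover have "inst [inst [B1] family_image, inst [B0] family_image]
      (rel 5 9 9 (BLam (Var 10)) (Var 1) (Var 0))
      = rel 3 7 7 (BLam (Var 8)) (end_image False) (end_image True)"
    by code_simp
  ultimately show ?thesis by (simp only:)
qed

text \<open>At an endpoint \<open>Extent\<close> reduces to its clause, which leaves an
  \<eta>-expansion of \<open>X\<close> or \<open>Y\<close>.\<close>

lemma end_family:
  "param_ctx \<turnstile> Lam (fam_extent 1 B0 (Var 0)) \<doteq> Var 5 \<Colon> Pi (Var 9) Univ"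
    "param_ctx \<turnstile> Lam (fam_extent 1 B1 (Var 0)) \<doteq> Var 4 \<Colon> Pi (Var 9) Univ"
proof -
  have rc: "check_ctx 30 param_ctx" "check_ctx 30 (Tm (Var 9) # param_ctx)" using param_ctx_ok end_image_ok by simp_all
  have A: "param_ctx \<turnstile> Var 9 \<doteq> Var 9 type Lg" using end_image_ok rc by (blast intro: run_check_type)
  have v: "Tm (Var 9) # param_ctx \<turnstile> Var 0 \<Colon> Var 10" using end_image_ok rc by (blast intro: run_check)
  have E: "extent_eq (Tm (Var 9) # param_ctx) (Var (10 + 1)) Univ
     (App (Var (6 + 1)) (Var 0)) (App (Var (6 + 1)) (Var 0)) (App (Var (5 + 1)) (Var 0)) (App (Var (5 + 1)) (Var 0))
     (BLam (Gel (Var 0) (App (Var (9 + 1)) (Var 3)) (App (Var (8 + 1)) (Var 2)) (rel (9 + 1) 5 4 (Var 3) (Var 1) (Var 0))))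
     (BLam (Gel (Var 0) (App (Var (9 + 1)) (Var 3)) (App (Var (8 + 1)) (Var 2)) (rel (9 + 1) 5 4 (Var 3) (Var 1) (Var 0))))"
    by (rule extent_param[OF extent_ok_Tm]) simp_all
  have "Tm (Var 9) # param_ctx \<turnstile> fam_extent 1 B0 (Var 0) \<doteq> App (Var 6) (Var 0) \<Colon> Univ"
    using extent_0[OF E, of "Var 0"] v by (simp add: fam_extent_def)
  moreover have "Tm (Var 9) # param_ctx \<turnstile> fam_extent 1 B1 (Var 0) \<doteq> App (Var 5) (Var 0) \<Colon> Univ"
    using extent_1[OF E, of "Var 0"] v by (simp add: fam_extent_def)
  moreover have "param_ctx \<turnstile> Lam (App (Var 6) (Var 0)) \<doteq> Var 5 \<Colon> Pi (Var 9) Univ"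
    "param_ctx \<turnstile> Lam (App (Var 5) (Var 0)) \<doteq> Var 4 \<Colon> Pi (Var 9) Univ"
    using end_image_ok rc by (blast intro: run_check_eq)+
  ultimately show "param_ctx \<turnstile> Lam (fam_extent 1 B0 (Var 0)) \<doteq> Var 5 \<Colon> Pi (Var 9) Univ"
    "param_ctx \<turnstile> Lam (fam_extent 1 B1 (Var 0)) \<doteq> Var 4 \<Colon> Pi (Var 9) Univ"
    using A by (blast intro: lam tm_trans)+
qed

lemma end_image_eq:
  "param_ctx \<turnstile> val0 \<doteq> end_image False \<Colon> App (Var 5) (Var 7)"
  "param_ctx \<turnstile> val1 \<doteq> end_image True \<Colon> App (Var 4) (Var 7)"
proof -
  note * = end_image_ok family_image_ok[unfolded Let_def]
  have rc: "check_ctx 30 param_ctx" using param_ctx_ok by simp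
  have G: "gel_eq param_ctx (App (Var 5) (Var 8)) (App (Var 5) (Var 8)) (App (Var 4) (Var 8)) (App (Var 4) (Var 8))
     (rel 5 10 10 (BLam (Var 11)) (Var 1) (Var 0)) (rel 5 10 10 (BLam (Var 11)) (Var 1) (Var 0)) Lg"
    using * by (blast intro: check_gel_sound(2))
  have k: "param_ctx \<turnstile> Var 6 \<Colon> Pi (Pi (Var 9) Univ) (Pi (App (Var 0) (Var 9)) (App (Var 1) (Var 9)))"
    and w: "param_ctx \<turnstile> Var 2 \<Colon> App (Var 5) (Var 8)" and u: "param_ctx \<turnstile> Var 1 \<Colon> App (Var 4) (Var 8)"
    and r: "param_ctx \<turnstile> Var 0 \<Colon> inst [Var 1, Var 2] (rel 5 10 10 (BLam (Var 11)) (Var 1) (Var 0))"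
    using * rc by (blast intro: run_check)+
  have "param_ctx \<turnstile> App (Var 6) (Var 5)
      \<doteq> App (Var 6) (Lam (fam_extent 1 B0 (Var 0))) \<Colon> Pi (App (Var 5) (Var 8)) (App (Var 6) (Var 8))"
    by (rule app_eq[OF k tm_sym[OF end_family(1)]]) code_simp
  then show "param_ctx \<turnstile> val0 \<doteq> end_image False \<Colon> App (Var 5) (Var 7)"
    unfolding val0_def end_image_def by (rule app_eq[OF _ tm_sym[OF gelin_0[OF G w u r]]]) code_simp
  have "param_ctx \<turnstile> App (Var 6) (Var 4)
      \<doteq> App (Var 6) (Lam (fam_extent 1 B1 (Var 0))) \<Colon> Pi (App (Var 4) (Var 8)) (App (Var 5) (Var 8))"
    by (rule app_eq[OF k tm_sym[OF end_family(2)]]) code_simp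
  then show "param_ctx \<turnstile> val1 \<doteq> end_image True \<Colon> App (Var 4) (Var 7)"
    unfolding val1_def end_image_def by (rule app_eq[OF _ tm_sym[OF gelin_1[OF G w u r]]]) code_simp
qed

lemma param: "[] \<turnstile> param_term \<Colon> param_type"
  unfolding param_term_def param_type_def
proof (rule lams_pis)
  have rc: "check_ctx 30 param_ctx" using param_ctx_ok by simp
  show "\<turnstile> map Tm param_tele" using wf_param_ctx by (simp add: param_ctx_def)
  have "param_ctx \<turnstile> App (App (App (Var 3) (Var 7)) (Var 7)) (BLam (Var 8))
      \<Colon> Pi (App (Var 5) (Var 7)) (Pi (App (Var 5) (Var 8)) Univ)"
    using end_image_ok rc by (blast intro: run_check)
  then have "param_ctx \<turnstile> App (App (App (App (Var 3) (Var 7)) (Var 7)) (BLam (Var 8))) val0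
      \<doteq> App (App (App (App (Var 3) (Var 7)) (Var 7)) (BLam (Var 8))) (end_image False) \<Colon> Pi (App (Var 4) (Var 7)) Univ"
    by (rule app_eq[OF _ end_image_eq(1)]) (use end_image_ok in blast)
  then have "param_ctx \<turnstile> param_result \<doteq> rel 3 7 7 (BLam (Var 8)) (end_image False) (end_image True) \<Colon> Univ"
    unfolding param_result_def by (rule app_eq[OF _ end_image_eq(2)]) simp
  then have "param_ctx \<turnstile> rel 3 7 7 (BLam (Var 8)) (end_image False) (end_image True) \<doteq> param_result type Lg"
    by (blast intro: ty_lift univ_el tm_sym)
  then show "map Tm param_tele \<turnstile> Ungel family_image \<Colon> param_result"
    using ungel_family_image by (simp only: param_ctx_def tm_conv)
qed

section \<open>Developments in a growing context\<close>

text \<open>Unlike the judgment for substitutions, this does not ask that the types of the context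
  be well formed, so it survives hiding entries; \<open>sat_sub\<close> recovers the judgment once
  the hidden context has been checked.\<close>

fun sat :: "ctx \<Rightarrow> (nat \<Rightarrow> tm) \<Rightarrow> ctx \<Rightarrow> bool" where
  "sat \<Gamma> \<sigma> [] = True"
| "sat \<Gamma> \<sigma> (Tm A # \<Theta>) = ((\<Gamma> \<turnstile> \<sigma> 0 \<Colon> sub (\<sigma> \<circ> Suc) A) \<and> sat \<Gamma> (\<sigma> \<circ> Suc) \<Theta>)"
| "sat \<Gamma> \<sigma> (Hid # \<Theta>) = sat \<Gamma> (\<sigma> \<circ> Suc) \<Theta>"
| "sat \<Gamma> \<sigma> (_ # \<Theta>) = False"

text \<open>Hiding the entries that a check does not use makes it much cheaper.\<close>

fun only :: "tm list \<Rightarrow> ctx \<Rightarrow> ctx" where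
  "only Ts [] = []"
| "only Ts (Tm A # \<Theta>) = (if A \<in> set Ts then Tm A else Hid) # only Ts \<Theta>"
| "only Ts (e # \<Theta>) = e # only Ts \<Theta>"

lemma sat_only: "sat \<Gamma> \<sigma> \<Theta> \<Longrightarrow> sat \<Gamma> \<sigma> (only Ts \<Theta>)"
  by (induction \<Gamma> \<sigma> \<Theta> rule: sat.induct) auto

lemma sat_sub: "sat \<Gamma> \<sigma> \<Theta> \<Longrightarrow> check_ctx n \<Theta> \<Longrightarrow> \<turnstile> \<Gamma> \<Longrightarrow> \<Gamma> \<turnstile> \<sigma> \<doteq> \<sigma> \<Rightarrow>\<^sub>s \<Theta>"
proof (induction \<Gamma> \<sigma> \<Theta> rule: sat.induct)
  case (2 \<Gamma> \<sigma> A \<Theta>)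
  then have "\<Gamma> \<turnstile> \<sigma> \<circ> Suc \<doteq> \<sigma> \<circ> Suc \<Rightarrow>\<^sub>s \<Theta>" by (simp add: comp_def)
  then show ?case using 2 by (intro sub_tm) (auto intro: run_check_type)
qed (auto intro: sub_nil sub_hid)

definition accepts :: "ctx \<Rightarrow> tm list \<Rightarrow> tm \<Rightarrow> tm \<Rightarrow> bool" where
  "accepts \<Theta> Ts A M \<longleftrightarrow> (let \<Theta>' = only Ts \<Theta> in
     check_ctx 50 \<Theta>' \<and> check_type (run 50) Lg \<Theta>' A \<noteq> None \<and> check (run 50) \<Theta>' M A \<noteq> None)"

text \<open>The bottom entry stands for the given type; the entries above it are hypotheses and
  results about it, all inhabited over \<Gamma>.\<close>

definition model :: "ctx \<Rightarrow> tm \<Rightarrow> ctx \<Rightarrow> bool" where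
  "model \<Gamma> A \<Theta> \<longleftrightarrow> (\<exists>\<sigma>. sat \<Gamma> \<sigma> \<Theta> \<and> \<sigma> (length \<Theta> - 1) = A) \<and> \<Theta> \<noteq> []"

text \<open>The values of the entries also satisfy the hidden context in which \<open>M\<close> was
  accepted, so substituting them into \<open>M\<close> gives the value of the new entry.\<close>

lemma model_step:
  assumes "\<turnstile> \<Gamma>" and "model \<Gamma> A \<Theta>" and "accepts \<Theta> Ts T M"
  shows "model \<Gamma> A (Tm T # \<Theta>)"
proof -
  obtain \<sigma> where \<sigma>: "sat \<Gamma> \<sigma> \<Theta>" "\<sigma> (length \<Theta> - 1) = A" and ne: "\<Theta> \<noteq> []" using assms(2) by (auto simp: model_def)
  have "\<Gamma> \<turnstile> \<sigma> \<doteq> \<sigma> \<Rightarrow>\<^sub>s only Ts \<Theta>" using \<sigma>(1) assms(1,3) by (auto simp: accepts_def Let_def intro: sat_sub sat_only)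
  moreover have "only Ts \<Theta> \<turnstile> M \<Colon> T" using assms(3) by (auto simp: accepts_def Let_def intro: run_check)
  ultimately have "\<Gamma> \<turnstile> sub \<sigma> M \<Colon> sub \<sigma> T" by (rule tm_sub[rotated])
  moreover have "case_nat (sub \<sigma> M) \<sigma> \<circ> Suc = \<sigma>" by auto
  ultimately have "sat \<Gamma> (case_nat (sub \<sigma> M) \<sigma>) (Tm T # \<Theta>)" using \<sigma> by simp
  moreover have "case_nat (sub \<sigma> M) \<sigma> (length (Tm T # \<Theta>) - 1) = A" using \<sigma>(2) ne by (cases \<Theta>) auto
  ultimately show ?thesis unfolding model_def by blast
qed

section \<open>Paths, transport and equivalences\<close>

definition base_ctx :: ctx where
  "base_ctx = [Tm param_type, Tm (isBDisc (Var 0)), Tm Univ]"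

abbreviation (input) app_infix :: "tm \<Rightarrow> tm \<Rightarrow> tm" (infixl \<open>\<cdot>\<close> 200) where
  "M \<cdot> N \<equiv> App M N"

abbreviation (input) papp_infix :: "tm \<Rightarrow> tm \<Rightarrow> tm" (infixl \<open>\<bullet>\<close> 200) where
  "M \<bullet> r \<equiv> PApp M r"

text \<open>
  Coercion along a constant line from \<open>0\<close> to \<open>0\<close> is the identity, so it serves as a type ascription.
\<close>

definition asc :: "tm \<Rightarrow> tm \<Rightarrow> tm" where
  "asc A M = Coe (wk 1 A) I0 I0 M"

text \<open>
  From \<open>\<phi>\<close> over \<open>m. Path (t m) c\<close> with \<open>\<phi> 0 = t\<close>, the square \<open>S i j\<close> with \<open>S 0 z = S z 0 = t z\<close> and
  \<open>S 1 z = S z 1 = c\<close>: compose \<open>c\<close> from \<open>k = 1\<close> to \<open>k = 0\<close> in the box with walls \<open>\<phi> 1 k\<close> at \<open>i = 1\<close>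
  and \<open>j = 1\<close>, \<open>\<phi> j k\<close> at \<open>i = 0\<close>, and \<open>\<phi> i k\<close> at \<open>j = 0\<close>. This is the only homogeneous composition
  of the whole argument.
\<close>

definition connection_from_type :: tm where
  "connection_from_type = pis [Univ, Var 0, Var 1, Path (Var 2) (Var 1) (Var 0), Path (Var 3)
     (Var 1) (Var 1), PathT (Path (Var 5) (Var 2 \<bullet> Var 0) (Var 3)) (Var 1) (Var 0)] (PathT (Path
     (Var 6) (Var 3 \<bullet> Var 0) (Var 4)) (Var 2) (PLam (Var 4)))"

definition connection_from_term :: tm where
  "connection_from_term = lams 6 (PLam (PLam (HCom I1 I0 (Var 7) (Var 5) [(Pth, Var 1, I1, Var 4
     \<bullet> I1 \<bullet> Var 0), (Pth, Var 1, I0, Var 4 \<bullet> Var 2 \<bullet> Var 0), (Pth, Var 0, I1, Var 4 \<bullet> I1 \<bullet> Var 0),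
     (Pth, Var 0, I0, Var 4 \<bullet> Var 3 \<bullet> Var 0)])))"

lemma connection_from_ok: "accepts base_ctx [] connection_from_type connection_from_term"
  by code_simp

definition connection_from_ctx :: ctx where
  "connection_from_ctx = Tm connection_from_type # base_ctx"

definition connection_type :: tm where
  "connection_type = pis [Univ, Var 0, Var 1, Path (Var 2) (Var 1) (Var 0)] (PathT (Path (Var 4)
     (Var 1 \<bullet> Var 0) (Var 2)) (Var 0) (PLam (Var 2)))"

text \<open>Coercing \<open>t\<close> from 0 to \<open>z\<close> along
  \<open>z. Path (t z) c\<close> supplies \<phi>. Its end at 1 is a path from \<open>c\<close> to
  \<open>c\<close> of unknown value, which the box above tolerates.\<close>

definition connection_term :: tm where
  "connection_term = lams 4 (Var 4 \<cdot> Var 3 \<cdot> Var 2 \<cdot> Var 1 \<cdot> Var 0 \<cdot> Coe (Path (Var 4) (Var 1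
     \<bullet> Var 0) (Var 2)) I0 I1 (Var 0) \<cdot> PLam (Coe (Path (Var 5) (Var 2 \<bullet> Var 0) (Var 3)) I0 (Var 0)
     (Var 1)))"

lemma connection_ok: "accepts connection_from_ctx [connection_from_type] connection_type connection_term"
  by code_simp

definition connection_ctx :: ctx where
  "connection_ctx = Tm connection_type # connection_from_ctx"

text \<open>
  Over \<open>v\<close>, both \<open>coe\<^bsub>z. Path (t v) (t z)\<^esub> v 1 refl\<close> and the connection at \<open>v\<close> are paths from \<open>t v\<close>
  to \<open>c\<close>; at \<open>v = 1\<close> both are \<open>refl\<close>, and coercing back to \<open>v = 0\<close> gives the claim.
\<close>

definition refl_comp_type :: tm where
  "refl_comp_type = pis [Univ, Var 0, Var 1, Path (Var 2) (Var 1) (Var 0)] (Path (Path (Var 3)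
     (Var 2) (Var 1)) (Coe (Path (Var 4) (Var 3) (Var 1 \<bullet> Var 0)) I0 I1 (PLam (Var 3))) (Var 0))"

definition refl_comp_term :: tm where
  "refl_comp_term = lams 4 (Coe (Path (Path (Var 4) (Var 1 \<bullet> Var 0) (Var 2)) (Coe (Path (Var 5)
     (Var 2 \<bullet> Var 1) (Var 2 \<bullet> Var 0)) (Var 0) I1 (PLam (Var 2 \<bullet> Var 1))) (Var 5 \<cdot> Var 4 \<cdot> Var 3
     \<cdot> Var 2 \<cdot> Var 1 \<bullet> Var 0)) I1 I0 (PLam (PLam (Var 3))))"

lemma refl_comp_ok: "accepts connection_ctx [connection_type] refl_comp_type refl_comp_term"
  by code_simp

definition refl_comp_ctx :: ctx where
  "refl_comp_ctx = Tm refl_comp_type # connection_ctx"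

text \<open>
  The inverse map \<open>g p X u = coe\<^bsub>z. X (p z)\<^esub> 0 1 u\<close>, packed with its behaviour on \<open>refl\<close> and the
  homotopy from \<open>F \<circ> g\<close> to the identity.
\<close>

definition transport_type :: tm where
  "transport_type = Sig (pis [Var 5, Var 6, Path (Var 7) (Var 1) (Var 0)] (Leibniz (Var 8) (Var 2)
     (Var 1))) (Sig (pis [Var 6, Arrow (Var 7) Univ, Var 0 \<cdot> Var 1] (Path (Var 1 \<cdot> Var 2) (Var 3
     \<cdot> Var 2 \<cdot> Var 2 \<cdot> PLam (Var 3) \<cdot> Var 1 \<cdot> Var 0) (Var 0))) (pis [Var 7, Var 8, Path (Var 9)
     (Var 1) (Var 0)] (Path (Path (Var 10) (Var 2) (Var 1)) (Var 4 \<cdot> Var 2 \<cdot> Var 1 \<cdot> Var 0 \<cdot> (Lam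
     (Path (Var 11) (Var 3) (Var 0))) \<cdot> PLam (Var 3)) (Var 0))))"

text \<open>For the family \<open>Path a\<close>, the transport of \<open>refl\<close> is by \<beta>
  the coercion of \<open>refl_comp_type\<close>, so that result is the homotopy.\<close>

definition transport_term :: tm where
  "transport_term = Pr (asc (pis [Var 5, Var 6, Path (Var 7) (Var 1) (Var 0)] (Leibniz (Var 8)
     (Var 2) (Var 1))) (lams 5 (Coe (Var 2 \<cdot> (Var 3 \<bullet> Var 0)) I0 I1 (Var 0)))) (Pr (lams 3 (PLam
     (Coe (Var 3 \<cdot> Var 4) (Var 0) I1 (Var 1)))) (Lam (Var 1 \<cdot> Var 6 \<cdot> Var 0)))"

lemma transport_ok: "accepts refl_comp_ctx [Univ, refl_comp_type] transport_type transport_term"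
  by code_simp

definition transport_ctx :: ctx where
  "transport_ctx = Tm transport_type # refl_comp_ctx"

text \<open>
  \<open>Leibniz a b\<close> is not small, so its connection is taken pointwise in the family and its element.
\<close>

definition connection_Leibniz_type :: tm where
  "connection_Leibniz_type = pis [Var 6, Var 7, Leibniz (Var 8) (Var 1) (Var 0), Leibniz (Var 9)
     (Var 2) (Var 1), Path (Leibniz (Var 10) (Var 3) (Var 2)) (Var 1) (Var 0)] (PathT (Path (Leibniz
     (Var 12) (Var 5) (Var 4)) (Var 1 \<bullet> Var 0) (Var 2)) (Var 0) (PLam (Var 2)))"

definition connection_Leibniz_term :: tm where
  "connection_Leibniz_term = lams 5 (PLam (PLam (lams 2 (Var 11 \<cdot> (Var 1 \<cdot> Var 7) \<cdot> (Var 6 \<cdot> Var 1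
     \<cdot> Var 0) \<cdot> (Var 5 \<cdot> Var 1 \<cdot> Var 0) \<cdot> PLam (Var 5 \<bullet> Var 0 \<cdot> Var 2 \<cdot> Var 1) \<bullet> Var 3 \<bullet> Var 2))))"

lemma connection_Leibniz_ok:
  "accepts transport_ctx [Univ, connection_type] connection_Leibniz_type connection_Leibniz_term"
  by code_simp

definition connection_Leibniz_ctx :: ctx where
  "connection_Leibniz_ctx = Tm connection_Leibniz_type # transport_ctx"

text \<open>
  If \<open>e : \<Pi>p. Path (f p) p\<close>, coercion along \<open>w. Path (e x w) (e y w)\<close> retracts \<open>q \<mapsto> f q\<close>, because
  \<open>i. e (q i) w\<close> interpolates between \<open>i. f (q i)\<close> and \<open>q\<close>.
\<close>

definition cancel_type :: tm where
  "cancel_type = pis [Univ, Arrow (Var 0) (Var 0), Pi (Var 1) (Path (Var 2) (Var 1 \<cdot> Var 0)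
     (Var 0))] (Sig (pis [Var 2, Var 3] (Arrow (Path (Var 4) (Var 3 \<cdot> Var 1) (Var 3 \<cdot> Var 0)) (Path
     (Var 4) (Var 1) (Var 0)))) (pis [Var 3, Var 4, Path (Var 5) (Var 1) (Var 0)] (Path (Path
     (Var 6) (Var 2) (Var 1)) (Var 3 \<cdot> Var 2 \<cdot> Var 1 \<cdot> PLam (Var 6 \<cdot> (Var 1 \<bullet> Var 0))) (Var 0))))"

definition cancel_term :: tm where
  "cancel_term = lams 3 (Pr (asc (pis [Var 2, Var 3] (Arrow (Path (Var 4) (Var 3 \<cdot> Var 1) (Var 3
     \<cdot> Var 0)) (Path (Var 4) (Var 1) (Var 0)))) (lams 3 (Coe (Path (Var 6) (Var 4 \<cdot> Var 3 \<bullet> Var 0)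
     (Var 4 \<cdot> Var 2 \<bullet> Var 0)) I0 I1 (Var 0)))) (lams 3 (PLam (Coe (Path (Var 7) (Var 5 \<cdot> Var 4
     \<bullet> Var 0) (Var 5 \<cdot> Var 3 \<bullet> Var 0)) (Var 0) I1 (PLam (Var 5 \<cdot> (Var 2 \<bullet> Var 0) \<bullet> Var 1))))))"

lemma cancel_ok: "accepts connection_Leibniz_ctx [] cancel_type cancel_term"
  by code_simp

definition cancel_ctx :: ctx where
  "cancel_ctx = Tm cancel_type # connection_Leibniz_ctx"

text \<open>Coercion along \<open>w. Path (q w) z\<close> and back:
  \<open>coe w 0 (coe 0 w p)\<close> is \<open>p\<close> at \<open>w = 0\<close> and the round trip
  at \<open>w = 1\<close>.\<close>

definition coe_inverse_type :: tm where
  "coe_inverse_type = pis [Var 8, Var 9, Leibniz (Var 10) (Var 1) (Var 0), Leibniz (Var 11) (Var 2)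
     (Var 1), Leibniz (Var 12) (Var 3) (Var 2), Path (Leibniz (Var 13) (Var 4) (Var 3)) (Var 2)
     (Var 1)] (Sig (Arrow (Path (Leibniz (Var 14) (Var 5) (Var 4)) (Var 3) (Var 1)) (Path (Leibniz
     (Var 14) (Var 5) (Var 4)) (Var 2) (Var 1))) (Sig (Arrow (Path (Leibniz (Var 15) (Var 6)
     (Var 5)) (Var 3) (Var 2)) (Path (Leibniz (Var 15) (Var 6) (Var 5)) (Var 4) (Var 2))) (Pi (Path
     (Leibniz (Var 16) (Var 7) (Var 6)) (Var 5) (Var 3)) (Path (Path (Leibniz (Var 17) (Var 8)
     (Var 7)) (Var 6) (Var 4)) (Var 0) (Var 1 \<cdot> (Var 2 \<cdot> Var 0))))))"

definition coe_inverse_term :: tm where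
  "coe_inverse_term = lams 6 (Pr (Lam (Coe (Path (Leibniz (Var 16) (Var 7) (Var 6)) (Var 2 \<bullet> Var 0)
     (Var 3)) I0 I1 (Var 0))) (Pr (Lam (Coe (Path (Leibniz (Var 16) (Var 7) (Var 6)) (Var 2 \<bullet> Var 0)
     (Var 3)) I1 I0 (Var 0))) (Lam (PLam (Coe (Path (Leibniz (Var 17) (Var 8) (Var 7)) (Var 3
     \<bullet> Var 0) (Var 4)) (Var 0) I0 (Coe (Path (Leibniz (Var 17) (Var 8) (Var 7)) (Var 3 \<bullet> Var 0)
     (Var 4)) I0 (Var 0) (Var 1)))))))"

lemma coe_inverse_ok: "accepts cancel_ctx [Univ] coe_inverse_type coe_inverse_term"
  by code_simp

definition coe_inverse_ctx :: ctx where
  "coe_inverse_ctx = Tm coe_inverse_type # cancel_ctx"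

text \<open>
  \<open>Path (F x) y\<close> is a retract of \<open>Path x (G y)\<close>. The section applies \<open>G\<close> and coerces along the path
  from \<open>G (F x)\<close> to \<open>x\<close>; the retraction undoes this coercion, applies \<open>F\<close> and cancels \<open>F \<circ> G\<close>. No
  coherence between the two homotopies is needed.
\<close>

definition retract_type :: tm where
  "retract_type = pis [Var 9, Var 10, Arrow (Leibniz (Var 11) (Var 1) (Var 0)) (Path (Var 11)
     (Var 1) (Var 0)), Arrow (Path (Var 12) (Var 2) (Var 1)) (Leibniz (Var 12) (Var 2) (Var 1)), Sig
     (pis [Path (Var 13) (Var 3) (Var 2), Path (Var 14) (Var 4) (Var 3)] (Arrow (Path (Path (Var 15)
     (Var 5) (Var 4)) (Var 3 \<cdot> (Var 2 \<cdot> Var 1)) (Var 3 \<cdot> (Var 2 \<cdot> Var 0))) (Path (Path (Var 15)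
     (Var 5) (Var 4)) (Var 1) (Var 0)))) (pis [Path (Var 14) (Var 4) (Var 3), Path (Var 15) (Var 5)
     (Var 4), Path (Path (Var 16) (Var 6) (Var 5)) (Var 1) (Var 0)] (Path (Path (Path (Var 17)
     (Var 7) (Var 6)) (Var 2) (Var 1)) (Var 3 \<cdot> Var 2 \<cdot> Var 1 \<cdot> PLam (Var 6 \<cdot> (Var 5 \<cdot> (Var 1
     \<bullet> Var 0)))) (Var 0))), Pi (Leibniz (Var 14) (Var 4) (Var 3)) (Path (Leibniz (Var 15) (Var 5)
     (Var 4)) (Var 2 \<cdot> (Var 3 \<cdot> Var 0)) (Var 0)), Leibniz (Var 15) (Var 5) (Var 4), Path (Var 16)
     (Var 6) (Var 5)] (Sig (Arrow (Path (Path (Var 17) (Var 7) (Var 6)) (Var 5 \<cdot> Var 1) (Var 0))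
     (Path (Leibniz (Var 17) (Var 7) (Var 6)) (Var 1) (Var 4 \<cdot> Var 0))) (Sig (Arrow (Path (Leibniz
     (Var 18) (Var 8) (Var 7)) (Var 2) (Var 5 \<cdot> Var 1)) (Path (Path (Var 18) (Var 8) (Var 7)) (Var 6
     \<cdot> Var 2) (Var 1))) (Pi (Path (Path (Var 19) (Var 9) (Var 8)) (Var 7 \<cdot> Var 3) (Var 2)) (Path
     (Path (Path (Var 20) (Var 10) (Var 9)) (Var 8 \<cdot> Var 4) (Var 3)) (Var 1 \<cdot> (Var 2 \<cdot> Var 0))
     (Var 0)))))"

definition retract_term :: tm where
  "retract_term = lams 8 (Pr (Lam (Fst (Var 9 \<cdot> Var 8 \<cdot> Var 7 \<cdot> (Var 5 \<cdot> (Var 6 \<cdot> Var 2)) \<cdot> Var 2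
     \<cdot> (Var 5 \<cdot> Var 1) \<cdot> (Var 3 \<cdot> Var 2)) \<cdot> PLam (Var 6 \<cdot> (Var 1 \<bullet> Var 0)))) (Pr (Lam (Fst (Var 4)
     \<cdot> (Var 6 \<cdot> Var 2) \<cdot> Var 1 \<cdot> PLam (Var 7 \<cdot> (Fst (Snd (Var 10 \<cdot> Var 9 \<cdot> Var 8 \<cdot> (Var 6 \<cdot> (Var 7
     \<cdot> Var 3)) \<cdot> Var 3 \<cdot> (Var 6 \<cdot> Var 2) \<cdot> (Var 4 \<cdot> Var 3))) \<cdot> Var 1 \<bullet> Var 0)))) (Lam (Coe (Path
     (Path (Path (Var 19) (Var 9) (Var 8)) (Var 7 \<cdot> Var 3) (Var 2)) (Fst (Var 5) \<cdot> (Var 7 \<cdot> Var 3)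
     \<cdot> Var 2 \<cdot> PLam (Var 8 \<cdot> (Snd (Snd (Var 11 \<cdot> Var 10 \<cdot> Var 9 \<cdot> (Var 7 \<cdot> (Var 8 \<cdot> Var 4)) \<cdot> Var 4
     \<cdot> (Var 7 \<cdot> Var 3) \<cdot> (Var 5 \<cdot> Var 4))) \<cdot> PLam (Var 8 \<cdot> (Var 3 \<bullet> Var 0)) \<bullet> Var 1 \<bullet> Var 0)))
     (Var 1)) I0 I1 (Snd (Var 4) \<cdot> (Var 6 \<cdot> Var 2) \<cdot> Var 1 \<cdot> Var 0)))))"

lemma retract_ok: "accepts coe_inverse_ctx [Univ, coe_inverse_type] retract_type retract_term"
  by code_simp

definition retract_ctx :: ctx where
  "retract_ctx = Tm retract_type # coe_inverse_ctx"

text \<open>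
  The connection contracts \<open>\<Sigma>x. Path x (G y)\<close> to \<open>(G y, refl)\<close>, and the fiberwise retraction carries
  this contraction over to the fiber of \<open>F\<close>.
\<close>

definition equivalence_type :: tm where
  "equivalence_type = pis [Var 10, Var 11, Arrow (Leibniz (Var 12) (Var 1) (Var 0)) (Path (Var 12)
     (Var 1) (Var 0)), Arrow (Path (Var 13) (Var 2) (Var 1)) (Leibniz (Var 13) (Var 2) (Var 1)), pis
     [Leibniz (Var 14) (Var 3) (Var 2), Path (Var 15) (Var 4) (Var 3)] (Sig (Arrow (Path (Path
     (Var 16) (Var 5) (Var 4)) (Var 3 \<cdot> Var 1) (Var 0)) (Path (Leibniz (Var 16) (Var 5) (Var 4))
     (Var 1) (Var 2 \<cdot> Var 0))) (Sig (Arrow (Path (Leibniz (Var 17) (Var 6) (Var 5)) (Var 2) (Var 3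
     \<cdot> Var 1)) (Path (Path (Var 17) (Var 6) (Var 5)) (Var 4 \<cdot> Var 2) (Var 1))) (Pi (Path (Path
     (Var 18) (Var 7) (Var 6)) (Var 5 \<cdot> Var 3) (Var 2)) (Path (Path (Path (Var 19) (Var 8) (Var 7))
     (Var 6 \<cdot> Var 4) (Var 3)) (Var 1 \<cdot> (Var 2 \<cdot> Var 0)) (Var 0)))))] (isEquiv (Leibniz (Var 15)
     (Var 4) (Var 3)) (Path (Var 15) (Var 4) (Var 3)) (Var 2))"

definition equivalence_term :: tm where
  "equivalence_term = lams 6 (Pr (Pr (Var 2 \<cdot> Var 0) (Fst (Snd (Var 1 \<cdot> (Var 2 \<cdot> Var 0) \<cdot> Var 0))
     \<cdot> PLam (Var 3 \<cdot> Var 1))) (Lam (Coe (Path (Fiber (Leibniz (Var 18) (Var 7) (Var 6)) (Path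
     (Var 18) (Var 7) (Var 6)) (Var 5) (Var 2)) (Pr (Var 4 \<cdot> Var 2) (Fst (Snd (Var 3 \<cdot> (Var 4
     \<cdot> Var 2) \<cdot> Var 2)) \<cdot> PLam (Var 5 \<cdot> Var 3))) (Pr (Fst (Var 1)) (Snd (Snd (Var 3 \<cdot> Fst (Var 1)
     \<cdot> Var 2)) \<cdot> Snd (Var 1) \<bullet> Var 0))) I0 I1 (Coe (Path (Fiber (Leibniz (Var 18) (Var 7) (Var 6))
     (Path (Var 18) (Var 7) (Var 6)) (Var 5) (Var 2)) (Pr (Var 4 \<cdot> Var 2) (Fst (Snd (Var 3 \<cdot> (Var 4
     \<cdot> Var 2) \<cdot> Var 2)) \<cdot> PLam (Var 5 \<cdot> Var 3))) (Pr (Fst (Var 3 \<cdot> Fst (Var 1) \<cdot> Var 2) \<cdot> Snd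
     (Var 1) \<bullet> Var 0) (Fst (Snd (Var 3 \<cdot> (Fst (Var 3 \<cdot> Fst (Var 1) \<cdot> Var 2) \<cdot> Snd (Var 1) \<bullet> Var 0)
     \<cdot> Var 2)) \<cdot> (Var 11 \<cdot> Var 7 \<cdot> Var 6 \<cdot> Fst (Var 1) \<cdot> (Var 4 \<cdot> Var 2) \<cdot> (Fst (Var 3 \<cdot> Fst (Var 1)
     \<cdot> Var 2) \<cdot> Snd (Var 1)) \<bullet> Var 0)))) I1 I0 (PLam (Pr (Var 4 \<cdot> Var 2) (Fst (Snd (Var 3 \<cdot> (Var 4
     \<cdot> Var 2) \<cdot> Var 2)) \<cdot> PLam (Var 5 \<cdot> Var 3))))))))"

lemma equivalence_ok: "accepts retract_ctx [Univ, connection_Leibniz_type] equivalence_type equivalence_term"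
  by code_simp

definition equivalence_ctx :: ctx where
  "equivalence_ctx = Tm equivalence_type # retract_ctx"

section \<open>Bridge-discreteness: from bridges to paths\<close>

definition fiber_path_type :: tm where
  "fiber_path_type = pis [Univ, Univ, Arrow (Var 1) (Var 0), Var 1, isContr (Fiber (Var 3) (Var 2)
     (Var 1) (Var 0)), Var 4, Path (Var 4) (Var 3 \<cdot> Var 0) (Var 2)] (Path (Var 6) (Fst (Fst
     (Var 2))) (Var 1))"

definition fiber_path_term :: tm where
  "fiber_path_term = lams 7 (PLam (Fst (Snd (Var 3) \<cdot> Pr (Var 2) (Var 1) \<bullet> Var 0)))"

lemma fiber_path_ok: "accepts equivalence_ctx [] fiber_path_type fiber_path_term"
  by code_simp

definition fiber_path_ctx :: ctx where
  "fiber_path_ctx = Tm fiber_path_type # equivalence_ctx"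

text \<open>
  The inverse of \<open>loosen\<close>, and the fact that it sends the constant bridge to \<open>refl\<close> up to a path.
\<close>

definition tight_type :: tm where
  "tight_type = Sig (pis [Var 12, Var 13, Bridge (Var 14) (Var 1) (Var 0)] (Path (Var 15) (Var 2)
     (Var 1))) (Pi (Var 13) (Path (Path (Var 14) (Var 0) (Var 0)) (Var 1 \<cdot> Var 0 \<cdot> Var 0 \<cdot> BLam
     (Var 1)) (PLam (Var 1))))"

text \<open>The final coercion from \<open>z\<close> to 1 is a path from \<open>loosen\<close> of
  \<open>refl\<close> to the constant bridge; hence \<open>refl\<close> lies in its fiber.\<close>

definition tight_term :: tm where
  "tight_term = Pr (asc (pis [Var 12, Var 13, Bridge (Var 14) (Var 1) (Var 0)] (Path (Var 15)
     (Var 2) (Var 1))) (lams 3 (Fst (Fst (Var 14 \<cdot> Var 2 \<cdot> Var 1 \<cdot> Var 0))))) (Lam (Var 1 \<cdot> Path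
     (Var 13) (Var 0) (Var 0) \<cdot> Bridge (Var 13) (Var 0) (Var 0) \<cdot> (Lam (loosen (Var 14) (Var 0)))
     \<cdot> BLam (Var 1) \<cdot> (Var 12 \<cdot> Var 0 \<cdot> Var 0 \<cdot> BLam (Var 1)) \<cdot> PLam (Var 1) \<cdot> PLam (Coe (Bridge
     (Var 15) (Var 2) (Var 2)) (Var 0) I1 (BLam (Var 2)))))"

lemma tight_ok: "accepts fiber_path_ctx [Univ, isBDisc (Var 0), fiber_path_type] tight_type tight_term"
  by code_simp

definition tight_ctx :: ctx where
  "tight_ctx = Tm tight_type # fiber_path_ctx"

text \<open>\<open>compose a b\<^sub>0 b\<^sub>1 c p\<close> is the path \<open>p : Path a b\<^sub>0\<close> followed by \<open>tight c : Path b\<^sub>0 b\<^sub>1\<close>.\<close>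

definition compose_type :: tm where
  "compose_type = Sig (pis [Var 13, Var 14, Var 15, Bridge (Var 16) (Var 1) (Var 0), Path (Var 17)
     (Var 3) (Var 2)] (Path (Var 18) (Var 4) (Var 2))) (pis [Var 14, Var 15, Path (Var 16) (Var 1)
     (Var 0)] (Path (Path (Var 17) (Var 2) (Var 1)) (Var 3 \<cdot> Var 2 \<cdot> Var 1 \<cdot> Var 1 \<cdot> BLam (Var 2)
     \<cdot> Var 0) (Var 0)))"

text \<open>For the unit law, \<open>tight\<close> of the constant bridge is first moved to
  \<open>refl\<close>; what remains is a coercion of \<open>p\<close> along a constant line, which
  shrinks to \<open>p\<close>.\<close>

definition compose_term :: tm where
  "compose_term = Pr (asc (pis [Var 13, Var 14, Var 15, Bridge (Var 16) (Var 1) (Var 0), Path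
     (Var 17) (Var 3) (Var 2)] (Path (Var 18) (Var 4) (Var 2))) (lams 5 (Coe (Path (Var 19) (Var 5)
     (Fst (Var 6) \<cdot> Var 4 \<cdot> Var 3 \<cdot> Var 2 \<bullet> Var 0)) I0 I1 (Var 0)))) (lams 3 (Coe (Path (Path
     (Var 17) (Var 3) (Var 2)) (Coe (Path (Var 18) (Var 4) (Fst (Var 5) \<cdot> Var 3 \<cdot> Var 3 \<cdot> BLam
     (Var 4) \<bullet> Var 0)) I0 I1 (Var 1)) (Coe (Path (Var 18) (Var 4) (Var 3)) (Var 0) I1 (Var 1))) I0
     I1 (PLam (Coe (Path (Var 18) (Var 4) (Snd (Var 5) \<cdot> Var 3 \<bullet> Var 1 \<bullet> Var 0)) I0 I1 (Var 1)))))"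

lemma compose_ok: "accepts tight_ctx [Univ, tight_type] compose_type compose_term"
  by code_simp

definition compose_ctx :: ctx where
  "compose_ctx = Tm compose_type # tight_ctx"

text \<open>
  Parametricity of \<open>k\<close> for the relation between \<open>Path a\<close> and \<open>Y\<close> that relates \<open>p : Path a b\<^sub>0\<close> and
  \<open>y : Y b\<^sub>1\<close> over a bridge \<open>c\<close> if the transport of \<open>u\<close> along \<open>compose a b\<^sub>0 b\<^sub>1 c p\<close> is connected
  to \<open>y\<close>. It relates \<open>refl\<close> and \<open>u\<close>, hence also \<open>k (Path a) refl\<close> and \<open>k Y u\<close>.
\<close>

definition naturality_type :: tm where
  "naturality_type = pis [Var 14, Var 15, Leibniz (Var 16) (Var 1) (Var 0), Arrow (Var 17) Univ,
     Var 0 \<cdot> Var 3] (Path (Var 1 \<cdot> Var 3) (Fst (Var 13) \<cdot> Var 4 \<cdot> Var 3 \<cdot> (Var 2 \<cdot> (Lam (Path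
     (Var 20) (Var 5) (Var 0))) \<cdot> PLam (Var 5)) \<cdot> Var 1 \<cdot> Var 0) (Var 2 \<cdot> Var 1 \<cdot> Var 0))"

text \<open>Over a constant bridge the relation still contains \<open>compose\<close>. Coercions
  along its unit law insert it in the premise (from 1 to 0) and remove it in the conclusion (from 0
  to 1).\<close>

definition naturality_term :: tm where
  "naturality_term = lams 5 (Coe (Path (Var 2 \<cdot> Var 4) (Fst (Var 14) \<cdot> Var 5 \<cdot> Var 4 \<cdot> (Snd (Var 6)
     \<cdot> Var 5 \<cdot> Var 4 \<cdot> (Var 3 \<cdot> (Lam (Path (Var 21) (Var 6) (Var 0))) \<cdot> PLam (Var 6)) \<bullet> Var 0)
     \<cdot> Var 2 \<cdot> Var 1) (Var 3 \<cdot> Var 2 \<cdot> Var 1)) I0 I1 (Var 17 \<cdot> Var 19 \<cdot> Var 4 \<cdot> Var 3 \<cdot> Var 2 \<cdot> (Lam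
     (Path (Var 20) (Var 5) (Var 0))) \<cdot> Var 1 \<cdot> asc (pis [Var 19, Var 20, Bridge (Var 21) (Var 1)
     (Var 0), Path (Var 22) (Var 7) (Var 2), Var 5 \<cdot> Var 2] Univ) (lams 5 (Path (Var 6 \<cdot> Var 3) (Fst
     (Var 18) \<cdot> Var 9 \<cdot> Var 3 \<cdot> (Fst (Var 10) \<cdot> Var 9 \<cdot> Var 4 \<cdot> Var 3 \<cdot> Var 2 \<cdot> Var 1) \<cdot> Var 6
     \<cdot> Var 5) (Var 0))) \<cdot> PLam (Var 5) \<cdot> Var 0 \<cdot> Coe (Path (Var 2 \<cdot> Var 5) (Fst (Var 14) \<cdot> Var 5
     \<cdot> Var 5 \<cdot> (Snd (Var 6) \<cdot> Var 5 \<cdot> Var 5 \<cdot> PLam (Var 6) \<bullet> Var 0) \<cdot> Var 2 \<cdot> Var 1) (Var 1)) I1 I0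
     (Fst (Snd (Var 13)) \<cdot> Var 4 \<cdot> Var 1 \<cdot> Var 0)))"

lemma naturality_ok:
  "accepts compose_ctx [Univ, param_type, transport_type, compose_type] naturality_type naturality_term"
  by code_simp

definition naturality_ctx :: ctx where
  "naturality_ctx = Tm naturality_type # compose_ctx"

definition naturality_path_type :: tm where
  "naturality_path_type = pis [Var 15, Var 16, Leibniz (Var 17) (Var 1) (Var 0)] (Path (Leibniz
     (Var 18) (Var 2) (Var 1)) (Fst (Var 12) \<cdot> Var 2 \<cdot> Var 1 \<cdot> (Var 0 \<cdot> (Lam (Path (Var 19) (Var 3)
     (Var 0))) \<cdot> PLam (Var 3))) (Var 0))"

definition naturality_path_term :: tm where
  "naturality_path_term = lams 3 (PLam (lams 2 (Var 6 \<cdot> Var 5 \<cdot> Var 4 \<cdot> Var 3 \<cdot> Var 1 \<cdot> Var 0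
     \<bullet> Var 2)))"

lemma naturality_path_ok:
  "accepts naturality_ctx [Univ, transport_type, naturality_type] naturality_path_type
     naturality_path_term"
  by code_simp

definition naturality_path_ctx :: ctx where
  "naturality_path_ctx = Tm naturality_path_type # naturality_ctx"

definition leibniz_equiv_type :: tm where
  "leibniz_equiv_type = pis [Var 16, Var 17] (Equiv (Leibniz (Var 18) (Var 1) (Var 0)) (Path
     (Var 18) (Var 1) (Var 0)))"

text \<open>The retracts needed for the equivalence come from \<open>retract_type\<close>, whose
  hypothesis on \<open>F\<close> after \<open>G\<close> is \<open>cancel_type\<close> at the unit
  law.\<close>

definition leibniz_equiv_term :: tm where
  "leibniz_equiv_term = lams 2 (Pr (asc (Arrow (Leibniz (Var 18) (Var 1) (Var 0)) (Path (Var 18)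
     (Var 1) (Var 0))) (Lam (Var 0 \<cdot> (Lam (Path (Var 20) (Var 3) (Var 0))) \<cdot> PLam (Var 3)))) (Var 7
     \<cdot> Var 1 \<cdot> Var 0 \<cdot> asc (Arrow (Leibniz (Var 18) (Var 1) (Var 0)) (Path (Var 18) (Var 1)
     (Var 0))) (Lam (Var 0 \<cdot> (Lam (Path (Var 20) (Var 3) (Var 0))) \<cdot> PLam (Var 3))) \<cdot> (Fst (Var 12)
     \<cdot> Var 1 \<cdot> Var 0) \<cdot> (Var 8 \<cdot> Var 1 \<cdot> Var 0 \<cdot> asc (Arrow (Leibniz (Var 18) (Var 1) (Var 0)) (Path
     (Var 18) (Var 1) (Var 0))) (Lam (Var 0 \<cdot> (Lam (Path (Var 20) (Var 3) (Var 0))) \<cdot> PLam (Var 3)))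
     \<cdot> (Fst (Var 12) \<cdot> Var 1 \<cdot> Var 0) \<cdot> (Var 10 \<cdot> Path (Var 18) (Var 1) (Var 0) \<cdot> asc (Arrow (Path
     (Var 18) (Var 1) (Var 0)) (Path (Var 18) (Var 1) (Var 0))) (Lam (Fst (Var 13) \<cdot> Var 2 \<cdot> Var 1
     \<cdot> Var 0 \<cdot> (Lam (Path (Var 20) (Var 3) (Var 0))) \<cdot> PLam (Var 3))) \<cdot> (Snd (Snd (Var 12)) \<cdot> Var 1
     \<cdot> Var 0)) \<cdot> (Var 2 \<cdot> Var 1 \<cdot> Var 0))))"

lemma leibniz_equiv_ok:
  "accepts naturality_path_ctx [Univ, transport_type, cancel_type, retract_type, equivalence_type,
     naturality_path_type] leibniz_equiv_type leibniz_equiv_term"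
  by code_simp

definition leibniz_equiv_ctx :: ctx where
  "leibniz_equiv_ctx = Tm leibniz_equiv_type # naturality_path_ctx"

section \<open>The equivalence\<close>

lemma upr_upr: "upr f (upr g i) = upr (\<lambda>i. f (g i)) i"
  by (auto simp: upr_def split: nat.splits)

text \<open>The substituted \<open>A\<close> picks up one weakening per binder; fusion collects them
  into the form used in the statements.\<close>

lemma ren_ren: "ren f (ren g M) = ren (\<lambda>i. f (g i)) M"
  by (induction g M arbitrary: f rule: ren.induct) (auto simp: upr_upr)

lemmas type_defs = isBDisc_def isEquiv_def isContr_def Fiber_def Path_def Bridge_def loosen_def
  Arrow_def Leibniz_def Equiv_def pis_def

lemma sub_isBDisc: "sub (\<lambda>_. A) (isBDisc (Var 0)) = isBDisc A"
  by (simp add: type_defs up_def ren_ren upr_def)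

lemma model_base_ctx:
  assumes "\<turnstile> \<Gamma>" and "\<Gamma> \<turnstile> A \<Colon> Univ" and "\<Gamma> \<turnstile> D \<Colon> isBDisc A"
  shows "model \<Gamma> A base_ctx"
proof -
  \<comment> \<open>Beyond index 0 the value is always \<open>A\<close>, so that
    \<open>\<tau> \<circ> Suc\<close> is the constant substitution of
    \<open>sub_isBDisc\<close>.\<close>
  define \<tau> where "\<tau> = case_nat D (\<lambda>_. A)"
  have "\<Gamma> \<turnstile> sub \<tau> param_term \<Colon> sub \<tau> param_type" using param sub_nil[OF assms(1)] by (rule tm_sub)
  moreover have "case_nat (sub \<tau> param_term) \<tau> \<circ> Suc = \<tau>" "\<tau> \<circ> Suc = (\<lambda>_. A)" "(\<lambda>_. A) \<circ> Suc = (\<lambda>_. A)" by (auto simp: \<tau>_def)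
  ultimately have "sat \<Gamma> (case_nat (sub \<tau> param_term) \<tau>) base_ctx"
    using assms by (simp add: base_ctx_def sub_isBDisc) (simp add: \<tau>_def)
  then show ?thesis unfolding model_def by (auto simp: base_ctx_def \<tau>_def intro!: exI[of _ "case_nat (sub \<tau> param_term) \<tau>"])
qed

theorem theorem11p3:
  fixes \<Gamma> :: ctx and A :: tm
  assumes "\<turnstile> \<Gamma>"
    and "\<Gamma> \<turnstile> A \<Colon> Univ"
    and "bridge_discrete \<Gamma> A"
  shows "\<exists>E. \<Gamma> \<turnstile> E \<Colon> Pi A (Pi (wk 1 A)
           (Equiv (Leibniz (wk 2 A) (Var 1) (Var 0)) (Path (wk 2 A) (Var 1) (Var 0))))"
proof -
  obtain D where "\<Gamma> \<turnstile> D \<Colon> isBDisc A" using assms(3) by (auto simp: bridge_discrete_def)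
  with assms(1,2) have "model \<Gamma> A base_ctx" by (rule model_base_ctx)
  then have "model \<Gamma> A connection_from_ctx"
    unfolding connection_from_ctx_def by (rule model_step[OF assms(1) _ connection_from_ok])
  then have "model \<Gamma> A connection_ctx"
    unfolding connection_ctx_def by (rule model_step[OF assms(1) _ connection_ok])
  then have "model \<Gamma> A refl_comp_ctx"
    unfolding refl_comp_ctx_def by (rule model_step[OF assms(1) _ refl_comp_ok])
  then have "model \<Gamma> A transport_ctx"
    unfolding transport_ctx_def by (rule model_step[OF assms(1) _ transport_ok])
  then have "model \<Gamma> A connection_Leibniz_ctx"
    unfolding connection_Leibniz_ctx_def by (rule model_step[OF assms(1) _ connection_Leibniz_ok])
  then have "model \<Gamma> A cancel_ctx"
    unfolding cancel_ctx_def by (rule model_step[OF assms(1) _ cancel_ok])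
  then have "model \<Gamma> A coe_inverse_ctx"
    unfolding coe_inverse_ctx_def by (rule model_step[OF assms(1) _ coe_inverse_ok])
  then have "model \<Gamma> A retract_ctx"
    unfolding retract_ctx_def by (rule model_step[OF assms(1) _ retract_ok])
  then have "model \<Gamma> A equivalence_ctx"
    unfolding equivalence_ctx_def by (rule model_step[OF assms(1) _ equivalence_ok])
  then have "model \<Gamma> A fiber_path_ctx"
    unfolding fiber_path_ctx_def by (rule model_step[OF assms(1) _ fiber_path_ok])
  then have "model \<Gamma> A tight_ctx"
    unfolding tight_ctx_def by (rule model_step[OF assms(1) _ tight_ok])
  then have "model \<Gamma> A compose_ctx"
    unfolding compose_ctx_def by (rule model_step[OF assms(1) _ compose_ok])
  then have "model \<Gamma> A naturality_ctx"
    unfolding naturality_ctx_def by (rule model_step[OF assms(1) _ naturality_ok])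
  then have "model \<Gamma> A naturality_path_ctx"
    unfolding naturality_path_ctx_def by (rule model_step[OF assms(1) _ naturality_path_ok])
  then have "model \<Gamma> A leibniz_equiv_ctx"
    unfolding leibniz_equiv_ctx_def by (rule model_step[OF assms(1) _ leibniz_equiv_ok])
  then obtain \<sigma> where \<sigma>: "\<Gamma> \<turnstile> \<sigma> 0 \<Colon> sub (\<sigma> \<circ> Suc) leibniz_equiv_type" and A: "\<sigma> (length leibniz_equiv_ctx - 1) = A"
    unfolding model_def by (auto simp: leibniz_equiv_ctx_def)
  \<comment> \<open>Three entries of \<open>base_ctx\<close> and fifteen results lie in the context,
    with \<open>A\<close> at the bottom.\<close>
  have "\<sigma> 17 = A"
    using A by (simp add: numeral_eq_Suc base_ctx_def connection_from_ctx_def connection_ctx_def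
      refl_comp_ctx_def transport_ctx_def connection_Leibniz_ctx_def cancel_ctx_def coe_inverse_ctx_def
      retract_ctx_def equivalence_ctx_def fiber_path_ctx_def tight_ctx_def
      compose_ctx_def naturality_ctx_def naturality_path_ctx_def leibniz_equiv_ctx_def)
  then have "sub (\<sigma> \<circ> Suc) leibniz_equiv_type = Pi A (Pi (wk 1 A)
      (Equiv (Leibniz (wk 2 A) (Var 1) (Var 0)) (Path (wk 2 A) (Var 1) (Var 0))))"
    by (simp add: leibniz_equiv_type_def type_defs up_def ren_ren upr_def)
  then show ?thesis using \<sigma> by metis
qed

end
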